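(* Let $\mathbb{B}$ be a real Banach space, let $A:\mathcal{D}(A)\subset\mathbb{B}\to\mathbb{B}$ be a linear closed densely defined (possibly unbounded) operator generating a strongly continuous semigroup $\Psi(s):\mathbb{B}\to\mathbb{B}$, $s\ge0$, of linear bounded operators, let $B:\mathbb{R}^m\to\mathbb{B}$ and $C:\mathbb{B}\to\mathbb{R}^k$ be linear bounded operators, let $\gamma\in L^\infty(\mathbb{R};\mathbb{R}^m)$, and let $\tilde u:\mathbb{R}\times\mathbb{R}^k\to\mathbb{R}^m$ be a measurable function. For $t^0\in\mathbb{R}$ and $x^0\in\mathcal{D}(A)$ consider the system $$\dot x(t)=Ax(t)+B(u(t)+\gamma(t)),\quad t>t^0,\quad x(t^0)=x^0,\qquad y(t)=Cx(t),\qquad u(t)=\tilde u(t,y(t)),$$ and let $x(t,t^0,x^0)$ denote an Utkin solution of it. Let $\mathrm{range}(B)\subset\mathcal{D}(A^2)$ and let $\tilde u$ satisfy the Filippov (resp., Carathéodory) Condition. If the Utkin solution $x(t,t^0,x^0)$ is unique on $\mathcal{I}$ (an interval starting at $t^0$), then it depends continuously on initial data: $x(t,t^1,x^1)\to x(t,t^0,x^0)$ as $|t^1-t^0|+\|x^1-x^0\|_{\mathbb{B}}+\|Ax^1-Ax^0\|_{\mathbb{B}}\to0$ (with $x^1\in\mathcal{D}(A)$), uniformly on compacts from $\mathcal{I}$.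
   Context: $\|\cdot\|$ is the Euclidean norm and $\mathcal{B}(r)\subset\mathbb{R}^k$ is the open ball of radius $r>0$ centered at $0$. $\mathcal{D}(A^2)=\{x\in\mathcal{D}(A):Ax\in\mathcal{D}(A)\}$. Filippov Condition for $\tilde u$: $\tilde u$ is measurable and for any $\alpha,r>0$ there exists $m_{\alpha,r}\in L^1((-\alpha,\alpha);\mathbb{R})$ such that $\|\tilde u(t,y)\|\le m_{\alpha,r}(t)$ for almost all $t\in(-\alpha,\alpha)$ and almost all $y\in\mathcal{B}(r)$. Carathéodory Condition: $\tilde u$ is measurable in $t$ for all $y$, continuous in $y$ for almost all $t$, and for any $\alpha,r>0$ there exists $m_{\alpha,r}\in L^1((-\alpha,\alpha);\mathbb{R})$ with $\|\tilde u(t,y)\|\le m_{\alpha,r}(t)$ for almost all $t\in(-\alpha,\alpha)$ and all $y\in\mathcal{B}(r)$. Filippov regularization: $K[\tilde u](t,y)=\bigcap_{\delta>0}\bigcap_{\mu(M)=0}\overline{\mathrm{co}}\,\tilde u(t,y+\mathcal{B}(\delta)\setminus M)$, where $\overline{\mathrm{co}}$ is the convex closure and the intersections are over all $\delta>0$ and all $M\subset\mathbb{R}^k$ of Lebesgue measure zero. Utkin solution of the first (resp. second) kind: a continuous function $x:[t^0,t^0+T)\to\mathbb{B}$, $0<T\le+\infty$, with $x(t^0)=x^0$, satisfying $x(t)=\Psi(t-t^0)x^0+\int_{t^0}^t\Psi(t-\tau)B(u_{\rm eq}(\tau)+\gamma(\tau))\,d\tau$ (Bochner integral) with some $u_{\rm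 eq}\in L^1((t^0,t^0+T);\mathbb{R}^m)$ such that $u_{\rm eq}(t)\in U(t,Cx(t))$ for almost all $t\in(t^0,t^0+T)$, where $U=K[\tilde u]$ (resp. $U=(K[\tilde u_1],\dots,K[\tilde u_m])^\top$, the product set). When $T=+\infty$, integrability of $u_{\rm eq}$ is understood locally, on bounded intervals. Since solutions with initial time $t^1$ are defined for $t\ge t^1$ only, the convergence on a compact from $\mathcal{I}$ concerns those $t$ in it with $t\ge t^1$. *)

theory Defs
  imports "HOL-Analysis.Analysis"
begin

(* The library's has_bochner_integral is restricted to second countable (separable) target
   spaces. This is Bochner's definition for an arbitrary normed target: f is an almost everywhere
   limit of integrable simple functions s i with integral of norm (f - s i) tending to 0, and I is
   the limit of the integrals of the s i. *)
definition has_strong_bochner_integral ::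
    "'a measure \<Rightarrow> ('a \<Rightarrow> 'b::real_normed_vector) \<Rightarrow> 'b \<Rightarrow> bool" where
  "has_strong_bochner_integral M f I \<longleftrightarrow>
     (\<exists>s. (\<forall>i::nat. Bochner_Integration.simple_bochner_integrable M (s i)) \<and>
          (AE \<tau> in M. (\<lambda>i. s i \<tau>) \<longlonglongrightarrow> f \<tau>) \<and>
          (\<lambda>i. \<integral>\<^sup>+\<tau>. ennreal (norm (f \<tau> - s i \<tau>)) \<partial>M) \<longlonglongrightarrow> 0 \<and>
          (\<lambda>i. Bochner_Integration.simple_bochner_integral M (s i)) \<longlonglongrightarrow> I)"

(* Only the values \<Psi> s with s \<ge> 0 matter. *)
definition C0_semigroup :: "(real \<Rightarrow> 'b::real_normed_vector \<Rightarrow> 'b) \<Rightarrow> bool" where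
  "C0_semigroup \<Psi> \<longleftrightarrow>
     (\<forall>s\<ge>0. bounded_linear (\<Psi> s)) \<and>
     (\<forall>x. \<Psi> 0 x = x) \<and>
     (\<forall>s\<ge>0. \<forall>t\<ge>0. \<forall>x. \<Psi> (s + t) x = \<Psi> s (\<Psi> t x)) \<and>
     (\<forall>x. ((\<lambda>s. \<Psi> s x) \<longlongrightarrow> x) (at_right 0))"

(* An unbounded operator is a pair of its domain D and a function A whose values outside D
   are irrelevant. *)
definition linear_operator_on :: "'b::real_normed_vector set \<Rightarrow> ('b \<Rightarrow> 'b) \<Rightarrow> bool" where
  "linear_operator_on D A \<longleftrightarrow>
     subspace D \<and>
     (\<forall>x\<in>D. \<forall>y\<in>D. A (x + y) = A x + A y) \<and>
     (\<forall>c. \<forall>x\<in>D. A (c *\<^sub>R x) = c *\<^sub>R A x)"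

definition closed_operator_on :: "'b::real_normed_vector set \<Rightarrow> ('b \<Rightarrow> 'b) \<Rightarrow> bool" where
  "closed_operator_on D A \<longleftrightarrow> closed ((\<lambda>x. (x, A x)) ` D)"

definition generates ::
    "'b::real_normed_vector set \<Rightarrow> ('b \<Rightarrow> 'b) \<Rightarrow> (real \<Rightarrow> 'b \<Rightarrow> 'b) \<Rightarrow> bool" where
  "generates D A \<Psi> \<longleftrightarrow>
     D = {x. \<exists>l. ((\<lambda>h. (\<Psi> h x - x) /\<^sub>R h) \<longlongrightarrow> l) (at_right 0)} \<and>
     (\<forall>x\<in>D. ((\<lambda>h. (\<Psi> h x - x) /\<^sub>R h) \<longlongrightarrow> A x) (at_right 0))"

definition domain_sq :: "'b set \<Rightarrow> ('b \<Rightarrow> 'b) \<Rightarrow> 'b set" where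
  "domain_sq D A = {x \<in> D. A x \<in> D}"

definition Linfty :: "(real \<Rightarrow> 'v::euclidean_space) \<Rightarrow> bool" where
  "Linfty \<gamma> \<longleftrightarrow> \<gamma> \<in> borel_measurable lebesgue \<and> (\<exists>c. AE t in lebesgue. norm (\<gamma> t) \<le> c)"

definition filippov_condition ::
    "(real \<Rightarrow> 'y::euclidean_space \<Rightarrow> 'v::euclidean_space) \<Rightarrow> bool" where
  "filippov_condition u \<longleftrightarrow>
     (\<lambda>(t, y). u t y) \<in> borel_measurable lebesgue \<and>
     (\<forall>\<alpha>>0. \<forall>r>0. \<exists>m::real \<Rightarrow> real.
        set_integrable lebesgue {-\<alpha><..<\<alpha>} m \<and>
        (AE t in lebesgue. t \<in> {-\<alpha><..<\<alpha>} \<longrightarrow>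
           (AE y in lebesgue. y \<in> ball 0 r \<longrightarrow> norm (u t y) \<le> m t)))"

definition caratheodory_condition ::
    "(real \<Rightarrow> 'y::euclidean_space \<Rightarrow> 'v::euclidean_space) \<Rightarrow> bool" where
  "caratheodory_condition u \<longleftrightarrow>
     (\<forall>y. (\<lambda>t. u t y) \<in> borel_measurable lebesgue) \<and>
     (AE t in lebesgue. continuous_on UNIV (u t)) \<and>
     (\<forall>\<alpha>>0. \<forall>r>0. \<exists>m::real \<Rightarrow> real.
        set_integrable lebesgue {-\<alpha><..<\<alpha>} m \<and>
        (AE t in lebesgue. t \<in> {-\<alpha><..<\<alpha>} \<longrightarrow>
           (\<forall>y\<in>ball 0 r. norm (u t y) \<le> m t)))"

definition filippov_reg ::
    "(real \<Rightarrow> 'y::euclidean_space \<Rightarrow> 'v::real_normed_vector) \<Rightarrow> real \<Rightarrow> 'y \<Rightarrow> 'v set" where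
  "filippov_reg u t y =
     (\<Inter>\<delta>\<in>{0<..}. \<Inter>M\<in>null_sets lebesgue. closure (convex hull (u t ` (ball y \<delta> - M))))"

definition filippov_reg_componentwise ::
    "(real \<Rightarrow> 'y::euclidean_space \<Rightarrow> real ^ 'm) \<Rightarrow> real \<Rightarrow> 'y \<Rightarrow> (real ^ 'm) set" where
  "filippov_reg_componentwise u t y = {v. \<forall>i. v $ i \<in> filippov_reg (\<lambda>s z. u s z $ i) t y}"

definition lifespan :: "real \<Rightarrow> ereal \<Rightarrow> real set" where
  "lifespan t0 T = {t. t0 \<le> t \<and> ereal t < ereal t0 + T}"

(* x is a solution on [t0, t0 + T), with T = \<infinity> allowed; its values elsewhere are irrelevant.
   U is filippov_reg u for solutions of the first kind and filippov_reg_componentwise u for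
   solutions of the second kind. The integrability clause is integrability on (t0, t0 + T) for
   finite T (take b = t0 + T) and integrability on bounded intervals for T = \<infinity>. *)
definition utkin_solution ::
    "(real \<Rightarrow> 'b::real_normed_vector \<Rightarrow> 'b) \<Rightarrow> ('v::euclidean_space \<Rightarrow> 'b) \<Rightarrow>
     ('b \<Rightarrow> 'y::euclidean_space) \<Rightarrow> (real \<Rightarrow> 'v) \<Rightarrow> (real \<Rightarrow> 'y \<Rightarrow> 'v set) \<Rightarrow>
     real \<Rightarrow> 'b \<Rightarrow> ereal \<Rightarrow> (real \<Rightarrow> 'b) \<Rightarrow> bool" where
  "utkin_solution \<Psi> B C \<gamma> U t0 x0 T x \<longleftrightarrow>
     0 < T \<and> continuous_on (lifespan t0 T) x \<and> x t0 = x0 \<and>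
     (\<exists>ueq. (\<forall>b. ereal b \<le> ereal t0 + T \<longrightarrow> set_integrable lebesgue {t0<..<b} ueq) \<and>
            (AE t in lebesgue. t \<in> lifespan t0 T \<longrightarrow> ueq t \<in> U t (C (x t))) \<and>
            (\<forall>t\<in>lifespan t0 T. \<exists>I.
               has_strong_bochner_integral lebesgue
                 (\<lambda>\<tau>. indicator {t0<..<t} \<tau> *\<^sub>R \<Psi> (t - \<tau>) (B (ueq \<tau> + \<gamma> \<tau>))) I \<and>
               x t = \<Psi> (t - t0) x0 + I))"

end

theory Submission
  imports Defs "HOL-Complex_Analysis.Great_Picard"
begin

text \<open>
  A solution with initial data \<open>(t1, x1)\<close> is determined by the input \<open>w = ueq + \<gamma>\<close> through
  \<open>x t = \<Psi> (t - t1) x1 + \<integral> \<Psi> (t - \<tau>) (B (w \<tau>)) d\<tau>\<close>. The input takes values in a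
  finite-dimensional space, so \<open>s \<mapsto> \<Psi> s \<circ> B\<close> is continuous in operator norm although the
  semigroup itself is only strongly continuous. This makes inputs dominated by one integrable
  function behave as in a finite-dimensional equation:

  \<^item> Along a subsequence the primitives of the inputs converge uniformly (Arzela-Ascoli), and then so
    do the state-space integrals, because on a short interval the kernel is almost constant and only
    the increment of the primitive matters (\<open>duhamel_uniformly_convergent_subsequence\<close>).
  \<^item> The limit is again the integral of some input, whose value at almost every time lies in the
    closed convex hull of every tail of the sequence of values (\<open>duhamel_limit_representation\<close>, an
    elementary form of Mazur's lemma).

  A value of the Filippov regularization is an intersection of closed convex sets that belong to
  balls of radius \<open>\<delta> > 0\<close> around \<open>y\<close>, and these sets grow with the ball. Hence the second item
  says precisely that the limit of inputs that are admissible up to errors \<open>\<delta> n \<longlonglongrightarrow> 0\<close> is admissible,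
  and limits of approximate solutions are solutions (\<open>traj_compactness\<close>). Applied to equations with
  a small delay, driven by averages of \<open>u\<close> over small balls, this gives existence
  (\<open>inclusion_solution_exists\<close>). Applied to solutions whose initial data converge to
  \<open>(t0, x0)\<close>, it gives a subsequence converging uniformly to a solution from \<open>(t0, x0)\<close>, which by
  uniqueness is \<open>x\<close>; so no sequence can stay away from \<open>x\<close> (\<open>inclusion_solution_stability\<close>).

  An integrable bound of the inputs is available only while the output \<open>C x\<close> stays in a bounded set.
  The output is therefore first projected onto a ball that contains a neighbourhood of the reference
  output on the compact interval. For the projected inclusion all solutions are global, and by a
  first-exit argument the projection is inactive along solutions that start close to the reference
  (\<open>continuous_dependence\<close>). Both kinds of regularization fit into this scheme, the second one
  component by component.
\<close>

section \<open>Strong Bochner integrals as gauge integrals\<close>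

text \<open>
  Solutions are defined through Bochner integrals in a possibly non-separable space. The gauge
  integral has a full calculus in every Banach space, and the following lemmas identify the two
  notions for the integrands that occur here, so that all later estimates can use gauge integrals.
\<close>
lemma simple_bochner_has_integral:
  fixes s :: "'a::euclidean_space \<Rightarrow> 'b::real_normed_vector"
  assumes s: "Bochner_Integration.simple_bochner_integrable lebesgue s" and A: "A \<in> sets lebesgue"
  shows "(s has_integral (\<Sum>y\<in>range s. measure lebesgue (A \<inter> s -` {y}) *\<^sub>R y)) A"
proof -
  have fin: "finite (range s)" and sets: "s -` Y \<in> sets lebesgue" for Y
    using s simple_functionD[of lebesgue s] by (auto simp: simple_bochner_integrable.simps)
  have supp: "emeasure lebesgue {x. s x \<noteq> 0} \<noteq> \<infinity>"
    using s by (auto simp: simple_bochner_integrable.simps)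
  have supp_sets: "{x. s x \<noteq> 0} \<in> sets lebesgue"
    using sets[of "-{0}"] by (simp add: vimage_def)
  have *: "((\<lambda>x. indicat_real (s -` {y}) x *\<^sub>R y) has_integral measure lebesgue (A \<inter> s -` {y}) *\<^sub>R y) A" for y
  proof (cases "y = 0")
    case False
    have "emeasure lebesgue (A \<inter> s -` {y}) \<le> emeasure lebesgue {x. s x \<noteq> 0}"
      using False supp_sets by (intro emeasure_mono) auto
    then have "A \<inter> s -` {y} \<in> lmeasurable"
      using A sets supp by (auto intro!: fmeasurableI simp: less_top top_unique)
    then have "(indicat_real (A \<inter> s -` {y}) has_integral measure lebesgue (A \<inter> s -` {y})) UNIV"
      by (simp add: lmeasurable_iff_has_integral)
    moreover have "indicat_real (A \<inter> s -` {y}) = (\<lambda>x. if x \<in> A then indicat_real (s -` {y}) x else 0)"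
      by (auto simp: indicator_def)
    ultimately have "(indicat_real (s -` {y}) has_integral measure lebesgue (A \<inter> s -` {y})) A"
      by (simp add: has_integral_restrict_UNIV)
    then show ?thesis
      by (rule has_integral_scaleR_left)
  qed auto
  have "s = (\<lambda>x. \<Sum>y\<in>range s. indicat_real (s -` {y}) x *\<^sub>R y)"
  proof
    fix x
    have "(\<Sum>y\<in>range s. indicat_real (s -` {y}) x *\<^sub>R y) = (\<Sum>y\<in>range s. if s x = y then y else 0)"
      by (intro sum.cong) (auto simp: indicator_def)
    then show "s x = (\<Sum>y\<in>range s. indicat_real (s -` {y}) x *\<^sub>R y)"
      using fin by simp
  qed
  then show ?thesis
    using has_integral_sum[OF fin, of "\<lambda>y x. indicat_real (s -` {y}) x *\<^sub>R y", OF *] by simp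
qed

text \<open>
  Riemann sums of \<open>f - s i\<close> are dominated in norm by Riemann sums of the real function \<open>g i\<close>, so one
  gauge that is fine for both \<open>s i\<close> and \<open>g i\<close> controls the Riemann sums of \<open>f\<close>.
\<close>
lemma has_integral_L1_limit:
  fixes f :: "real \<Rightarrow> 'b::real_normed_vector"
  assumes s: "\<And>i. (s i has_integral J i) {a..b}" and g: "\<And>i. (g i has_integral e i) {a..b}"
    and le: "\<And>i x. x \<in> {a..b} \<Longrightarrow> norm (f x - s i x) \<le> g i x"
    and e: "e \<longlonglongrightarrow> 0" and J: "J \<longlonglongrightarrow> (I::'b)"
  shows "(f has_integral I) {a..b}"
  unfolding has_integral_real
proof (intro allI impI)
  fix \<epsilon> :: real assume \<epsilon>: "\<epsilon> > 0"
  have "eventually (\<lambda>i. \<bar>e i\<bar> < \<epsilon>/5) sequentially"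
    using tendstoD[OF e, of "\<epsilon>/5"] \<epsilon> by simp
  moreover have "eventually (\<lambda>i. norm (J i - I) < \<epsilon>/5) sequentially"
    using tendstoD[OF J, of "\<epsilon>/5"] \<epsilon> by (simp add: dist_norm)
  ultimately obtain i where i: "\<bar>e i\<bar> < \<epsilon>/5" "norm (J i - I) < \<epsilon>/5"
    using eventually_happens'[OF sequentially_bot, OF eventually_conj] by blast
  obtain \<gamma>1 where \<gamma>1: "gauge \<gamma>1" "\<And>\<D>. \<D> tagged_division_of {a..b} \<Longrightarrow> \<gamma>1 fine \<D> \<Longrightarrow>
      norm (sum (\<lambda>(x,k). measure lborel k *\<^sub>R s i x) \<D> - J i) < \<epsilon>/5"
    using s[of i, unfolded has_integral_real, rule_format, of "\<epsilon>/5"] \<epsilon> by auto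
  obtain \<gamma>2 where \<gamma>2: "gauge \<gamma>2" "\<And>\<D>. \<D> tagged_division_of {a..b} \<Longrightarrow> \<gamma>2 fine \<D> \<Longrightarrow>
      norm (sum (\<lambda>(x,k). measure lborel k *\<^sub>R g i x) \<D> - e i) < \<epsilon>/5"
    using g[of i, unfolded has_integral_real, rule_format, of "\<epsilon>/5"] \<epsilon> by auto
  show "\<exists>\<gamma>. gauge \<gamma> \<and> (\<forall>\<D>. \<D> tagged_division_of {a..b} \<and> \<gamma> fine \<D> \<longrightarrow>
        norm (sum (\<lambda>(x,k). measure lborel k *\<^sub>R f x) \<D> - I) < \<epsilon>)"
  proof (intro exI[of _ "\<lambda>x. \<gamma>1 x \<inter> \<gamma>2 x"] conjI allI impI gauge_Int \<gamma>1 \<gamma>2)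
    fix \<D> assume "\<D> tagged_division_of {a..b} \<and> (\<lambda>x. \<gamma>1 x \<inter> \<gamma>2 x) fine \<D>"
    then have D: "\<D> tagged_division_of {a..b}" "\<gamma>1 fine \<D>" "\<gamma>2 fine \<D>"
      by (auto simp: fine_Int)
    have "norm (sum (\<lambda>(x,k). measure lborel k *\<^sub>R f x) \<D> - sum (\<lambda>(x,k). measure lborel k *\<^sub>R s i x) \<D>)
        = norm (sum (\<lambda>(x,k). measure lborel k *\<^sub>R (f x - s i x)) \<D>)"
      by (simp add: sum_subtractf[symmetric] case_prod_unfold scaleR_diff_right)
    also have "\<dots> \<le> sum (\<lambda>(x,k). measure lborel k *\<^sub>R g i x) \<D>"
    proof (intro order.trans[OF norm_sum] sum_mono, clarify)
      fix x k assume "(x,k) \<in> \<D>"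
      then have "x \<in> {a..b}" using D(1) by (metis tag_in_interval)
      then show "norm (measure lborel k *\<^sub>R (f x - s i x)) \<le> measure lborel k *\<^sub>R g i x"
        using le by (simp add: mult_left_mono)
    qed
    finally have 1: "norm (sum (\<lambda>(x,k). measure lborel k *\<^sub>R f x) \<D> - sum (\<lambda>(x,k). measure lborel k *\<^sub>R s i x) \<D>)
        \<le> sum (\<lambda>(x,k). measure lborel k *\<^sub>R g i x) \<D>" .
    have 2: "sum (\<lambda>(x,k). measure lborel k *\<^sub>R g i x) \<D> < 2*\<epsilon>/5"
      using \<gamma>2(2)[OF D(1,3)] i(1) by (simp add: abs_if split: if_splits)
    have 3: "norm (sum (\<lambda>(x,k). measure lborel k *\<^sub>R s i x) \<D> - I) < 2*\<epsilon>/5"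
      using norm_triangle_lt[of "sum (\<lambda>(x,k). measure lborel k *\<^sub>R s i x) \<D> - J i" "J i - I" "2*\<epsilon>/5"] \<gamma>1(2)[OF D(1,2)] i(2)
      by simp
    show "norm (sum (\<lambda>(x,k). measure lborel k *\<^sub>R f x) \<D> - I) < \<epsilon>"
      using norm_triangle_le[of "sum (\<lambda>(x,k). measure lborel k *\<^sub>R f x) \<D> - sum (\<lambda>(x,k). measure lborel k *\<^sub>R s i x) \<D>"
          "sum (\<lambda>(x,k). measure lborel k *\<^sub>R s i x) \<D> - I" "4*\<epsilon>/5"] 1 2 3 \<epsilon> by simp
  qed
qed

lemma borel_measurable_lebesgue_AE_limit:
  fixes F :: "nat \<Rightarrow> 'a::euclidean_space \<Rightarrow> 'c::euclidean_space"
  assumes F[measurable]: "\<And>j. F j \<in> borel_measurable lebesgue" and lim: "AE x in lebesgue. (\<lambda>j. F j x) \<longlonglongrightarrow> h x"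
  shows "h \<in> borel_measurable lebesgue"
proof -
  have "(\<lambda>x. lim (\<lambda>j. F j x)) \<in> borel_measurable lebesgue"
    by measurable
  moreover have "AE x in lebesgue. lim (\<lambda>j. F j x) = h x"
    using lim by eventually_elim (rule limI)
  ultimately show ?thesis
    by (rule borel_measurable_AE)
qed

text \<open>
  Nothing forces the approximating simple functions to vanish outside \<open>{a..b}\<close>; their integral over
  the complement is bounded by the distance to \<open>f\<close>, which vanishes there, and so disappears in the
  limit.
\<close>
lemma strong_bochner_imp_has_integral:
  fixes f :: "real \<Rightarrow> 'b::banach"
  assumes f: "has_strong_bochner_integral lebesgue f I" and off: "\<And>x. x \<notin> {a..b} \<Longrightarrow> f x = 0"
  shows "(f has_integral I) {a..b}"
proof -
  obtain s where s: "\<And>i::nat. Bochner_Integration.simple_bochner_integrable lebesgue (s i)"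
    and ae: "AE \<tau> in lebesgue. (\<lambda>i. s i \<tau>) \<longlonglongrightarrow> f \<tau>"
    and d0: "(\<lambda>i. \<integral>\<^sup>+\<tau>. ennreal (norm (f \<tau> - s i \<tau>)) \<partial>lebesgue) \<longlonglongrightarrow> 0"
    and I0: "(\<lambda>i. Bochner_Integration.simple_bochner_integral lebesgue (s i)) \<longlonglongrightarrow> I"
    using f unfolding has_strong_bochner_integral_def by blast
  have meas: "(\<lambda>x. norm (f x - s i x)) \<in> borel_measurable lebesgue" for i
  proof (rule borel_measurable_lebesgue_AE_limit)
    show "(\<lambda>x. norm (s j x - s i x)) \<in> borel_measurable lebesgue" for j
      using s by (intro borel_measurable_simple_function simple_function_compose2[where h="\<lambda>x y. norm (x - y)"])
        (auto simp: simple_bochner_integrable.simps)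
    show "AE x in lebesgue. (\<lambda>j. norm (s j x - s i x)) \<longlonglongrightarrow> norm (f x - s i x)"
      using ae by eventually_elim (intro tendsto_intros)
  qed
  define N where "N i = (\<integral>\<^sup>+\<tau>. ennreal (norm (f \<tau> - s i \<tau>)) \<partial>lebesgue)" for i
  have N0: "N \<longlonglongrightarrow> 0" using d0 unfolding N_def .
  obtain i0 where i0: "\<And>i. i \<ge> i0 \<Longrightarrow> N i < 1"
    using order_tendstoD(2)[OF N0, of 1] by (auto simp: eventually_sequentially)
  (* Only finitely many of the distances N i can be infinite; they are skipped. *)
  define e where "e i = enn2real (N (i + i0))" for i
  define S where "S i = s (i + i0)" for i
  have Ne: "N (i + i0) = ennreal (e i)" for i
    using i0[of "i + i0"] unfolding e_def by (subst ennreal_enn2real) (auto simp: less_top[symmetric] dest: order_less_trans)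
  have e0: "e \<longlonglongrightarrow> 0"
    using tendsto_enn2real[of "\<lambda>i. N (i + i0)" 0 sequentially] LIMSEQ_ignore_initial_segment[OF N0, of i0]
    by (simp add: e_def[abs_def])
  have e_nonneg: "0 \<le> e i" for i by (simp add: e_def)
  have g: "((\<lambda>x. norm (f x - S i x)) has_integral e i) UNIV" for i
    unfolding S_def using meas[of "i + i0"] Ne[of i] e_nonneg[of i]
    by (subst has_integral_iff_nn_integral_lebesgue) (auto simp: N_def)
  have gab: "(\<lambda>x. norm (f x - S i x)) integrable_on {a..b}" for i
    using integrable_on_subinterval[OF has_integral_integrable[OF g]] by auto
  define K where "K i = Bochner_Integration.simple_bochner_integral lebesgue (S i)" for i
  have K: "(S i has_integral K i) UNIV" for i
    using simple_bochner_has_integral[of "S i" UNIV] s[of "i + i0"]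
    by (simp add: S_def K_def simple_bochner_integral_def vimage_def)
  have KI: "K \<longlonglongrightarrow> I"
    using LIMSEQ_ignore_initial_segment[OF I0, of i0] by (simp add: K_def[abs_def] S_def)
  have Sab: "S i integrable_on {a..b}" for i
    using simple_bochner_has_integral[of "S i" "{a..b}"] s[of "i + i0"] by (auto simp: S_def)
  have off_bound: "norm (K i - integral {a..b} (S i)) \<le> e i" for i
  proof -
    have "((\<lambda>x. if x \<in> {a..b} then S i x else 0) has_integral integral {a..b} (S i)) UNIV"
      using Sab by (subst has_integral_restrict_UNIV) (auto intro: integrable_integral)
    from has_integral_diff[OF K this]
    have *: "((\<lambda>x. S i x - (if x \<in> {a..b} then S i x else 0)) has_integral K i - integral {a..b} (S i)) UNIV" .
    have "norm (integral UNIV (\<lambda>x. S i x - (if x \<in> {a..b} then S i x else 0))) \<le> integral UNIV (\<lambda>x. norm (f x - S i x))"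
      using * g off by (intro integral_norm_bound_integral) (auto intro: has_integral_integrable)
    then show ?thesis
      using integral_unique[OF *] integral_unique[OF g] by simp
  qed
  have "(\<lambda>i. K i - integral {a..b} (S i)) \<longlonglongrightarrow> 0"
    by (rule Lim_null_comparison[OF _ e0]) (use off_bound in auto)
  from tendsto_diff[OF KI this] have J: "(\<lambda>i. integral {a..b} (S i)) \<longlonglongrightarrow> I"
    by simp
  have e1: "(\<lambda>i. integral {a..b} (\<lambda>x. norm (f x - S i x))) \<longlonglongrightarrow> 0"
  proof (rule tendsto_sandwich[OF _ _ tendsto_const e0])
    show "\<forall>\<^sub>F i in sequentially. 0 \<le> integral {a..b} (\<lambda>x. norm (f x - S i x))"
      using gab by (intro always_eventually allI integral_nonneg) auto
    show "\<forall>\<^sub>F i in sequentially. integral {a..b} (\<lambda>x. norm (f x - S i x)) \<le> e i"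
      using gab g by (intro always_eventually allI) 
        (metis (mono_tags, lifting) has_integral_integrable integral_subset_le integral_unique norm_ge_zero subset_UNIV)
  qed
  show ?thesis
    by (rule has_integral_L1_limit[OF integrable_integral[OF Sab] integrable_integral[OF gab] _ e1 J]) auto
qed

text \<open>
  Simple functions approximating \<open>\<tau> \<mapsto> k (t - \<tau>) (w \<tau>)\<close> are obtained by replacing \<open>w\<close> by simple
  functions and by freezing the kernel on a grid whose mesh is chosen from its modulus of
  continuity.
\<close>
lemma strong_bochner_kernel_exists:
  fixes k :: "real \<Rightarrow> 'v::euclidean_space \<Rightarrow> 'b::banach"
  assumes lin: "\<And>s. 0 \<le> s \<Longrightarrow> linear (k s)"
    and bound: "\<And>s p. 0 \<le> s \<Longrightarrow> s \<le> t - c \<Longrightarrow> norm (k s p) \<le> \<kappa> * norm p"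
    and uc: "\<And>\<omega>. 0 < \<omega> \<Longrightarrow> \<exists>h>0. \<forall>s\<in>{0..t-c}. \<forall>s'\<in>{0..t-c}. \<bar>s - s'\<bar> \<le> h \<longrightarrow> (\<forall>p. norm (k s p - k s' p) \<le> \<omega> * norm p)"
    and w: "set_integrable lebesgue {c<..<t} w"
  shows "\<exists>I. has_strong_bochner_integral lebesgue (\<lambda>\<tau>. indicator {c<..<t} \<tau> *\<^sub>R k (t - \<tau>) (w \<tau>)) I"
proof -
  define W where "W \<tau> = indicat_real {c<..<t} \<tau> *\<^sub>R w \<tau>" for \<tau>
  have W: "integrable lebesgue W" using w by (simp add: set_integrable_def W_def[abs_def])
  obtain s where s: "\<And>i. simple_function lebesgue (s i)" "\<And>i. emeasure lebesgue {y. s i y \<noteq> 0} \<noteq> \<infinity>"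
      "\<And>x. (\<lambda>i. s i x) \<longlonglongrightarrow> W x" "\<And>x i. norm (s i x) \<le> 2 * norm (W x)"
  proof (rule integrable_implies_simple_function_sequence[OF W])
    fix s :: "nat \<Rightarrow> real \<Rightarrow> 'v"
    assume "\<And>i. simple_function lebesgue (s i)" "\<And>i. emeasure lebesgue {y \<in> space lebesgue. s i y \<noteq> 0} \<noteq> \<infinity>"
      "\<And>x. x \<in> space lebesgue \<Longrightarrow> (\<lambda>i. s i x) \<longlonglongrightarrow> W x" "\<And>x i. x \<in> space lebesgue \<Longrightarrow> norm (s i x) \<le> 2 * norm (W x)"
    then show thesis by (intro that[of s]) (simp_all del: infinity_ennreal_def)
  qed
  have s_meas[measurable]: "s i \<in> borel_measurable lebesgue" for i
    using s(1) by (rule borel_measurable_simple_function)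
  have W_meas[measurable]: "W \<in> borel_measurable lebesgue" using W by auto
  have "\<forall>i. \<exists>N. 0 < N \<and> (\<forall>s\<in>{0..t-c}. \<forall>s'\<in>{0..t-c}. \<bar>s - s'\<bar> \<le> 1 / real N \<longrightarrow> (\<forall>p. norm (k s p - k s' p) \<le> 1 / real (Suc i) * norm p))"
  proof
    fix i
    obtain h where h: "h > 0" "\<forall>s\<in>{0..t-c}. \<forall>s'\<in>{0..t-c}. \<bar>s - s'\<bar> \<le> h \<longrightarrow> (\<forall>p. norm (k s p - k s' p) \<le> 1 / real (Suc i) * norm p)"
      using uc[of "1 / real (Suc i)"] by auto
    obtain N where "inverse (real (Suc N)) < h" using reals_Archimedean[OF h(1)] by auto
    then have "1 / real (Suc N) \<le> h" by (simp only: inverse_eq_divide less_imp_le)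
    then have "x \<le> 1 / real (Suc N) \<Longrightarrow> x \<le> h" for x by simp
    with h(2) have "\<forall>s\<in>{0..t-c}. \<forall>s'\<in>{0..t-c}. \<bar>s - s'\<bar> \<le> 1 / real (Suc N) \<longrightarrow> (\<forall>p. norm (k s p - k s' p) \<le> 1 / real (Suc i) * norm p)"
      by simp
    then show "\<exists>N. 0 < N \<and> (\<forall>s\<in>{0..t-c}. \<forall>s'\<in>{0..t-c}. \<bar>s - s'\<bar> \<le> 1 / real N \<longrightarrow> (\<forall>p. norm (k s p - k s' p) \<le> 1 / real (Suc i) * norm p))"
      by (intro exI[of _ "Suc N"] conjI zero_less_Suc)
  qed
  from choice[OF this] obtain N where N: "\<And>i. 0 < N i"
    "\<And>i s s' p. s \<in> {0..t-c} \<Longrightarrow> s' \<in> {0..t-c} \<Longrightarrow> \<bar>s - s'\<bar> \<le> 1 / real (N i) \<Longrightarrow> norm (k s p - k s' p) \<le> 1 / real (Suc i) * norm p"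
    by blast
  (* Grid point to the left of \<tau>, clipped so that t - \<sigma> stays in the range {0..t-c} of the bounds on k;
     the value c - 1 marks the times outside the interval. *)
  define \<sigma> where "\<sigma> i \<tau> = (if \<tau> \<in> {c<..<t} then max c (of_int \<lfloor>real (N i) * \<tau>\<rfloor> / real (N i)) else c - 1)" for i \<tau>
  have \<sigma>_simple: "simple_function lebesgue (\<sigma> i)" for i
  proof (rule simple_function_borel_measurable)
    have "\<sigma> i \<in> borel_measurable borel"
      unfolding \<sigma>_def[abs_def] by measurable
    then show "\<sigma> i \<in> borel_measurable lebesgue"
      by (intro measurable_completion) simp
    have "range (\<sigma> i) \<subseteq> insert (c-1) ((\<lambda>z. max c (of_int z / real (N i))) ` {\<lfloor>real (N i) * c\<rfloor>..\<lfloor>real (N i) * t\<rfloor>})"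
    proof (rule image_subsetI)
      fix \<tau>
      show "\<sigma> i \<tau> \<in> insert (c-1) ((\<lambda>z. max c (of_int z / real (N i))) ` {\<lfloor>real (N i) * c\<rfloor>..\<lfloor>real (N i) * t\<rfloor>})"
      proof (cases "\<tau> \<in> {c<..<t}")
        case True
        then have "real (N i) * c \<le> real (N i) * \<tau>" "real (N i) * \<tau> \<le> real (N i) * t"
          by (simp_all add: mult_left_mono)
        then have "\<lfloor>real (N i) * \<tau>\<rfloor> \<in> {\<lfloor>real (N i) * c\<rfloor>..\<lfloor>real (N i) * t\<rfloor>}"
          by (simp add: floor_mono)
        then show ?thesis
          unfolding \<sigma>_def if_P[OF True] by (intro insertI2 imageI)
      next
        case False
        show ?thesis
          unfolding \<sigma>_def if_not_P[OF False] by (rule insertI1)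
      qed
    qed
    then have "finite (range (\<sigma> i))"
      by (rule finite_subset) simp
    then show "finite (\<sigma> i ` space lebesgue)"
      by simp
  qed
  have \<sigma>: "c \<le> \<sigma> i \<tau>" "\<sigma> i \<tau> \<le> \<tau>" "\<tau> - \<sigma> i \<tau> \<le> 1 / real (N i)" if "\<tau> \<in> {c<..<t}" for i \<tau>
  proof -
    have "of_int \<lfloor>real (N i) * \<tau>\<rfloor> / real (N i) \<le> \<tau>"
      using N(1)[of i] of_int_floor_le[of "real (N i) * \<tau>"] by (simp add: pos_divide_le_eq mult.commute del: of_int_floor_le)
    moreover have "\<tau> \<le> of_int \<lfloor>real (N i) * \<tau>\<rfloor> / real (N i) + 1 / real (N i)"
      using N(1)[of i] floor_correct[of "real (N i) * \<tau>"] by (simp add: add_divide_distrib[symmetric] pos_le_divide_eq mult.commute)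
    ultimately show "c \<le> \<sigma> i \<tau>" "\<sigma> i \<tau> \<le> \<tau>" "\<tau> - \<sigma> i \<tau> \<le> 1 / real (N i)"
      using that by (simp_all add: \<sigma>_def)
  qed
  define F where "F i \<tau> = (if \<sigma> i \<tau> < c then 0 else k (t - \<sigma> i \<tau>) (s i \<tau>))" for i \<tau>
  define f where "f \<tau> = indicator {c<..<t} \<tau> *\<^sub>R k (t - \<tau>) (w \<tau>)" for \<tau>
  define g where "g i \<tau> = \<kappa> * norm (s i \<tau> - W \<tau>) + 1 / real (Suc i) * norm (W \<tau>)" for i \<tau>
  have F: "Bochner_Integration.simple_bochner_integrable lebesgue (F i)" for i
  proof
    show "simple_function lebesgue (F i)"
      unfolding F_def[abs_def]
      by (rule simple_function_compose2[where h="\<lambda>\<sigma> s. if \<sigma> < c then 0 else k (t - \<sigma>) s", OF \<sigma>_simple s(1)])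
    have "\<tau> \<in> {c<..<t} \<Longrightarrow> k (t - \<sigma> i \<tau>) 0 = 0" for \<tau>
      using lin[of "t - \<sigma> i \<tau>"] \<sigma>[of \<tau> i] by (intro linear_0) auto
    then have "{y \<in> space lebesgue. F i y \<noteq> 0} \<subseteq> {y. s i y \<noteq> 0}"
      by (auto simp: F_def \<sigma>_def split: if_splits)
    then have "emeasure lebesgue {y \<in> space lebesgue. F i y \<noteq> 0} \<le> emeasure lebesgue {y. s i y \<noteq> 0}"
      using simple_functionD(2)[OF s(1), of i "-{0}"] by (intro emeasure_mono) (auto simp: vimage_def)
    then show "emeasure lebesgue {y \<in> space lebesgue. F i y \<noteq> 0} \<noteq> \<infinity>"
      using s(2)[of i] by (auto simp: top_unique)
  qed
  have Ff: "norm (f \<tau> - F i \<tau>) \<le> g i \<tau>" for i \<tau>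
  proof (cases "\<tau> \<in> {c<..<t}")
    case True
    note \<sigma>' = \<sigma>[OF True, of i]
    have *: "t - \<sigma> i \<tau> \<in> {0..t-c}" "t - \<tau> \<in> {0..t-c}" using \<sigma>' True by auto
    have "f \<tau> - F i \<tau> = (k (t - \<tau>) (W \<tau>) - k (t - \<sigma> i \<tau>) (W \<tau>)) - k (t - \<sigma> i \<tau>) (s i \<tau> - W \<tau>)"
      using True \<sigma>' * by (simp add: f_def F_def W_def linear_diff[OF lin])
    also have "norm \<dots> \<le> norm (k (t - \<tau>) (W \<tau>) - k (t - \<sigma> i \<tau>) (W \<tau>)) + norm (k (t - \<sigma> i \<tau>) (s i \<tau> - W \<tau>))"
      by (rule norm_triangle_ineq4)
    also have "\<dots> \<le> 1 / real (Suc i) * norm (W \<tau>) + \<kappa> * norm (s i \<tau> - W \<tau>)"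
      using * \<sigma>' by (intro add_mono N(2) bound) auto
    finally show ?thesis by (simp add: g_def)
  next
    case False
    have "s i \<tau> = 0" using s(4)[of i \<tau>] False by (simp add: W_def)
    then show ?thesis using False by (auto simp: f_def F_def g_def W_def \<sigma>_def)
  qed
  have dom: "integrable lebesgue (\<lambda>\<tau>. norm (s i \<tau> - W \<tau>))" and "(\<lambda>i. LINT \<tau>|lebesgue. norm (s i \<tau> - W \<tau>)) \<longlonglongrightarrow> (LINT \<tau>|(lebesgue :: real measure). 0 :: real)" for i
  proof -
    have 1: "AE x in lebesgue. (\<lambda>i. norm (s i x - W x)) \<longlonglongrightarrow> 0"
      using s(3) by (auto intro!: tendsto_norm_zero LIM_zero)
    have 2: "AE x in lebesgue. norm (norm (s i x - W x)) \<le> 3 * norm (W x)" for i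
    proof (intro always_eventually allI)
      fix x show "norm (norm (s i x - W x)) \<le> 3 * norm (W x)"
        using s(4)[of i x] norm_triangle_ineq4[of "s i x" "W x"] by simp
    qed
    show "integrable lebesgue (\<lambda>\<tau>. norm (s i \<tau> - W \<tau>))"
      by (rule Bochner_Integration.integrable_bound[of _ "\<lambda>x. 3 * norm (W x)"]) (use W 2 in auto)
    show "(\<lambda>i. LINT \<tau>|lebesgue. norm (s i \<tau> - W \<tau>)) \<longlonglongrightarrow> (LINT \<tau>|(lebesgue :: real measure). 0 :: real)"
      by (rule integral_dominated_convergence[OF _ _ _ 1 2]) (use W in auto)
  qed
  then have L1: "(\<lambda>i. LINT \<tau>|lebesgue. norm (s i \<tau> - W \<tau>)) \<longlonglongrightarrow> 0" by simp
  have g: "integrable lebesgue (g i)" for i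
    unfolding g_def[abs_def] using dom W by (intro Bochner_Integration.integrable_add integrable_mult_right) auto
  define E where "E i = (LINT \<tau>|lebesgue. g i \<tau>)" for i
  have E_eq: "E i = \<kappa> * (LINT \<tau>|lebesgue. norm (s i \<tau> - W \<tau>)) + 1 / real (Suc i) * (LINT \<tau>|lebesgue. norm (W \<tau>))" for i
    unfolding E_def g_def using dom W by (subst Bochner_Integration.integral_add) auto
  have "(\<lambda>i. \<kappa> * (LINT \<tau>|lebesgue. norm (s i \<tau> - W \<tau>)) + 1 / real (Suc i) * (LINT \<tau>|lebesgue. norm (W \<tau>))) \<longlonglongrightarrow> \<kappa> * 0 + 0 * (LINT \<tau>|lebesgue. norm (W \<tau>))"
    using LIMSEQ_inverse_real_of_nat by (intro tendsto_intros L1) (simp add: inverse_eq_divide)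
  then have E0: "E \<longlonglongrightarrow> 0" unfolding E_eq[abs_def, symmetric] by simp
  have g_nonneg: "0 \<le> g i \<tau>" for i \<tau> using order.trans[OF norm_ge_zero Ff] .
  have nn: "(\<integral>\<^sup>+\<tau>. ennreal (norm (f \<tau> - F i \<tau>)) \<partial>lebesgue) \<le> ennreal (E i)" for i
    unfolding E_def nn_integral_eq_integral[OF g always_eventually[OF allI[OF g_nonneg]], symmetric]
    using Ff by (intro nn_integral_mono ennreal_leI)
  have "(\<lambda>i. \<integral>\<^sup>+\<tau>. ennreal (norm (f \<tau> - F i \<tau>)) \<partial>lebesgue) \<longlonglongrightarrow> 0"
    using tendsto_sandwich[OF _ always_eventually[OF allI[OF nn]] tendsto_const tendsto_ennrealI[OF E0]] by simp
  moreover have "AE \<tau> in lebesgue. (\<lambda>i. F i \<tau>) \<longlonglongrightarrow> f \<tau>"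
  proof (intro always_eventually allI)
    fix \<tau>
    have "(\<lambda>i. g i \<tau>) \<longlonglongrightarrow> \<kappa> * 0 + 0 * norm (W \<tau>)"
      unfolding g_def using LIMSEQ_inverse_real_of_nat
      by (intro tendsto_intros tendsto_norm_zero LIM_zero s(3)) (simp add: inverse_eq_divide)
    then have g0: "(\<lambda>i. g i \<tau>) \<longlonglongrightarrow> 0" by simp
    have "(\<lambda>i. f \<tau> - F i \<tau>) \<longlonglongrightarrow> 0"
      by (rule Lim_null_comparison[OF _ g0]) (use Ff in auto)
    from tendsto_diff[OF tendsto_const[of "f \<tau>"] this] show "(\<lambda>i. F i \<tau>) \<longlonglongrightarrow> f \<tau>" by simp
  qed
  moreover have "Cauchy (\<lambda>i. Bochner_Integration.simple_bochner_integral lebesgue (F i))"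
  proof -
    define K where "K i = Bochner_Integration.simple_bochner_integral lebesgue (F i)" for i
    have K: "(F i has_integral K i) UNIV" for i
      using simple_bochner_has_integral[OF F, of UNIV i] by (simp add: K_def simple_bochner_integral_def vimage_def)
    have KE: "norm (K i - K j) \<le> E i + E j" for i j
    proof -
      have 1: "((\<lambda>x. F i x - F j x) has_integral K i - K j) UNIV" by (intro has_integral_diff K)
      have 2: "((\<lambda>x. g i x + g j x) has_integral E i + E j) UNIV"
        unfolding E_def by (intro has_integral_add has_integral_integral_lebesgue g)
      have "norm (F i x - F j x) \<le> g i x + g j x" for x
        using Ff[of x i] Ff[of x j] norm_triangle_ineq4[of "f x - F j x" "f x - F i x"] by simp
      then have "norm (integral UNIV (\<lambda>x. F i x - F j x)) \<le> integral UNIV (\<lambda>x. g i x + g j x)"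
        using 1 2 by (intro integral_norm_bound_integral) (auto intro: has_integral_integrable)
      then show ?thesis using integral_unique[OF 1] integral_unique[OF 2] by simp
    qed
    have "Cauchy K"
    proof (rule metric_CauchyI)
      fix e :: real assume "e > 0"
      then obtain M where M: "\<And>i. i \<ge> M \<Longrightarrow> \<bar>E i\<bar> < e/2"
        using LIMSEQ_D[OF E0, of "e/2"] by auto
      show "\<exists>M. \<forall>m\<ge>M. \<forall>n\<ge>M. dist (K m) (K n) < e"
      proof (intro exI[of _ M] allI impI)
        fix i j assume "M \<le> i" "M \<le> j"
        then show "dist (K i) (K j) < e"
          using KE[of i j] M[of i] M[of j] unfolding dist_norm by linarith
      qed
    qed
    then show ?thesis by (simp add: K_def[abs_def])
  qed
  ultimately show ?thesis
    using F unfolding has_strong_bochner_integral_def f_def[symmetric] Cauchy_convergent_iff convergent_def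
    by blast
qed

section \<open>Semigroups acting on a finite-dimensional control space\<close>

text \<open>
  The uniform boundedness principle: by right continuity at \<open>0\<close> every \<open>x\<close> lies in one of the closed
  sets \<open>E n\<close>, so by Baire one of them contains a ball, and linearity spreads the bound on that ball.
\<close>
lemma C0_semigroup_bounded_near_0:
  fixes \<Psi> :: "real \<Rightarrow> 'b::banach \<Rightarrow> 'b"
  assumes \<Psi>: "C0_semigroup \<Psi>"
  obtains \<delta> M where "\<delta> > 0" "\<And>s x. 0 \<le> s \<Longrightarrow> s \<le> \<delta> \<Longrightarrow> norm (\<Psi> s x) \<le> M * norm x"
proof -
  have lin: "bounded_linear (\<Psi> s)" if "0 \<le> s" for s
    using \<Psi> that by (auto simp: C0_semigroup_def)
  define E where "E n = {x. \<forall>s\<in>{0..1 / real (Suc n)}. norm (\<Psi> s x) \<le> real n}" for n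
  have closed_E: "closed (E n)" for n
  proof -
    have "E n = (\<Inter>s\<in>{0..1 / real (Suc n)}. {x. norm (\<Psi> s x) \<le> real n})"
      by (auto simp: E_def)
    moreover have "closed {x. norm (\<Psi> s x) \<le> real n}" if "0 \<le> s" for s
      by (intro closed_Collect_le continuous_on_norm bounded_linear.continuous_on[OF lin[OF that]] continuous_intros)
    ultimately show ?thesis by (auto intro!: closed_INT)
  qed
  have cover: "\<exists>n. x \<in> E n" for x
  proof -
    have "((\<lambda>s. \<Psi> s x) \<longlongrightarrow> x) (at_right 0)"
      using \<Psi> by (auto simp: C0_semigroup_def)
    then have "eventually (\<lambda>s. norm (\<Psi> s x) < norm x + 1) (at_right 0)"
      by (intro order_tendstoD(2)[OF tendsto_norm]) auto
    then obtain d where d: "d > 0" "\<And>s. 0 < s \<Longrightarrow> s < d \<Longrightarrow> norm (\<Psi> s x) < norm x + 1"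
      by (auto simp: eventually_at_right_field)
    obtain n1 where n1: "inverse (real (Suc n1)) < d" using reals_Archimedean[OF d(1)] by auto
    obtain n2 where n2: "norm x + 1 \<le> real n2" using real_arch_simple by blast
    define n where "n = max n1 n2"
    have nd: "1 / real (Suc n) < d"
      using le_less_trans[OF _ n1, of "1 / real (Suc n)"] by (simp add: n_def inverse_eq_divide frac_le)
    have nn: "norm x + 1 \<le> real n"
      using n2 by (simp add: n_def)
    have "norm (\<Psi> s x) \<le> real n" if "s \<in> {0..1 / real (Suc n)}" for s
    proof (cases "s = 0")
      case True
      then show ?thesis using \<Psi> nn by (simp add: C0_semigroup_def)
    next
      case False
      then show ?thesis using d(2)[of s] that nd nn by simp
    qed
    then have "x \<in> E n" unfolding E_def by blast
    then show ?thesis ..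
  qed
  have "\<exists>n. interior (E n) \<noteq> {}"
  proof (rule ccontr)
    assume "\<not> ?thesis"
    then have "Met_TC.mtopology interior_of \<Union>(range E) = {}"
      using closed_E by (intro Met_TC.metric_Baire_category_alt) (auto simp: complete_UNIV)
    moreover have "\<Union>(range E) = UNIV" using cover by auto
    ultimately show False by simp
  qed
  then obtain n x0 where "x0 \<in> interior (E n)" by auto
  then obtain e where e: "e > 0" "cball x0 e \<subseteq> E n"
    by (meson mem_interior_cball)
  show thesis
  proof (rule that[of "1 / real (Suc n)" "2 * real n / e"])
    fix s :: real and x assume s: "0 \<le> s" "s \<le> 1 / real (Suc n)"
    interpret bounded_linear "\<Psi> s" by (rule lin[OF s(1)])
    show "norm (\<Psi> s x) \<le> 2 * real n / e * norm x"
    proof (cases "x = 0")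
      case False
      define z where "z = x0 + (e / norm x) *\<^sub>R x"
      have "z \<in> E n" "x0 \<in> E n" using e False by (auto simp: z_def dist_norm intro!: subsetD[OF e(2)])
      then have "norm (\<Psi> s z) \<le> real n" "norm (\<Psi> s x0) \<le> real n" using s by (auto simp: E_def)
      then have "norm (\<Psi> s z - \<Psi> s x0) \<le> 2 * real n"
        using norm_triangle_ineq4[of "\<Psi> s z" "\<Psi> s x0"] by simp
      moreover have "\<Psi> s z - \<Psi> s x0 = (e / norm x) *\<^sub>R \<Psi> s x"
        by (simp add: z_def add scaleR)
      ultimately have "e / norm x * norm (\<Psi> s x) \<le> 2 * real n" using e by simp
      then show ?thesis using e False by (simp add: field_simps)
    qed (simp add: zero)
  qed simp
qed

lemma C0_semigroup_locally_bounded: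
  fixes \<Psi> :: "real \<Rightarrow> 'b::banach \<Rightarrow> 'b"
  assumes \<Psi>: "C0_semigroup \<Psi>"
  obtains M where "M \<ge> 1" "\<And>s x. 0 \<le> s \<Longrightarrow> s \<le> L \<Longrightarrow> norm (\<Psi> s x) \<le> M * norm x"
proof -
  obtain \<delta> M0 where \<delta>: "\<delta> > 0" and M0: "\<And>s x. 0 \<le> s \<Longrightarrow> s \<le> \<delta> \<Longrightarrow> norm (\<Psi> s x) \<le> M0 * norm x"
    using C0_semigroup_bounded_near_0[OF \<Psi>] by blast
  define M where "M = max M0 1"
  have M: "norm (\<Psi> s x) \<le> M * norm x" if "0 \<le> s" "s \<le> \<delta>" for s x
    using M0[OF that, of x] by (rule order.trans) (simp add: M_def mult_right_mono)
  have M1: "1 \<le> M" by (simp add: M_def)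
  have *: "norm (\<Psi> s x) \<le> M ^ Suc k * norm x" if "0 \<le> s" "s \<le> real (Suc k) * \<delta>" for k s x
    using that
  proof (induction k arbitrary: s)
    case 0
    then show ?case using M by simp
  next
    case (Suc k)
    show ?case
    proof (cases "s \<le> \<delta>")
      case True
      have "M * norm x \<le> M ^ Suc (Suc k) * norm x"
        using M1 self_le_power[of M "Suc (Suc k)"] by (intro mult_right_mono) auto
      then show ?thesis using M[OF Suc.prems(1) True, of x] by linarith
    next
      case False
      have "\<forall>s\<ge>0. \<forall>t\<ge>0. \<forall>x. \<Psi> (s + t) x = \<Psi> s (\<Psi> t x)" using \<Psi> by (simp add: C0_semigroup_def)
      from this[rule_format, of \<delta> "s - \<delta>" x] have "\<Psi> s x = \<Psi> \<delta> (\<Psi> (s - \<delta>) x)"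
        using \<delta> False by simp
      then have "norm (\<Psi> s x) \<le> M * norm (\<Psi> (s - \<delta>) x)"
        using M[of \<delta>] \<delta> by simp
      also have "\<dots> \<le> M * (M ^ Suc k * norm x)"
        using M1 Suc.prems False by (intro mult_left_mono Suc.IH) (auto simp: algebra_simps)
      finally show ?thesis by (simp add: mult.assoc)
    qed
  qed
  obtain k where k: "L / \<delta> \<le> real k" using real_arch_simple by blast
  show thesis
  proof (rule that[of "M ^ Suc k"])
    show "1 \<le> M ^ Suc k" using M1 by (rule one_le_power)
    fix s x assume "0 \<le> s" "s \<le> L"
    moreover have "L \<le> real (Suc k) * \<delta>"
      using k \<delta> by (simp add: pos_divide_le_eq algebra_simps)
    ultimately show "norm (\<Psi> s x) \<le> M ^ Suc k * norm x" by (intro *) auto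
  qed
qed

lemma C0_semigroup_orbit_uniformly_continuous:
  fixes \<Psi> :: "real \<Rightarrow> 'b::banach \<Rightarrow> 'b"
  assumes \<Psi>: "C0_semigroup \<Psi>" and \<epsilon>: "\<epsilon> > 0"
  shows "\<exists>d>0. \<forall>s\<in>{0..L}. \<forall>s'\<in>{0..L}. \<bar>s - s'\<bar> \<le> d \<longrightarrow> norm (\<Psi> s x - \<Psi> s' x) \<le> \<epsilon>"
proof -
  obtain M where M: "M \<ge> 1" "\<And>s x. 0 \<le> s \<Longrightarrow> s \<le> L \<Longrightarrow> norm (\<Psi> s x) \<le> M * norm x"
    using C0_semigroup_locally_bounded[OF \<Psi>] by blast
  have "((\<lambda>s. \<Psi> s x) \<longlongrightarrow> x) (at_right 0)"
    using \<Psi> by (auto simp: C0_semigroup_def)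
  from tendstoD[OF this, of "\<epsilon> / M"] have "eventually (\<lambda>s. norm (\<Psi> s x - x) < \<epsilon> / M) (at_right 0)"
    using M \<epsilon> by (simp add: dist_norm)
  then obtain d where d: "d > 0" "\<And>s. 0 < s \<Longrightarrow> s < d \<Longrightarrow> norm (\<Psi> s x - x) < \<epsilon> / M"
    by (auto simp: eventually_at_right_field)
  have *: "norm (\<Psi> s' x - \<Psi> s x) \<le> \<epsilon>" if "s \<in> {0..L}" "s \<le> s'" "s' - s \<le> d/2" for s s'
  proof (cases "s = s'")
    case False
    interpret bounded_linear "\<Psi> s" using \<Psi> that by (auto simp: C0_semigroup_def)
    have "\<forall>s\<ge>0. \<forall>t\<ge>0. \<forall>x. \<Psi> (s + t) x = \<Psi> s (\<Psi> t x)" using \<Psi> by (simp add: C0_semigroup_def)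
    from this[rule_format, of s "s' - s" x] have "\<Psi> s' x - \<Psi> s x = \<Psi> s (\<Psi> (s' - s) x - x)"
      using that by (simp add: diff)
    then have "norm (\<Psi> s' x - \<Psi> s x) \<le> M * norm (\<Psi> (s' - s) x - x)"
      using M(2)[of s] that by simp
    also have "\<dots> \<le> M * (\<epsilon> / M)"
      using M that d(2)[of "s' - s"] d(1) False by (intro mult_left_mono) auto
    finally show ?thesis using M by simp
  qed (use \<epsilon> in simp)
  show ?thesis
  proof (intro exI[of _ "d/2"] conjI ballI impI)
    fix s s' assume "s \<in> {0..L}" "s' \<in> {0..L}" "\<bar>s - s'\<bar> \<le> d / 2"
    then show "norm (\<Psi> s x - \<Psi> s' x) \<le> \<epsilon>"
      using *[of s s'] *[of s' s] by (cases "s \<le> s'") (auto simp: norm_minus_commute)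
  qed (use d in simp)
qed

text \<open>
  Strong continuity on the finitely many images of basis vectors is norm continuity of \<open>\<Psi> s \<circ> B\<close>.
\<close>
lemma C0_semigroup_control_uniformly_continuous:
  fixes \<Psi> :: "real \<Rightarrow> 'b::banach \<Rightarrow> 'b" and B :: "'v::euclidean_space \<Rightarrow> 'b"
  assumes \<Psi>: "C0_semigroup \<Psi>" and B: "bounded_linear B" and \<omega>: "\<omega> > 0"
  shows "\<exists>h>0. \<forall>s\<in>{0..L}. \<forall>s'\<in>{0..L}. \<bar>s - s'\<bar> \<le> h \<longrightarrow> (\<forall>p. norm (\<Psi> s (B p) - \<Psi> s' (B p)) \<le> \<omega> * norm p)"
proof -
  define \<omega>' where "\<omega>' = \<omega> / DIM('v)"
  have \<omega>': "\<omega>' > 0" using \<omega> by (simp add: \<omega>'_def)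
  have "\<forall>b\<in>Basis. \<exists>h>0. \<forall>s\<in>{0..L}. \<forall>s'\<in>{0..L}. \<bar>s - s'\<bar> \<le> h \<longrightarrow> norm (\<Psi> s (B b) - \<Psi> s' (B b)) \<le> \<omega>'"
    by (intro ballI C0_semigroup_orbit_uniformly_continuous[OF \<Psi> \<omega>'])
  then obtain h where h: "\<And>b. b \<in> Basis \<Longrightarrow> h b > 0" 
    "\<And>b s s'. b \<in> Basis \<Longrightarrow> s \<in> {0..L} \<Longrightarrow> s' \<in> {0..L} \<Longrightarrow> \<bar>s - s'\<bar> \<le> h b \<Longrightarrow> norm (\<Psi> s (B b) - \<Psi> s' (B b)) \<le> \<omega>'"
    unfolding bchoice_iff by blast
  show ?thesis
  proof (intro exI[of _ "Min (h ` (Basis :: 'v set))"] conjI ballI impI allI)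
    show "0 < Min (h ` (Basis :: 'v set))" using h(1) by (subst Min_gr_iff) auto
    fix s s' p assume s: "s \<in> {0..L}" "s' \<in> {0..L}" "\<bar>s - s'\<bar> \<le> Min (h ` (Basis :: 'v set))"
    have *: "norm (\<Psi> s (B b) - \<Psi> s' (B b)) \<le> \<omega>'" if "b \<in> Basis" for b
      using s that by (intro h(2)) auto
    have "linear (\<Psi> r)" if "0 \<le> r" for r
      using \<Psi> that unfolding C0_semigroup_def by (simp add: bounded_linear.linear)
    then have "linear (\<Psi> r \<circ> B)" if "0 \<le> r" for r
      using that by (intro linear_compose[OF bounded_linear.linear[OF B]])
    then have lin: "linear (\<lambda>p. (\<Psi> s \<circ> B) p - (\<Psi> s' \<circ> B) p)"
      using s by (simp only: linear_compose_sub atLeastAtMost_iff)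
    have "\<Psi> s (B p) - \<Psi> s' (B p) = (\<Sum>b\<in>Basis. (p \<bullet> b) *\<^sub>R (\<Psi> s (B b) - \<Psi> s' (B b)))"
      using linear_sum[OF lin, of "\<lambda>b. (p \<bullet> b) *\<^sub>R b" Basis]
      by (simp only: euclidean_representation linear_scale[OF lin]) simp
    also have "norm \<dots> \<le> (\<Sum>b\<in>(Basis :: 'v set). norm p * \<omega>')"
      using * \<omega>' by (intro order.trans[OF norm_sum] sum_mono) (auto intro!: mult_mono Basis_le_norm)
    also have "\<dots> = \<omega> * norm p" by (simp add: \<omega>'_def)
    finally show "norm (\<Psi> s (B p) - \<Psi> s' (B p)) \<le> \<omega> * norm p" .
  qed
qed

section \<open>Convex combinations of dominated sequences\<close>

text \<open>
  Iterated midpoints are all the convex combinations that the parallelogram law asks for, and an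
  inductive definition avoids any bookkeeping of coefficients.
\<close>
inductive midpoint_hull :: "('a \<Rightarrow> 'v::real_vector) set \<Rightarrow> ('a \<Rightarrow> 'v) \<Rightarrow> bool" for F where
  base: "f \<in> F \<Longrightarrow> midpoint_hull F f"
| midpoint: "midpoint_hull F f \<Longrightarrow> midpoint_hull F g \<Longrightarrow> midpoint_hull F (\<lambda>x. (1/2) *\<^sub>R (f x + g x))"

lemma midpoint_hull_mono: "midpoint_hull F f \<Longrightarrow> F \<subseteq> G \<Longrightarrow> midpoint_hull G f"
  by (induction rule: midpoint_hull.induct) (auto intro: midpoint_hull.intros)

lemma midpoint_hull_in_convex_hull:
  "midpoint_hull F f \<Longrightarrow> f x \<in> convex hull ((\<lambda>g. g x) ` F)"
proof (induction rule: midpoint_hull.induct)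
  case (base f)
  then show ?case by (auto intro: hull_inc)
next
  case (midpoint f g)
  then show ?case
    using convexD[OF convex_convex_hull, of "f x" "(\<lambda>g. g x) ` F" "g x" "1/2" "1/2"]
    by (simp add: scaleR_add_right)
qed

lemma midpoint_hull_measurable:
  fixes F :: "('a \<Rightarrow> 'v::euclidean_space) set"
  assumes "midpoint_hull F f" "\<And>f. f \<in> F \<Longrightarrow> f \<in> borel_measurable M"
  shows "f \<in> borel_measurable M"
  using assms(1)
  by (induction rule: midpoint_hull.induct) (use assms(2) in \<open>auto intro!: borel_measurable_scaleR borel_measurable_add\<close>)

lemma midpoint_hull_AE_bound:
  fixes F :: "('a \<Rightarrow> 'v::euclidean_space) set"
  assumes "midpoint_hull F f" "\<And>f. f \<in> F \<Longrightarrow> AE x in M. norm (f x) \<le> m x"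
  shows "AE x in M. norm (f x) \<le> m x"
  using assms(1)
proof (induction rule: midpoint_hull.induct)
  case (midpoint f g)
  from midpoint.IH show ?case
  proof eventually_elim
    case (elim x)
    then show ?case using norm_triangle_ineq[of "f x" "g x"] by simp
  qed
qed (use assms(2) in auto)

text \<open>
  Mazur's lemma for a dominated sequence, without weak topologies. Minimize the weighted \<open>L\<^sup>2\<close>
  functional \<open>Q\<close> over the midpoint hulls of the tails. The infima increase to a finite limit, and the
  parallelogram law turns almost minimizers into a Cauchy sequence. The weight \<open>1 / \<rho>\<close> makes \<open>Q\<close>
  finite although the functions are only integrable, and integrability of \<open>\<rho>\<close> lets one return from
  the weighted \<open>L\<^sup>2\<close> norm to \<open>L\<^sup>1\<close>, where a subsequence converges almost everywhere.
\<close>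
lemma dominated_sequence_midpoint_convergence:
  fixes u :: "nat \<Rightarrow> 'a \<Rightarrow> 'v::euclidean_space"
  assumes M: "finite_measure M"
    and u[measurable]: "\<And>n. u n \<in> borel_measurable M" and m: "integrable M m"
    and um: "\<And>n. AE x in M. norm (u n x) \<le> m x"
  shows "\<exists>g w. (\<forall>n. midpoint_hull (u ` {n..}) (g n)) \<and> w \<in> borel_measurable M \<and>
     (AE x in M. norm (w x) \<le> m x) \<and> (AE x in M. (\<lambda>n. g n x) \<longlonglongrightarrow> w x)"
proof -
  interpret finite_measure M by (rule M)
  have m_meas[measurable]: "m \<in> borel_measurable M" using m by auto
  define \<rho> where "\<rho> x = 1 + \<bar>m x\<bar>" for x
  have [measurable]: "\<rho> \<in> borel_measurable M" unfolding \<rho>_def[abs_def] by measurable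
  have \<rho>: "integrable M \<rho>" unfolding \<rho>_def[abs_def] using m by (intro Bochner_Integration.integrable_add) auto
  have \<rho>1: "\<rho> x \<ge> 1" "\<rho> x \<ge> m x" for x by (auto simp: \<rho>_def)
  define H where "H n = Collect (midpoint_hull (u ` {n..}))" for n
  have H_meas[measurable (raw)]: "g \<in> H n \<Longrightarrow> g \<in> borel_measurable M" for g n
    unfolding H_def using u by (auto intro: midpoint_hull_measurable)
  have H_bound: "AE x in M. norm (g x) \<le> m x" if "g \<in> H n" for g n
    using that um unfolding H_def by (auto intro: midpoint_hull_AE_bound)
  have H_mono: "H l \<subseteq> H n" if "n \<le> l" for n l
    unfolding H_def using that by (auto intro!: midpoint_hull_mono[of "u ` {l..}"])
  have H_mid: "(\<lambda>x. (1/2) *\<^sub>R (f x + g x)) \<in> H n" if "f \<in> H n" "g \<in> H n" for f g n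
    using that unfolding H_def by (auto intro: midpoint_hull.midpoint)
  define q where "q g x = (norm (g x))\<^sup>2 / \<rho> x" for g :: "'a \<Rightarrow> 'v" and x
  define Q where "Q g = (LINT x|M. q g x)" for g
  have q_nonneg: "0 \<le> q g x" for g x using \<rho>1(1)[of x] by (auto simp: q_def)
  have q_le: "q g x \<le> \<rho> x" if "norm (g x) \<le> m x" for g x
  proof -
    have "(norm (g x))\<^sup>2 \<le> (\<rho> x)\<^sup>2"
      using that \<rho>1[of x] by (intro power_mono) auto
    then show ?thesis using \<rho>1(1)[of x] by (simp add: q_def pos_divide_le_eq power2_eq_square)
  qed
  have q_int: "integrable M (q g)" if "g \<in> H n" for g n
  proof (rule Bochner_Integration.integrable_bound[OF \<rho>])
    show "q g \<in> borel_measurable M" unfolding q_def[abs_def] using H_meas[OF that] by measurable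
    show "AE x in M. norm (q g x) \<le> norm (\<rho> x)"
      using H_bound[OF that]
    proof eventually_elim
      case (elim x)
      then show ?case using q_le[of g x] q_nonneg[of g x] by simp
    qed
  qed
  have Q_nonneg: "0 \<le> Q g" for g unfolding Q_def by (intro Bochner_Integration.integral_nonneg q_nonneg)
  have Q_le: "Q g \<le> (LINT x|M. \<rho> x)" if "g \<in> H n" for g n
    unfolding Q_def
    by (rule integral_mono_AE[OF q_int[OF that] \<rho>]) (use H_bound[OF that] q_le in \<open>auto elim!: eventually_mono\<close>)
  have H_ne: "u n \<in> H n" for n by (auto simp: H_def intro: midpoint_hull.base)
  define d where "d n = Inf (Q ` H n)" for n
  have bdd: "bdd_below (Q ` H n)" for n by (rule bdd_belowI[of _ 0]) (auto simp: Q_nonneg)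
  have d_le: "d n \<le> Q g" if "g \<in> H n" for g n
    unfolding d_def using that bdd by (intro cInf_lower) auto
  have "incseq d"
    unfolding d_def incseq_def using bdd H_ne by (intro allI impI cInf_superset_mono image_mono H_mono) auto
  moreover have "d n \<le> (LINT x|M. \<rho> x)" for n
    using d_le[OF H_ne, of n] Q_le[OF H_ne, of n] by linarith
  ultimately have "convergent d"
    by (meson incseq_convergent convergent_def)
  then have d_Cauchy: "Cauchy d" by (rule convergent_Cauchy)
  define \<epsilon> where "\<epsilon> n = 1 / real (Suc n)" for n
  have \<epsilon>: "0 < \<epsilon> n" "n \<le> l \<Longrightarrow> \<epsilon> l \<le> \<epsilon> n" for n l
    by (simp_all add: \<epsilon>_def frac_le)
  have "\<exists>g. g \<in> H n \<and> Q g < d n + \<epsilon> n" for n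
    using cInf_lessD[of "Q ` H n" "d n + \<epsilon> n"] H_ne[of n] \<epsilon>(1)[of n] unfolding d_def by force
  then obtain g where g: "\<And>n. g n \<in> H n" "\<And>n. Q (g n) < d n + \<epsilon> n"
    by metis
  have g_meas[measurable]: "g n \<in> borel_measurable M" for n using g(1) by (rule H_meas)
  have half: "Q (\<lambda>x. (1/2) *\<^sub>R (g n x - g l x)) \<le> (d l - d n) / 2 + \<epsilon> n"
    and half_int: "integrable M (q (\<lambda>x. (1/2) *\<^sub>R (g n x - g l x)))" if "n \<le> l" for n l
  proof -
    have gl: "g l \<in> H n" using g(1) H_mono[OF that] by auto
    note mid = H_mid[OF g(1)[of n] gl]
    have par: "q (\<lambda>x. (1/2) *\<^sub>R (g n x - g l x)) x = (q (g n) x + q (g l) x) / 2 - q (\<lambda>x. (1/2) *\<^sub>R (g n x + g l x)) x" for x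
    proof -
      have "(norm ((1/2) *\<^sub>R (g n x - g l x)))\<^sup>2 = ((norm (g n x))\<^sup>2 + (norm (g l x))\<^sup>2) / 2 - (norm ((1/2) *\<^sub>R (g n x + g l x)))\<^sup>2"
        by (simp add: power2_norm_eq_inner inner_add inner_diff inner_commute field_simps)
      then show ?thesis unfolding q_def by (simp add: add_divide_distrib diff_divide_distrib)
    qed
    note I = q_int[OF g(1)[of n]] q_int[OF gl] q_int[OF mid]
    show "integrable M (q (\<lambda>x. (1/2) *\<^sub>R (g n x - g l x)))"
      unfolding par[abs_def] using I by auto
    have "Q (\<lambda>x. (1/2) *\<^sub>R (g n x - g l x)) = (Q (g n) + Q (g l)) / 2 - Q (\<lambda>x. (1/2) *\<^sub>R (g n x + g l x))"
      unfolding Q_def par using I by simp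
    moreover have "x \<le> (d l - d n) / 2 + e" if "x = (y + z) / 2 - w" "e' \<le> e" "d n \<le> w" "y < d n + e" "z < d l + e'"
      for x y z w e e' :: real using that by argo
    moreover have "\<epsilon> l \<le> \<epsilon> n" using that by (rule \<epsilon>(2))
    ultimately show "Q (\<lambda>x. (1/2) *\<^sub>R (g n x - g l x)) \<le> (d l - d n) / 2 + \<epsilon> n"
      using d_le[OF mid] g(2)[of n] g(2)[of l] by blast
  qed
  have g_int: "integrable M (g n)" for n
    by (rule Bochner_Integration.integrable_bound[OF m g_meas]) (use H_bound[OF g(1)[of n]] in \<open>auto elim!: eventually_mono\<close>)
  have L1: "\<exists>N. \<forall>i\<ge>N. \<forall>j\<ge>N. (LINT x|M. norm (g i x - g j x)) < e" if e: "e > 0" for e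
  proof -
    define R where "R = (LINT x|M. \<rho> x)"
    have R: "R \<ge> 0" unfolding R_def by (intro Bochner_Integration.integral_nonneg) (simp add: \<rho>_def)
    define c where "c = 2 * (R + 1) / e"
    have c: "c > 0" using R e by (simp add: c_def)
    obtain N1 where N1: "\<And>i j. i \<ge> N1 \<Longrightarrow> j \<ge> N1 \<Longrightarrow> \<bar>d i - d j\<bar> < e / (4 * c)"
      using metric_CauchyD[OF d_Cauchy, of "e / (4 * c)"] e c by (auto simp: dist_real_def)
    obtain N2 where N2: "\<epsilon> N2 < e / (8 * c)"
      using reals_Archimedean[of "e / (8 * c)"] e c by (auto simp: inverse_eq_divide \<epsilon>_def)
    define N where "N = max N1 N2"
    have *: "(LINT x|M. norm (g i x - g j x)) < e" if "i \<le> j" "N \<le> i" for i j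
    proof -
      (* Young's inequality replaces Cauchy-Schwarz; the constant c balances the two terms. *)
      have pt: "norm (g i x - g j x) \<le> c * q (\<lambda>x. (1/2) *\<^sub>R (g i x - g j x)) x + \<rho> x / c" for x
      proof -
        define y where "y = norm ((1/2) *\<^sub>R (g i x - g j x))"
        have r: "\<rho> x > 0" using \<rho>1(1)[of x] by simp
        have "0 \<le> (c * y - \<rho> x)\<^sup>2 / (c * \<rho> x)" using r c by simp
        also have "\<dots> = c * (y\<^sup>2 / \<rho> x) + \<rho> x / c - 2 * y"
          using r c by (simp add: power2_eq_square field_simps)
        finally show ?thesis by (simp add: q_def y_def)
      qed
      have "(LINT x|M. norm (g i x - g j x)) \<le> (LINT x|M. c * q (\<lambda>x. (1/2) *\<^sub>R (g i x - g j x)) x + \<rho> x / c)"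
        using pt g_int \<rho> half_int[OF \<open>i \<le> j\<close>] by (intro integral_mono) auto
      also have "\<dots> = c * Q (\<lambda>x. (1/2) *\<^sub>R (g i x - g j x)) + R / c"
        using \<rho> half_int[OF \<open>i \<le> j\<close>] by (simp add: Q_def R_def)
      also have "\<dots> \<le> c * ((d j - d i) / 2 + \<epsilon> i) + R / c"
        using half[OF \<open>i \<le> j\<close>] c by simp
      also have "\<dots> \<le> c * ((e / (4 * c)) / 2 + e / (8 * c)) + R / c"
      proof -
        have "\<epsilon> i \<le> \<epsilon> N2" using that by (intro \<epsilon>(2)) (simp add: N_def)
        moreover have "d j - d i \<le> e / (4 * c)" using N1[of j i] that by (simp add: N_def)
        ultimately have "(d j - d i) / 2 + \<epsilon> i \<le> (e / (4 * c)) / 2 + e / (8 * c)"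
          using N2 by (intro add_mono divide_right_mono) auto
        then show ?thesis using c by (intro add_right_mono mult_left_mono) auto
      qed
      also have "\<dots> = e / 4 + R / c" using c by (simp add: field_simps)
      also have "e / 4 + R / c < e"
      proof -
        have "R / c < e / 2" using c R e by (simp add: c_def field_simps)
        then show ?thesis using e by simp
      qed
      finally show ?thesis .
    qed
    have "(LINT x|M. norm (g i x - g j x)) < e" if "N \<le> i" "N \<le> j" for i j
      using *[of i j] *[of j i] that by (cases "i \<le> j") (auto simp: norm_minus_commute)
    then show ?thesis by blast
  qed
  obtain r where r: "strict_mono r" "AE x in M. Cauchy (\<lambda>i. g (r i) x)"
    using cauchy_L1_AE_cauchy_subseq[OF g_int L1] by blast
  define w where "w x = lim (\<lambda>i. g (r i) x)" for x
  have lim: "AE x in M. (\<lambda>i. g (r i) x) \<longlonglongrightarrow> w x"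
    using r(2) by eventually_elim (simp add: w_def convergent_LIMSEQ_iff[symmetric] Cauchy_convergent_iff)
  have "AE x in M. \<forall>i. norm (g (r i) x) \<le> m x"
    using H_bound[OF g(1)] by (subst AE_all_countable) blast
  with lim have "AE x in M. norm (w x) \<le> m x"
    by eventually_elim (rule LIMSEQ_le_const2[OF tendsto_norm], auto)
  moreover have "w \<in> borel_measurable M" unfolding w_def[abs_def] by measurable
  moreover have "midpoint_hull (u ` {i..}) (g (r i))" for i
    using g(1)[of "r i"] H_mono[OF seq_suble[OF r(1), of i]] by (auto simp: H_def)
  ultimately show ?thesis using lim by (intro exI[of _ "\<lambda>i. g (r i)"] exI[of _ w]) auto
qed

section \<open>The Duhamel integral\<close>

lemma integral_norm_bound_integral_AE:
  fixes f :: "'a::euclidean_space \<Rightarrow> 'b::banach"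
  assumes f: "f integrable_on S" and g: "g integrable_on S" and le: "AE x in lebesgue. x \<in> S \<longrightarrow> norm (f x) \<le> g x"
  shows "norm (integral S f) \<le> integral S g"
proof -
  define N where "N = {x. \<not> (x \<in> S \<longrightarrow> norm (f x) \<le> g x)}"
  have N: "negligible N"
    using le unfolding N_def negligible_iff_null_sets by (simp add: completion.AE_iff_null_sets)
  define f' where "f' x = (if x \<in> N then 0 else f x)" for x
  define g' where "g' x = (if x \<in> N then 0 else g x)" for x
  have "(f' has_integral integral S f) S"
    by (rule has_integral_spike[OF N _ integrable_integral[OF f]]) (simp add: f'_def)
  moreover have "(g' has_integral integral S g) S"
    by (rule has_integral_spike[OF N _ integrable_integral[OF g]]) (simp add: g'_def)
  moreover have "norm (f' x) \<le> g' x" if "x \<in> S" for x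
    using that by (auto simp: f'_def g'_def N_def)
  ultimately show ?thesis
    using integral_norm_bound_integral[of f' S g'] by (metis has_integral_integrable integral_unique)
qed

lemma absolutely_integrable_bound_AE:
  fixes f :: "'a::euclidean_space \<Rightarrow> 'v::euclidean_space"
  assumes S: "S \<in> sets lebesgue" and f: "f \<in> borel_measurable lebesgue" and m: "(m :: _ \<Rightarrow> real) absolutely_integrable_on S"
    and le: "AE x in lebesgue. x \<in> S \<longrightarrow> norm (f x) \<le> m x"
  shows "f absolutely_integrable_on S"
  unfolding set_integrable_def
proof (rule Bochner_Integration.integrable_bound)
  show "integrable lebesgue (\<lambda>x. indicat_real S x *\<^sub>R m x)"
    using m by (simp add: set_integrable_def)
  show "(\<lambda>x. indicat_real S x *\<^sub>R f x) \<in> borel_measurable lebesgue"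
    using S f by (intro borel_measurable_scaleR borel_measurable_indicator)
  show "AE x in lebesgue. norm (indicat_real S x *\<^sub>R f x) \<le> norm (indicat_real S x *\<^sub>R m x)"
    using le by eventually_elim (auto simp: indicator_def)
qed

text \<open>
  A function with small primitive has a small integral against a continuous kernel: on each of \<open>N\<close>
  cells of length \<open>h\<close> the kernel differs by at most \<open>\<omega>\<close> from its value at the left end point, and the
  frozen kernel only sees the increment of the primitive.
\<close>
lemma norm_integral_partition_bound:
  fixes k :: "real \<Rightarrow> 'v::euclidean_space \<Rightarrow> 'b::banach"
  assumes "c \<le> d" "d - c \<le> real N * h" "0 \<le> h" "0 \<le> \<eta>" "0 \<le> \<kappa>"
    and "\<And>\<tau>. \<tau> \<in> {c..d} \<Longrightarrow> linear (k \<tau>)"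
    and "\<And>\<tau> p. \<tau> \<in> {c..d} \<Longrightarrow> norm (k \<tau> p) \<le> \<kappa> * norm p"
    and "\<And>\<tau> \<tau>' p. \<tau> \<in> {c..d} \<Longrightarrow> \<tau>' \<in> {c..d} \<Longrightarrow> \<bar>\<tau> - \<tau>'\<bar> \<le> h \<Longrightarrow> norm (k \<tau> p - k \<tau>' p) \<le> \<omega> * norm p"
    and "(\<lambda>\<tau>. k \<tau> (v \<tau>)) integrable_on {c..d}" and "v absolutely_integrable_on {c..d}"
    and "\<And>c' d'. c \<le> c' \<Longrightarrow> c' \<le> d' \<Longrightarrow> d' \<le> d \<Longrightarrow> norm (integral {c'..d'} v) \<le> \<eta>"
  shows "norm (integral {c..d} (\<lambda>\<tau>. k \<tau> (v \<tau>))) \<le> \<omega> * integral {c..d} (\<lambda>\<tau>. norm (v \<tau>)) + real N * \<kappa> * \<eta>"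
  using assms
proof (induction N arbitrary: c)
  case 0
  then show ?case by simp
next
  case (Suc N)
  define e where "e = min d (c + h)"
  have e: "c \<le> e" "e \<le> d" "e - c \<le> h" using Suc.prems(1,3) by (auto simp: e_def)
  have sub: "{c..e} \<subseteq> {c..d}" "{e..d} \<subseteq> {c..d}" using e by auto
  have ki: "(\<lambda>\<tau>. k \<tau> (v \<tau>)) integrable_on {c..e}" "(\<lambda>\<tau>. k \<tau> (v \<tau>)) integrable_on {e..d}"
    using integrable_on_subinterval[OF Suc.prems(9)] sub by auto
  have vi: "v absolutely_integrable_on {c..e}" "v absolutely_integrable_on {e..d}"
    using absolutely_integrable_on_subinterval[OF Suc.prems(10)] sub by auto
  have vi': "v integrable_on {c..e}" "(\<lambda>\<tau>. norm (v \<tau>)) integrable_on {c..e}" "(\<lambda>\<tau>. norm (v \<tau>)) integrable_on {c..d}"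
    using vi(1) Suc.prems(10) by (auto simp: absolutely_integrable_on_def)
  have blc: "bounded_linear (k c)"
    using Suc.prems(1,6) by (simp add: linear_conv_bounded_linear[symmetric])
  have kc: "((\<lambda>\<tau>. k c (v \<tau>)) has_integral k c (integral {c..e} v)) {c..e}"
    using has_integral_linear[OF integrable_integral[OF vi'(1)] blc] by (simp add: o_def)
  have 1: "norm (integral {c..e} (\<lambda>\<tau>. k \<tau> (v \<tau>) - k c (v \<tau>))) \<le> integral {c..e} (\<lambda>\<tau>. \<omega> * norm (v \<tau>))"
  proof (rule integral_norm_bound_integral)
    show "(\<lambda>\<tau>. k \<tau> (v \<tau>) - k c (v \<tau>)) integrable_on {c..e}"
      using ki(1) kc by (intro integrable_diff) auto
    show "(\<lambda>\<tau>. \<omega> * norm (v \<tau>)) integrable_on {c..e}" using vi'(2) by (intro integrable_on_mult_right)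
    fix \<tau> assume "\<tau> \<in> {c..e}"
    then show "norm (k \<tau> (v \<tau>) - k c (v \<tau>)) \<le> \<omega> * norm (v \<tau>)"
      using e by (intro Suc.prems(8)) auto
  qed
  have 2: "norm (k c (integral {c..e} v)) \<le> \<kappa> * \<eta>"
    using Suc.prems(7)[of c "integral {c..e} v"] Suc.prems(11)[of c e] e Suc.prems(1,5)
    by (smt (verit, best) atLeastAtMost_iff mult_left_mono)
  have "integral {c..e} (\<lambda>\<tau>. k \<tau> (v \<tau>)) = integral {c..e} (\<lambda>\<tau>. k \<tau> (v \<tau>) - k c (v \<tau>)) + k c (integral {c..e} v)"
    using ki(1) kc by (subst Henstock_Kurzweil_Integration.integral_diff) (auto simp: integral_unique)
  then have A: "norm (integral {c..e} (\<lambda>\<tau>. k \<tau> (v \<tau>))) \<le> \<omega> * integral {c..e} (\<lambda>\<tau>. norm (v \<tau>)) + \<kappa> * \<eta>"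
    using norm_triangle_le[OF add_mono[OF 1 2]] by simp
  have B: "norm (integral {e..d} (\<lambda>\<tau>. k \<tau> (v \<tau>))) \<le> \<omega> * integral {e..d} (\<lambda>\<tau>. norm (v \<tau>)) + real N * \<kappa> * \<eta>"
  proof (rule Suc.IH)
    show "d - e \<le> real N * h"
    proof (cases "e = d")
      case True
      then show ?thesis using Suc.prems(3) by simp
    next
      case False
      then have "e = c + h" by (auto simp: e_def min_def split: if_splits)
      then show ?thesis using Suc.prems(2) by (simp add: algebra_simps)
    qed
    show "norm (integral {c'..d'} v) \<le> \<eta>" if "e \<le> c'" "c' \<le> d'" "d' \<le> d" for c' d'
      using that e by (intro Suc.prems(11)) auto
  qed (use Suc.prems(3-8) e ki(2) vi(2) in auto)
  have "integral {c..d} (\<lambda>\<tau>. k \<tau> (v \<tau>)) = integral {c..e} (\<lambda>\<tau>. k \<tau> (v \<tau>)) + integral {e..d} (\<lambda>\<tau>. k \<tau> (v \<tau>))"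
    using Henstock_Kurzweil_Integration.integral_combine[OF e(1,2) Suc.prems(9)] by simp
  moreover have "integral {c..d} (\<lambda>\<tau>. norm (v \<tau>)) = integral {c..e} (\<lambda>\<tau>. norm (v \<tau>)) + integral {e..d} (\<lambda>\<tau>. norm (v \<tau>))"
    using Henstock_Kurzweil_Integration.integral_combine[OF e(1,2) vi'(3)] by simp
  ultimately show ?case
    using norm_triangle_le[OF add_mono[OF A B]] by (simp add: algebra_simps)
qed

locale control_semigroup =
  fixes \<Psi> :: "real \<Rightarrow> 'b::banach \<Rightarrow> 'b" and B :: "'v::euclidean_space \<Rightarrow> 'b"
  assumes semigroup: "C0_semigroup \<Psi>" and control: "bounded_linear B"
begin

lemma bounded_linear_semigroup: "0 \<le> s \<Longrightarrow> bounded_linear (\<Psi> s)"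
  using semigroup by (simp add: C0_semigroup_def)

lemma semigroup_0 [simp]: "\<Psi> 0 x = x"
  using semigroup by (simp add: C0_semigroup_def)

lemma semigroup_add: "0 \<le> s \<Longrightarrow> 0 \<le> t \<Longrightarrow> \<Psi> (s + t) x = \<Psi> s (\<Psi> t x)"
  using semigroup by (simp add: C0_semigroup_def)

lemma bounded_linear_kernel: "0 \<le> s \<Longrightarrow> bounded_linear (\<lambda>p. \<Psi> s (B p))"
  by (rule bounded_linear_compose[OF bounded_linear_semigroup control])

lemma kernel_bound:
  obtains \<kappa> where "\<kappa> \<ge> 0" "\<And>s p. 0 \<le> s \<Longrightarrow> s \<le> L \<Longrightarrow> norm (\<Psi> s (B p)) \<le> \<kappa> * norm p"
proof -
  obtain M where M: "M \<ge> 1" "\<And>s x. 0 \<le> s \<Longrightarrow> s \<le> L \<Longrightarrow> norm (\<Psi> s x) \<le> M * norm x"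
    using C0_semigroup_locally_bounded[OF semigroup] by blast
  obtain b where b: "\<And>p. norm (B p) \<le> norm p * b" "b > 0"
    using bounded_linear.pos_bounded[OF control] by blast
  show thesis
  proof (rule that[of "M * b"])
    show "0 \<le> M * b" using M b by simp
    fix s p assume "0 \<le> s" "s \<le> L"
    from M(2)[OF this, of "B p"] have "norm (\<Psi> s (B p)) \<le> M * norm (B p)" .
    also have "\<dots> \<le> M * (norm p * b)" using M b by (intro mult_left_mono) auto
    finally show "norm (\<Psi> s (B p)) \<le> M * b * norm p" by (simp add: ac_simps)
  qed
qed

lemma kernel_uniformly_continuous:
  "0 < \<omega> \<Longrightarrow> \<exists>h>0. \<forall>s\<in>{0..L}. \<forall>s'\<in>{0..L}. \<bar>s - s'\<bar> \<le> h \<longrightarrow> (\<forall>p. norm (\<Psi> s (B p) - \<Psi> s' (B p)) \<le> \<omega> * norm p)"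
  by (rule C0_semigroup_control_uniformly_continuous[OF semigroup control])

lemma strong_bochner_duhamel:
  assumes w: "set_integrable lebesgue {c<..<t} w"
  shows "\<exists>I. has_strong_bochner_integral lebesgue (\<lambda>\<tau>. indicator {c<..<t} \<tau> *\<^sub>R \<Psi> (t - \<tau>) (B (w \<tau>))) I"
proof -
  obtain \<kappa> where \<kappa>: "\<And>s p. 0 \<le> s \<Longrightarrow> s \<le> t - c \<Longrightarrow> norm (\<Psi> s (B p)) \<le> \<kappa> * norm p"
    using kernel_bound by blast
  show ?thesis
    by (rule strong_bochner_kernel_exists[where k = "\<lambda>s p. \<Psi> s (B p)", OF _ \<kappa> kernel_uniformly_continuous w])
      (auto intro: bounded_linear.linear bounded_linear_kernel)
qed

abbreviation response :: "real \<Rightarrow> (real \<Rightarrow> 'v) \<Rightarrow> real \<Rightarrow> 'b" where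
  "response t w \<equiv> \<lambda>\<tau>. \<Psi> (t - \<tau>) (B (w \<tau>))"

lemma strong_bochner_duhamel_has_integral:
  assumes "has_strong_bochner_integral lebesgue (\<lambda>\<tau>. indicator {c<..<t} \<tau> *\<^sub>R \<Psi> (t - \<tau>) (B (w \<tau>))) I"
  shows "((response t w) has_integral I) {c..t}"
proof -
  have "((\<lambda>\<tau>. indicat_real {c<..<t} \<tau> *\<^sub>R \<Psi> (t - \<tau>) (B (w \<tau>))) has_integral I) {c..t}"
    by (rule strong_bochner_imp_has_integral[OF assms]) (auto simp: indicator_def)
  then show ?thesis
    by (rule has_integral_spike_finite[of "{c, t}", rotated 2]) (auto simp: indicator_def)
qed

lemma strong_bochner_duhamel_iff:
  assumes w: "set_integrable lebesgue {c<..<t} w"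
  shows "has_strong_bochner_integral lebesgue (\<lambda>\<tau>. indicator {c<..<t} \<tau> *\<^sub>R \<Psi> (t - \<tau>) (B (w \<tau>))) I \<longleftrightarrow>
    I = integral {c..t} (response t w)"
  using strong_bochner_duhamel[OF w] strong_bochner_duhamel_has_integral[of c t w] integral_unique by metis

lemma duhamel_integrable:
  assumes w: "w absolutely_integrable_on {a..b}" and "a \<le> c" "t \<le> d" "d \<le> b"
  shows "(response d w) integrable_on {c..t}"
proof -
  have "set_integrable lebesgue {a<..<d} w"
    by (rule set_integrable_subset[OF w]) (use assms in auto)
  from strong_bochner_duhamel[OF this] have "(response d w) integrable_on {a..d}"
    using strong_bochner_duhamel_has_integral by blast
  then show ?thesis
    by (rule integrable_on_subinterval) (use assms in auto)
qed

definition duhamel :: "real \<Rightarrow> (real \<Rightarrow> 'v) \<Rightarrow> real \<Rightarrow> 'b" where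
  "duhamel a w t = integral {a..t} (response t w)"

lemma duhamel_bound:
  assumes w: "w absolutely_integrable_on {a..b}" and m: "m integrable_on {a..b}"
    and le: "AE \<tau> in lebesgue. \<tau> \<in> {a..b} \<longrightarrow> norm (w \<tau>) \<le> m \<tau>"
    and \<kappa>: "0 \<le> \<kappa>" "\<And>s p. 0 \<le> s \<Longrightarrow> s \<le> b - a \<Longrightarrow> norm (\<Psi> s (B p)) \<le> \<kappa> * norm p"
    and ct: "a \<le> c" "t \<le> d" "d \<le> b"
  shows "norm (integral {c..t} (response d w)) \<le> \<kappa> * integral {c..t} m"
proof -
  have m': "m integrable_on {c..t}"
    by (rule integrable_on_subinterval[OF m]) (use ct in auto)
  have "norm (integral {c..t} (response d w)) \<le> integral {c..t} (\<lambda>\<tau>. \<kappa> * m \<tau>)"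
  proof (rule integral_norm_bound_integral_AE)
    show "(response d w) integrable_on {c..t}" by (rule duhamel_integrable[OF w ct])
    show "(\<lambda>\<tau>. \<kappa> * m \<tau>) integrable_on {c..t}" using m' by (rule integrable_on_mult_right)
    show "AE \<tau> in lebesgue. \<tau> \<in> {c..t} \<longrightarrow> norm (\<Psi> (d - \<tau>) (B (w \<tau>))) \<le> \<kappa> * m \<tau>"
      using le
    proof eventually_elim
      case (elim \<tau>)
      show ?case
      proof
        assume "\<tau> \<in> {c..t}"
        then have "norm (\<Psi> (d - \<tau>) (B (w \<tau>))) \<le> \<kappa> * norm (w \<tau>)" using ct by (intro \<kappa>(2)) auto
        also have "\<dots> \<le> \<kappa> * m \<tau>" using elim \<open>\<tau> \<in> {c..t}\<close> ct \<kappa>(1) by (intro mult_left_mono) auto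
        finally show "norm (\<Psi> (d - \<tau>) (B (w \<tau>))) \<le> \<kappa> * m \<tau>" .
      qed
    qed
  qed
  then show ?thesis by simp
qed

lemma duhamel_cong_AE:
  assumes "AE \<tau> in lebesgue. \<tau> \<in> {a..t} \<longrightarrow> w \<tau> = w' \<tau>"
  shows "duhamel a w t = duhamel a w' t"
  unfolding duhamel_def
proof (rule integral_spike)
  show "negligible {\<tau>. \<not> (\<tau> \<in> {a..t} \<longrightarrow> w \<tau> = w' \<tau>)}"
    using assms by (simp add: negligible_iff_null_sets completion.AE_iff_null_sets)
qed auto

lemma duhamel_diff:
  assumes "w absolutely_integrable_on {a..b}" "w' absolutely_integrable_on {a..b}" "t \<le> b"
  shows "duhamel a (\<lambda>\<tau>. w \<tau> - w' \<tau>) t = duhamel a w t - duhamel a w' t"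
proof -
  have "duhamel a w t - duhamel a w' t = integral {a..t} (\<lambda>\<tau>. \<Psi> (t - \<tau>) (B (w \<tau>)) - \<Psi> (t - \<tau>) (B (w' \<tau>)))"
    unfolding duhamel_def using assms by (intro Henstock_Kurzweil_Integration.integral_diff[symmetric] duhamel_integrable) auto
  also have "\<dots> = duhamel a (\<lambda>\<tau>. w \<tau> - w' \<tau>) t"
    unfolding duhamel_def
    by (rule Henstock_Kurzweil_Integration.integral_cong) (simp add: linear_diff[OF bounded_linear.linear[OF bounded_linear_kernel]])
  finally show ?thesis by simp
qed

lemma duhamel_midpoint:
  assumes "w absolutely_integrable_on {a..b}" "w' absolutely_integrable_on {a..b}" "t \<le> b"
  shows "duhamel a (\<lambda>\<tau>. (1/2) *\<^sub>R (w \<tau> + w' \<tau>)) t = (1/2) *\<^sub>R (duhamel a w t + duhamel a w' t)"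
proof -
  have "(1/2) *\<^sub>R (duhamel a w t + duhamel a w' t) = (1/2) *\<^sub>R integral {a..t} (\<lambda>\<tau>. \<Psi> (t - \<tau>) (B (w \<tau>)) + \<Psi> (t - \<tau>) (B (w' \<tau>)))"
    unfolding duhamel_def using assms by (subst Henstock_Kurzweil_Integration.integral_add) (auto intro!: duhamel_integrable)
  also have "\<dots> = integral {a..t} (\<lambda>\<tau>. (1/2) *\<^sub>R (\<Psi> (t - \<tau>) (B (w \<tau>)) + \<Psi> (t - \<tau>) (B (w' \<tau>))))"
    by (rule integral_cmul[symmetric])
  also have "\<dots> = duhamel a (\<lambda>\<tau>. (1/2) *\<^sub>R (w \<tau> + w' \<tau>)) t"
    unfolding duhamel_def
    by (rule Henstock_Kurzweil_Integration.integral_cong)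
      (simp add: linear_add[OF bounded_linear.linear[OF bounded_linear_kernel]] linear_scale[OF bounded_linear.linear[OF bounded_linear_kernel]])
  finally show ?thesis by simp
qed

text \<open>
  The semigroup law propagates what was accumulated up to time \<open>c\<close>. All concatenation arguments rest
  on this formula.
\<close>
lemma duhamel_restart:
  assumes w: "w absolutely_integrable_on {a..b}" and ct: "a \<le> c" "c \<le> t" "t \<le> b"
  shows "duhamel a w t = \<Psi> (t - c) (duhamel a w c) + integral {c..t} (response t w)"
proof -
  have "duhamel a w t = integral {a..c} (response t w) + integral {c..t} (response t w)"
    unfolding duhamel_def using ct
    by (intro Henstock_Kurzweil_Integration.integral_combine[symmetric] duhamel_integrable[OF w]) auto
  also have "integral {a..c} (response t w) = integral {a..c} (\<lambda>\<tau>. \<Psi> (t - c) (\<Psi> (c - \<tau>) (B (w \<tau>))))"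
    using ct semigroup_add[of "t - c"] by (intro Henstock_Kurzweil_Integration.integral_cong) (auto simp flip: semigroup_add)
  also have "\<dots> = \<Psi> (t - c) (duhamel a w c)"
    unfolding duhamel_def
    using integral_linear[OF duhamel_integrable[OF w, of a c c] bounded_linear_semigroup[of "t - c"]] ct by (simp add: o_def)
  finally show ?thesis .
qed

lemma continuous_on_duhamel:
  assumes w: "w absolutely_integrable_on {a..b}"
  shows "continuous_on {a..b} (duhamel a w)"
proof -
  obtain \<kappa> where \<kappa>: "0 \<le> \<kappa>" "\<And>s p. 0 \<le> s \<Longrightarrow> s \<le> b - a \<Longrightarrow> norm (\<Psi> s (B p)) \<le> \<kappa> * norm p"
    using kernel_bound by blast
  have wn: "(\<lambda>\<tau>. norm (w \<tau>)) integrable_on {a..b}"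
    using w by (simp add: absolutely_integrable_on_def)
  define W where "W t = integral {a..t} (\<lambda>\<tau>. norm (w \<tau>))" for t
  have W: "uniformly_continuous_on {a..b} W"
    unfolding W_def by (intro compact_uniformly_continuous indefinite_integral_continuous_1 wn) auto
  have W_mono: "W s \<le> W t" if "a \<le> s" "s \<le> t" "t \<le> b" for s t
    unfolding W_def using that by (intro integral_subset_le integrable_on_subinterval[OF wn]) auto
  define R where "R = W b + 1"
  have R: "R > 0" unfolding R_def W_def by (intro add_nonneg_pos integral_nonneg wn) auto
  have est: "\<exists>h>0. \<forall>s\<in>{a..b}. \<forall>t\<in>{a..b}. s \<le> t \<and> t - s \<le> h \<longrightarrow> norm (duhamel a w t - duhamel a w s) \<le> \<epsilon>" if "\<epsilon> > 0" for \<epsilon>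
  proof -
    have "\<epsilon> / (2 * R) > 0" using that R by simp
    from kernel_uniformly_continuous[OF this, of "b - a"] obtain h1 where h1: "h1 > 0"
      "\<And>s s' p. s \<in> {0..b-a} \<Longrightarrow> s' \<in> {0..b-a} \<Longrightarrow> \<bar>s - s'\<bar> \<le> h1 \<Longrightarrow> norm (\<Psi> s (B p) - \<Psi> s' (B p)) \<le> \<epsilon> / (2 * R) * norm p"
      by blast
    have "\<epsilon> / (2 * (\<kappa> + 1)) > 0" using that \<kappa> by simp
    from uniformly_continuous_onE[OF W this] obtain h2 where h2: "h2 > 0"
      "\<And>s t. s \<in> {a..b} \<Longrightarrow> t \<in> {a..b} \<Longrightarrow> dist t s < h2 \<Longrightarrow> dist (W t) (W s) < \<epsilon> / (2 * (\<kappa> + 1))"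
      by metis
    have "norm (duhamel a w t - duhamel a w s) \<le> \<epsilon>" if st: "s \<in> {a..b}" "t \<in> {a..b}" "s \<le> t" "t - s \<le> min h1 (h2 / 2)" for s t
    proof -
      have I: "(response t w) integrable_on {a..s}" "(response s w) integrable_on {a..s}"
        "(response t w) integrable_on {a..t}"
        using st by (auto intro!: duhamel_integrable[OF w])
      have "duhamel a w t = integral {a..s} (response t w) + integral {s..t} (response t w)"
        unfolding duhamel_def using st by (intro Henstock_Kurzweil_Integration.integral_combine[symmetric] I) auto
      then have "duhamel a w t - duhamel a w s = integral {a..s} (\<lambda>\<tau>. \<Psi> (t - \<tau>) (B (w \<tau>)) - \<Psi> (s - \<tau>) (B (w \<tau>))) + integral {s..t} (response t w)"
        unfolding duhamel_def by (subst Henstock_Kurzweil_Integration.integral_diff[OF I(1,2)]) simp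
      moreover have "norm (integral {a..s} (\<lambda>\<tau>. \<Psi> (t - \<tau>) (B (w \<tau>)) - \<Psi> (s - \<tau>) (B (w \<tau>)))) \<le> integral {a..s} (\<lambda>\<tau>. \<epsilon> / (2 * R) * norm (w \<tau>))"
        using st wn by (intro integral_norm_bound_integral integrable_diff I integrable_on_mult_right h1(2))
          (auto intro: integrable_on_subinterval)
      moreover have "integral {a..s} (\<lambda>\<tau>. \<epsilon> / (2 * R) * norm (w \<tau>)) \<le> \<epsilon> / 2"
      proof -
        have "W s \<le> R" using W_mono[of s b] st by (simp add: R_def)
        then have "\<epsilon> / (2 * R) * W s \<le> \<epsilon> / (2 * R) * R" using \<open>\<epsilon> > 0\<close> R by (intro mult_left_mono) auto
        then show ?thesis using R by (simp add: W_def)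
      qed
      moreover have "norm (integral {s..t} (response t w)) \<le> \<kappa> * integral {s..t} (\<lambda>\<tau>. norm (w \<tau>))"
        using st by (intro duhamel_bound[OF w wn _ \<kappa>]) auto
      moreover have "\<kappa> * integral {s..t} (\<lambda>\<tau>. norm (w \<tau>)) \<le> \<epsilon> / 2"
      proof -
        have "W t = W s + integral {s..t} (\<lambda>\<tau>. norm (w \<tau>))"
          unfolding W_def using st wn
          by (intro Henstock_Kurzweil_Integration.integral_combine[symmetric]) (auto intro: integrable_on_subinterval)
        then have "integral {s..t} (\<lambda>\<tau>. norm (w \<tau>)) \<le> \<epsilon> / (2 * (\<kappa> + 1))"
          using h2(2)[of s t] h2(1) st by (auto simp: dist_real_def)
        then have "\<kappa> * integral {s..t} (\<lambda>\<tau>. norm (w \<tau>)) \<le> \<kappa> * (\<epsilon> / (2 * (\<kappa> + 1)))"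
          using \<kappa>(1) by (intro mult_left_mono) auto
        also have "\<dots> \<le> \<epsilon> / 2" using \<kappa>(1) \<open>\<epsilon> > 0\<close> by (simp add: field_simps)
        finally show ?thesis .
      qed
      ultimately show ?thesis
        using norm_triangle_ineq[of "integral {a..s} (\<lambda>\<tau>. \<Psi> (t - \<tau>) (B (w \<tau>)) - \<Psi> (s - \<tau>) (B (w \<tau>)))" "integral {s..t} (response t w)"]
        by simp
    qed
    then show ?thesis using h1(1) h2(1) by (intro exI[of _ "min h1 (h2 / 2)"]) auto
  qed
  show ?thesis
    unfolding continuous_on_iff
  proof (intro ballI allI impI)
    fix s \<epsilon> :: real assume s: "s \<in> {a..b}" "0 < \<epsilon>"
    then obtain h where h: "h > 0" "\<And>s t. s \<in> {a..b} \<Longrightarrow> t \<in> {a..b} \<Longrightarrow> s \<le> t \<Longrightarrow> t - s \<le> h \<Longrightarrow> norm (duhamel a w t - duhamel a w s) \<le> \<epsilon>/2"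
      using est[of "\<epsilon>/2"] by (auto simp: Ball_def)
    have "dist (duhamel a w t) (duhamel a w s) < \<epsilon>" if "t \<in> {a..b}" "dist t s < h" for t
      using h(2)[of s t] h(2)[of t s] that s by (cases "s \<le> t") (auto simp: dist_norm norm_minus_commute)
    then show "\<exists>d>0. \<forall>x'\<in>{a..b}. dist x' s < d \<longrightarrow> dist (duhamel a w x') (duhamel a w s) < \<epsilon>"
      using h(1) by blast
  qed
qed

end

section \<open>Compactness of Duhamel integrals\<close>

context control_semigroup begin

text \<open>
  The common bound makes the primitives equicontinuous; Arzela-Ascoli is applied to them rather than
  to the state trajectories, since bounded sets of the state space need not be relatively compact.
\<close>
lemma duhamel_uniformly_convergent_subsequence:
  fixes u :: "nat \<Rightarrow> real \<Rightarrow> 'v"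
  assumes u: "\<And>n. u n absolutely_integrable_on {a..b}" and m: "m integrable_on {a..b}"
    and le: "\<And>n. AE \<tau> in lebesgue. \<tau> \<in> {a..b} \<longrightarrow> norm (u n \<tau>) \<le> m \<tau>"
  obtains r \<Phi> where "strict_mono r" "uniform_limit {a..b} (\<lambda>n. duhamel a (u (r n))) \<Phi> sequentially"
proof -
  have ui: "u n integrable_on {c..d}" if "a \<le> c" "d \<le> b" for n c d
    using that u[of n] by (auto simp: absolutely_integrable_on_def intro: integrable_on_subinterval)
  have mi: "m integrable_on {c..d}" if "a \<le> c" "d \<le> b" for c d
    using that by (intro integrable_on_subinterval[OF m]) auto
  have int_le: "norm (integral {c..d} (u n)) \<le> integral {c..d} m" if "a \<le> c" "d \<le> b" for n c d
    using ui[OF that] mi[OF that] by (rule integral_norm_bound_integral_AE) (use le[of n] that in \<open>auto elim!: eventually_mono\<close>)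
  define V where "V n t = integral {a..t} (u n)" for n t
  define M where "M t = integral {a..t} m" for t
  have V_diff: "V n d - V n c = integral {c..d} (u n)" if "a \<le> c" "c \<le> d" "d \<le> b" for n c d
    unfolding V_def using Henstock_Kurzweil_Integration.integral_combine[OF that(1,2) ui[of a d n]] that by (simp add: algebra_simps)
  have M_diff: "M d - M c = integral {c..d} m" if "a \<le> c" "c \<le> d" "d \<le> b" for c d
    unfolding M_def using Henstock_Kurzweil_Integration.integral_combine[OF that(1,2) mi[of a d]] that by (simp add: algebra_simps)
  have V_le: "norm (V n d - V n c) \<le> \<bar>M d - M c\<bar>" if "c \<in> {a..b}" "d \<in> {a..b}" for n c d
  proof -
    have *: "norm (V n d - V n c) \<le> M d - M c" if "c \<in> {a..b}" "d \<in> {a..b}" "c \<le> d" for c d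
      using that int_le[of c d n] by (simp add: V_diff M_diff)
    show ?thesis
      using *[of c d] *[of d c] that by (cases "c \<le> d") (auto simp: norm_minus_commute)
  qed
  have M_mono: "M c \<le> M d" if "a \<le> c" "c \<le> d" "d \<le> b" for c d
    using order.trans[OF norm_ge_zero int_le[of c d 0]] M_diff[OF that] that by simp
  have M_cont: "continuous_on {a..b} M"
    unfolding M_def by (rule indefinite_integral_continuous_1[OF m])
    have bnd: "norm (V n x) \<le> integral {a..b} m" if "x \<in> {a..b}" for n x
    proof -
      have 1: "norm (V n x) \<le> M x" using int_le[of a x n] that by (simp add: V_def M_def)
      also have "M x \<le> M b" using M_mono that by simp
      finally show ?thesis by (simp add: M_def)
    qed
    have equi: "\<exists>d>0. \<forall>n y. y \<in> {a..b} \<and> norm (x - y) < d \<longrightarrow> norm (V n x - V n y) < e" if x: "x \<in> {a..b}" "0 < e" for x e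
    proof -
      obtain d where d: "d > 0" "\<And>y. y \<in> {a..b} \<Longrightarrow> dist y x < d \<Longrightarrow> dist (M y) (M x) < e"
        using M_cont[unfolded continuous_on_iff, rule_format, OF x] by blast
      have "norm (V n x - V n y) < e" if "y \<in> {a..b}" "norm (x - y) < d" for n y
        using V_le[of y x n] d(2)[of y] that x by (auto simp: dist_real_def abs_minus_commute)
      then show ?thesis using d(1) by blast
    qed
  obtain g and r :: "nat \<Rightarrow> nat" where r: "strict_mono r" and g: "\<And>e. 0 < e \<Longrightarrow> \<exists>N. \<forall>n x. n \<ge> N \<and> x \<in> {a..b} \<longrightarrow> norm (V (r n) x - g x) < e"
  proof (rule Arzela_Ascoli[OF compact_Icc bnd equi])
    fix g and k :: "nat \<Rightarrow> nat"
    assume "strict_mono k" "\<And>e. 0 < e \<Longrightarrow> \<exists>N. \<forall>n x. n \<ge> N \<and> x \<in> {a..b} \<longrightarrow> norm (V (k n) x - g x) < e"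
    then show thesis by (rule that)
  qed auto
  obtain \<kappa> where \<kappa>: "0 \<le> \<kappa>" "\<And>s p. 0 \<le> s \<Longrightarrow> s \<le> b - a \<Longrightarrow> norm (\<Psi> s (B p)) \<le> \<kappa> * norm p"
    using kernel_bound by blast
  have "uniformly_Cauchy_on {a..b} (\<lambda>n. duhamel a (u (r n)))"
    unfolding uniformly_Cauchy_on_def
  proof (intro allI impI)
    fix e :: real assume e: "e > 0"
    define R where "R = 2 * \<bar>integral {a..b} m\<bar> + 1"
    have R: "R > 0" by (simp add: R_def)
    define \<omega> where "\<omega> = e / (2 * R)"
    have \<omega>: "\<omega> > 0" using e R by (simp add: \<omega>_def)
    from kernel_uniformly_continuous[OF this, of "b - a"] obtain h where h: "h > 0"
      "\<And>s s' p. s \<in> {0..b-a} \<Longrightarrow> s' \<in> {0..b-a} \<Longrightarrow> \<bar>s - s'\<bar> \<le> h \<Longrightarrow> norm (\<Psi> s (B p) - \<Psi> s' (B p)) \<le> \<omega> * norm p"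
      by blast
    obtain N where N: "(b - a) / h \<le> real N" using real_arch_simple by blast
    define \<eta> where "\<eta> = e / (4 * (real N * \<kappa> + 1))"
    have \<eta>: "\<eta> > 0" using e \<kappa> by (simp add: \<eta>_def add_nonneg_pos)
    have "\<eta> / 4 > 0" using \<eta> by simp
    from g[OF this] obtain n0 where n0: "\<And>n x. n \<ge> n0 \<Longrightarrow> x \<in> {a..b} \<Longrightarrow> norm (V (r n) x - g x) < \<eta> / 4"
      by blast
    have "dist (duhamel a (u (r p)) t) (duhamel a (u (r q)) t) < e" if t: "t \<in> {a..b}" and pq: "p \<ge> n0" "q \<ge> n0" for t p q
    proof -
      define v where "v \<tau> = u (r p) \<tau> - u (r q) \<tau>" for \<tau>
      have v: "v absolutely_integrable_on {a..b}" unfolding v_def by (intro set_integral_diff u)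
      have vt: "v absolutely_integrable_on {a..t}" using t by (intro absolutely_integrable_on_subinterval[OF v]) auto
      have Vpq: "norm (V (r p) x - V (r q) x) \<le> \<eta> / 2" if "x \<in> {a..b}" for x
        using n0[OF pq(1) that] n0[OF pq(2) that] norm_triangle_ineq4[of "V (r p) x - g x" "V (r q) x - g x"] by simp
      have "norm (integral {a..t} (response t v)) \<le> \<omega> * integral {a..t} (\<lambda>\<tau>. norm (v \<tau>)) + real N * \<kappa> * \<eta>"
      proof (rule norm_integral_partition_bound[where h = h])
        have "b - a \<le> real N * h" using N h(1) by (simp add: pos_divide_le_eq)
        then show "t - a \<le> real N * h" using t by simp
        show "linear (\<lambda>p. \<Psi> (t - \<tau>) (B p))" if "\<tau> \<in> {a..t}" for \<tau>
          using that by (intro bounded_linear.linear bounded_linear_kernel) auto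
        show "norm (\<Psi> (t - \<tau>) (B p)) \<le> \<kappa> * norm p" if "\<tau> \<in> {a..t}" for \<tau> p
          using that t by (intro \<kappa>(2)) auto
        show "norm (\<Psi> (t - \<tau>) (B p) - \<Psi> (t - \<tau>') (B p)) \<le> \<omega> * norm p" if "\<tau> \<in> {a..t}" "\<tau>' \<in> {a..t}" "\<bar>\<tau> - \<tau>'\<bar> \<le> h" for \<tau> \<tau>' p
          using that t by (intro h(2)) auto
        show "(response t v) integrable_on {a..t}" using t by (intro duhamel_integrable[OF v]) auto
        show "norm (integral {c'..d'} v) \<le> \<eta>" if "a \<le> c'" "c' \<le> d'" "d' \<le> t" for c' d'
        proof -
          have "integral {c'..d'} v = integral {c'..d'} (u (r p)) - integral {c'..d'} (u (r q))"
            unfolding v_def using that t by (intro Henstock_Kurzweil_Integration.integral_diff ui) auto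
          also have "\<dots> = (V (r p) d' - V (r q) d') - (V (r p) c' - V (r q) c')"
            using V_diff[of c' d', symmetric] that t by simp
          also have "norm \<dots> \<le> \<eta> / 2 + \<eta> / 2"
            using that t by (intro order.trans[OF norm_triangle_ineq4] add_mono Vpq) auto
          finally show ?thesis by simp
        qed
      qed (use t h \<eta> \<kappa> vt in auto)
      moreover have "integral {a..t} (\<lambda>\<tau>. norm (v \<tau>)) \<le> R"
      proof -
        have "norm (integral {a..t} (\<lambda>\<tau>. norm (v \<tau>))) \<le> integral {a..t} (\<lambda>\<tau>. 2 * m \<tau>)"
        proof (rule integral_norm_bound_integral_AE)
          show "(\<lambda>\<tau>. norm (v \<tau>)) integrable_on {a..t}" using vt by (simp add: absolutely_integrable_on_def)
          show "(\<lambda>\<tau>. 2 * m \<tau>) integrable_on {a..t}" using t mi[of a t] by (intro integrable_on_mult_right) auto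
          show "AE \<tau> in lebesgue. \<tau> \<in> {a..t} \<longrightarrow> norm (norm (v \<tau>)) \<le> 2 * m \<tau>"
            using le[of "r p"] le[of "r q"]
          proof eventually_elim
            case (elim \<tau>)
            then show ?case using t norm_triangle_ineq4[of "u (r p) \<tau>" "u (r q) \<tau>"] by (auto simp: v_def)
          qed
        qed
        also have "\<dots> = 2 * M t" by (simp add: M_def)
        also have "\<dots> \<le> 2 * M b"
          using M_mono[of t b] t by simp
        finally show ?thesis by (simp add: R_def M_def)
      qed
      then have "\<omega> * integral {a..t} (\<lambda>\<tau>. norm (v \<tau>)) \<le> \<omega> * R" using \<omega> by (intro mult_left_mono) auto
      moreover have "\<omega> * R = e / 2" using R by (simp add: \<omega>_def)
      moreover have "real N * \<kappa> * \<eta> < e / 2"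
      proof -
        have field: "y * (e / (4 * y)) = e / 4" if "0 < y" for y using that by simp
        have "real N * \<kappa> * \<eta> \<le> (real N * \<kappa> + 1) * \<eta>" using \<eta> by (intro mult_right_mono) auto
        also have "\<dots> = e / 4"
          using field[of "real N * \<kappa> + 1"] add_nonneg_pos[OF mult_nonneg_nonneg[OF of_nat_0_le_iff \<kappa>(1)] zero_less_one, of N]
          unfolding \<eta>_def by blast
        finally show ?thesis using e by simp
      qed
      moreover have "duhamel a (u (r p)) t - duhamel a (u (r q)) t = integral {a..t} (response t v)"
        using duhamel_diff[OF u u, of t "r p" "r q"] t by (simp add: v_def duhamel_def)
      ultimately show ?thesis by (simp add: dist_norm)
    qed
    then show "\<exists>M. \<forall>x\<in>{a..b}. \<forall>m\<ge>M. \<forall>n\<ge>M. dist (duhamel a (u (r m)) x) (duhamel a (u (r n)) x) < e"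
      by blast
  qed
  then show thesis
    using that[OF r] Cauchy_uniformly_convergent by (auto simp: uniformly_convergent_on_def)
qed

text \<open>
  The estimate \<open>norm (duhamel a f t - \<Phi> t) \<le> e\<close> survives midpoints, so the midpoint combinations
  \<open>g n\<close>, which converge almost everywhere, have the same limit \<open>\<Phi>\<close> of Duhamel integrals as the
  original sequence. Their values stay in the convex hulls of the tails.
\<close>
lemma duhamel_limit_representation:
  fixes u :: "nat \<Rightarrow> real \<Rightarrow> 'v"
  assumes u: "\<And>n. u n absolutely_integrable_on {a..b}" and m: "(m :: real \<Rightarrow> real) absolutely_integrable_on {a..b}"
    and le: "\<And>n. AE \<tau> in lebesgue. \<tau> \<in> {a..b} \<longrightarrow> norm (u n \<tau>) \<le> m \<tau>"
    and lim: "\<And>t. t \<in> {a..b} \<Longrightarrow> (\<lambda>n. duhamel a (u n) t) \<longlonglongrightarrow> \<Phi> t"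
  obtains w where "w absolutely_integrable_on {a..b}"
    "\<And>t. t \<in> {a..b} \<Longrightarrow> duhamel a w t = \<Phi> t"
    "AE \<tau> in lebesgue. \<tau> \<in> {a..b} \<longrightarrow> (\<forall>n. w \<tau> \<in> closure (convex hull ((\<lambda>k. u k \<tau>) ` {n..})))"
proof -
  define M where "M = lebesgue_on {a..b}"
  have int_iff: "integrable M f \<longleftrightarrow> f absolutely_integrable_on {a..b}" for f :: "real \<Rightarrow> 'c::euclidean_space"
    unfolding M_def by (simp add: integrable_restrict_space set_integrable_def)
  have AE_iff: "(AE x in M. P x) \<longleftrightarrow> (AE x in lebesgue. x \<in> {a..b} \<longrightarrow> P x)" for P
    unfolding M_def by (simp add: AE_restrict_space_iff)
  have fin: "finite_measure M" unfolding M_def by (rule finite_measureI) (simp add: emeasure_restrict_space emeasure_lborel_Icc_eq)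
  have um: "u n \<in> borel_measurable M" for n using u[of n] unfolding int_iff[symmetric] by auto
  have m': "integrable M m" using m by (simp add: int_iff)
  have leM: "AE x in M. norm (u n x) \<le> m x" for n using le[of n] by (simp add: AE_iff)
  obtain g w where g: "\<And>n. midpoint_hull (u ` {n..}) (g n)" and w: "w \<in> borel_measurable M"
    "AE x in M. norm (w x) \<le> m x" "AE x in M. (\<lambda>n. g n x) \<longlonglongrightarrow> w x"
    using dominated_sequence_midpoint_convergence[of M u m, OF fin um m' leM] by blast
  have wi: "w absolutely_integrable_on {a..b}"
    unfolding int_iff[symmetric] by (rule Bochner_Integration.integrable_bound[OF m' w(1)]) (use w(2) in \<open>auto elim!: eventually_mono\<close>)
  have gb: "AE x in M. norm (g n x) \<le> m x" for n
    by (rule midpoint_hull_AE_bound[OF g]) (use le AE_iff in auto)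
  have gi: "g n absolutely_integrable_on {a..b}" for n
    unfolding int_iff[symmetric]
    by (rule Bochner_Integration.integrable_bound[OF m' midpoint_hull_measurable[OF g]]) (use um gb[of n] in \<open>auto elim!: eventually_mono\<close>)
  have "duhamel a w t = \<Phi> t" if t: "t \<in> {a..b}" for t
  proof -
    have close: "norm (duhamel a f t - \<Phi> t) \<le> e \<and> f absolutely_integrable_on {a..b}"
      if "midpoint_hull (u ` {n..}) f" "\<And>k. k \<ge> n \<Longrightarrow> norm (duhamel a (u k) t - \<Phi> t) \<le> e" for n f e
      using that(1)
    proof (induction rule: midpoint_hull.induct)
      case (base f)
      then show ?case using that(2) u by auto
    next
      case (midpoint f h)
      have "duhamel a (\<lambda>x. (1/2) *\<^sub>R (f x + h x)) t - \<Phi> t = (1/2) *\<^sub>R ((duhamel a f t - \<Phi> t) + (duhamel a h t - \<Phi> t))"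
      proof -
        have "(duhamel a f t - \<Phi> t) + (duhamel a h t - \<Phi> t) = duhamel a f t + duhamel a h t - 2 *\<^sub>R \<Phi> t"
          by (simp add: scaleR_2)
        then show ?thesis
          using duhamel_midpoint[of a b f h t] midpoint.IH t by (simp only: scaleR_diff_right) simp
      qed
      then have "norm (duhamel a (\<lambda>x. (1/2) *\<^sub>R (f x + h x)) t - \<Phi> t) \<le> e"
        using norm_triangle_ineq[of "duhamel a f t - \<Phi> t" "duhamel a h t - \<Phi> t"] midpoint.IH by simp
      moreover have "(\<lambda>x. (1/2) *\<^sub>R (f x + h x)) absolutely_integrable_on {a..b}"
        using midpoint.IH by (intro absolutely_integrable_scaleR_left set_integral_add) auto
      ultimately show ?case by blast
    qed
    have "(\<lambda>n. duhamel a (g n) t) \<longlonglongrightarrow> \<Phi> t"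
    proof (rule metric_LIMSEQ_I)
      fix e :: real assume "e > 0"
      then obtain N where N: "\<And>k. k \<ge> N \<Longrightarrow> norm (duhamel a (u k) t - \<Phi> t) < e / 2"
        using LIMSEQ_D[OF lim[OF t], of "e / 2"] by auto
      have "dist (duhamel a (g n) t) (\<Phi> t) < e" if "n \<ge> N" for n
      proof -
        have "norm (duhamel a (g n) t - \<Phi> t) \<le> e / 2"
        proof (rule close[OF g, THEN conjunct1])
          fix k assume "k \<ge> n"
          then show "norm (duhamel a (u k) t - \<Phi> t) \<le> e / 2" using N[of k] that by simp
        qed
        then show ?thesis using \<open>e > 0\<close> by (simp add: dist_norm)
      qed
      then show "\<exists>N. \<forall>n\<ge>N. dist (duhamel a (g n) t) (\<Phi> t) < e" by blast
    qed
    moreover have "(\<lambda>n. duhamel a (g n) t) \<longlonglongrightarrow> duhamel a w t"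
    proof -
      obtain \<kappa> where \<kappa>: "0 \<le> \<kappa>" "\<And>s p. 0 \<le> s \<Longrightarrow> s \<le> b - a \<Longrightarrow> norm (\<Psi> s (B p)) \<le> \<kappa> * norm p"
        using kernel_bound by blast
      define d where "d n x = norm (g n x - w x)" for n x
      have dgw: "(\<lambda>x. g n x - w x) absolutely_integrable_on {a..b}" for n by (intro set_integral_diff gi wi)
      have di: "integrable M (d n)" for n
        unfolding d_def[abs_def] using dgw[of n] unfolding int_iff[symmetric] by (rule Bochner_Integration.integrable_norm)
      have "(\<lambda>n. LINT x|M. d n x) \<longlonglongrightarrow> (LINT x|M. 0)"
      proof (rule integral_dominated_convergence[where w = "\<lambda>x. 2 * m x"])
        show "AE x in M. (\<lambda>n. d n x) \<longlonglongrightarrow> 0"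
          using w(3) unfolding d_def by eventually_elim (intro tendsto_norm_zero LIM_zero)
        show "AE x in M. norm (d n x) \<le> 2 * m x" for n
          using gb[of n] w(2)
        proof eventually_elim
          case (elim x)
          then show ?case unfolding d_def using norm_triangle_ineq4[of "g n x" "w x"] by simp
        qed
      qed (use di m' in auto)
      moreover have "(LINT x|M. d n x) = integral {a..b} (d n)" for n
        unfolding M_def by (rule lebesgue_integral_eq_integral) (use di in \<open>simp_all add: M_def\<close>)
      ultimately have d0: "(\<lambda>n. integral {a..b} (d n)) \<longlonglongrightarrow> 0"
        by simp
      have d_int: "d n integrable_on {a..b}" for n
        using di[of n] int_iff[of "d n"] by (simp add: absolutely_integrable_on_def)
      have "norm (duhamel a (g n) t - duhamel a w t) \<le> \<kappa> * integral {a..b} (d n)" for n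
      proof -
        have "norm (integral {a..t} (\<lambda>\<tau>. \<Psi> (t - \<tau>) (B (g n \<tau> - w \<tau>)))) \<le> \<kappa> * integral {a..t} (d n)"
          using t by (intro duhamel_bound[OF dgw d_int _ \<kappa>]) (auto simp: d_def)
        also have "\<dots> \<le> \<kappa> * integral {a..b} (d n)"
        proof (intro mult_left_mono integral_subset_le d_int \<kappa>(1))
          show "d n integrable_on {a..t}" by (rule integrable_on_subinterval[OF d_int]) (use t in auto)
        qed (use t in \<open>auto simp: d_def\<close>)
        finally show ?thesis
          using duhamel_diff[OF gi[of n] wi, of t] t by (simp add: duhamel_def)
      qed
      then have "(\<lambda>n. duhamel a (g n) t - duhamel a w t) \<longlonglongrightarrow> 0"
        by (intro Lim_null_comparison[OF _ tendsto_mult_right_zero[OF d0]] always_eventually allI)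
      then show ?thesis by (rule LIM_zero_cancel)
    qed
    ultimately show ?thesis by (metis LIMSEQ_unique)
  qed
  moreover have "AE \<tau> in M. \<forall>n. w \<tau> \<in> closure (convex hull ((\<lambda>k. u k \<tau>) ` {n..}))"
    using w(3)
  proof eventually_elim
    case (elim x)
    show ?case
    proof
      fix n
      have "g i x \<in> convex hull ((\<lambda>k. u k x) ` {n..})" if "i \<ge> n" for i
      proof -
        have "u ` {i..} \<subseteq> u ` {n..}" using that by (intro image_mono) auto
        from midpoint_hull_in_convex_hull[OF midpoint_hull_mono[OF g this], of x] show ?thesis
          by (simp add: image_image)
      qed
      then have "eventually (\<lambda>i. g i x \<in> closure (convex hull ((\<lambda>k. u k x) ` {n..}))) sequentially"
        unfolding eventually_sequentially using closure_subset[of "convex hull ((\<lambda>k. u k x) ` {n..})"] by blast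
      then show "w x \<in> closure (convex hull ((\<lambda>k. u k x) ` {n..}))"
        by (rule Lim_in_closed_set[OF closed_closure _ sequentially_bot elim])
    qed
  qed
  ultimately show thesis
    using that[OF wi] unfolding AE_iff by blast
qed

end

section \<open>Limits of approximate trajectories\<close>

lemma (in control_semigroup) continuous_on_orbit: "continuous_on {0..L} (\<lambda>s. \<Psi> s x)"
  unfolding continuous_on_iff
proof (intro ballI allI impI)
  fix s e :: real assume s: "s \<in> {0..L}" "e > 0"
  then have "e / 2 > 0" by simp
  from C0_semigroup_orbit_uniformly_continuous[OF semigroup this, of L x]
  obtain d where d: "d > 0" "\<And>s s'. s \<in> {0..L} \<Longrightarrow> s' \<in> {0..L} \<Longrightarrow> \<bar>s - s'\<bar> \<le> d \<Longrightarrow> norm (\<Psi> s x - \<Psi> s' x) \<le> e / 2"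
    by blast
  have "dist (\<Psi> s' x) (\<Psi> s x) < e" if "s' \<in> {0..L}" "dist s' s < d" for s'
    using d(2)[of s' s] that s by (simp add: dist_norm)
  then show "\<exists>d>0. \<forall>x'\<in>{0..L}. dist x' s < d \<longrightarrow> dist (\<Psi> x' x) (\<Psi> s x) < e"
    using d(1) by blast
qed

text \<open>
  A regularized inclusion on \<open>{a..\<beta>}\<close>, reduced to what the limit arguments use. The set \<open>H \<delta> t y\<close>
  stands for the admissible inputs at time \<open>t\<close> when the output is known up to \<open>\<delta>\<close>; the true
  right-hand side is the intersection over \<open>\<delta> > 0\<close>. Monotonicity is stated through
  \<open>dist y' y + \<delta>' \<le> \<delta>\<close> instead of an inclusion of balls because this form is preserved when outputs
  are composed with a nonexpansive map. The function \<open>sel\<close> selects an admissible input that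
  is measurable along continuous outputs.
\<close>
locale inclusion_system = control_semigroup \<Psi> B
  for \<Psi> :: "real \<Rightarrow> 'b::banach \<Rightarrow> 'b" and B :: "'v::euclidean_space \<Rightarrow> 'b" +
  fixes C :: "'b \<Rightarrow> 'y::euclidean_space" and a \<beta> :: real
    and H :: "real \<Rightarrow> real \<Rightarrow> 'y \<Rightarrow> 'v set" and sel :: "real \<Rightarrow> real \<Rightarrow> 'y \<Rightarrow> 'v" and m :: "real \<Rightarrow> real"
  assumes observation: "bounded_linear C"
    and m: "m absolutely_integrable_on {a..\<beta>}"
    and closed_H: "closed (H \<delta> t y)" and convex_H: "convex (H \<delta> t y)"
    and mono_H: "0 < \<delta>' \<Longrightarrow> dist y' y + \<delta>' \<le> \<delta> \<Longrightarrow> H \<delta>' t y' \<subseteq> H \<delta> t y"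
    and bound_H: "AE t in lebesgue. t \<in> {a..\<beta>} \<longrightarrow> (\<forall>y. \<forall>\<delta>. 0 < \<delta> \<and> \<delta> \<le> 1 \<longrightarrow> H \<delta> t y \<subseteq> cball 0 (m t))"
    and sel_measurable: "0 < \<delta> \<Longrightarrow> \<delta> \<le> 1 \<Longrightarrow> continuous_on UNIV \<eta> \<Longrightarrow> (\<lambda>t. sel \<delta> t (\<eta> t)) \<in> borel_measurable lebesgue"
    and sel_in_H: "AE t in lebesgue. t \<in> {a..\<beta>} \<longrightarrow> (\<forall>y. \<forall>\<delta>. 0 < \<delta> \<and> \<delta> \<le> 1 \<longrightarrow> sel \<delta> t y \<in> H \<delta> t y)"
begin

definition F :: "real \<Rightarrow> 'y \<Rightarrow> 'v set" where
  "F t y = (\<Inter>\<delta>\<in>{0<..}. H \<delta> t y)"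

text \<open>
  Trajectories are extended to times before \<open>t1\<close> by their initial value. Trajectories with
  different initial times then live on the same interval and can be compared uniformly.
\<close>
definition traj :: "real \<Rightarrow> 'b \<Rightarrow> (real \<Rightarrow> 'v) \<Rightarrow> real \<Rightarrow> 'b" where
  "traj t1 x1 w t = \<Psi> (max 0 (t - t1)) x1 + duhamel a (\<lambda>\<tau>. if t1 < \<tau> then w \<tau> else 0) t"

definition inclusion_solution :: "real \<Rightarrow> 'b \<Rightarrow> (real \<Rightarrow> 'v) \<Rightarrow> real \<Rightarrow> bool" where
  "inclusion_solution t1 x1 w c \<longleftrightarrow> w absolutely_integrable_on {a..\<beta>} \<and>
     (AE \<tau> in lebesgue. t1 < \<tau> \<and> \<tau> < c \<longrightarrow> w \<tau> \<in> F \<tau> (C (traj t1 x1 w \<tau>)))"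

lemma truncate_absolutely_integrable:
  assumes "w absolutely_integrable_on {a..\<beta>}"
  shows "(\<lambda>\<tau>. if t1 < \<tau> then w \<tau> else 0) absolutely_integrable_on {a..\<beta>}"
proof -
  have "(\<lambda>x. indicat_real ({a..\<beta>} \<inter> {t1<..}) x *\<^sub>R w x) = (\<lambda>x. indicat_real {a..\<beta>} x *\<^sub>R (if t1 < x then w x else 0))"
    by (auto simp: indicator_def)
  moreover have "set_integrable lebesgue ({a..\<beta>} \<inter> {t1<..}) w"
    by (rule set_integrable_subset[OF assms]) auto
  ultimately show ?thesis by (simp add: set_integrable_def)
qed

lemma duhamel_zero:
  assumes "\<And>\<tau>. \<tau> \<in> {a..<t} \<Longrightarrow> w \<tau> = 0"
  shows "duhamel a w t = 0"
proof -
  have "duhamel a w t = integral {a..t} (\<lambda>\<tau>. 0)"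
    unfolding duhamel_def
  proof (rule integral_spike[of "{t}"])
    fix \<tau> assume \<tau>: "\<tau> \<in> {a..t} - {t}"
    then have "w \<tau> = 0" using assms by auto
    then show "0 = \<Psi> (t - \<tau>) (B (w \<tau>))"
      using \<tau> linear_0[OF bounded_linear.linear[OF bounded_linear_kernel[of "t - \<tau>"]]] by auto
  qed auto
  then show ?thesis by simp
qed

lemma traj_before: "t \<le> t1 \<Longrightarrow> traj t1 x1 w t = x1"
  unfolding traj_def by (subst duhamel_zero) (auto simp: max_def)

lemma continuous_on_traj:
  assumes "w absolutely_integrable_on {a..\<beta>}"
  shows "continuous_on {a..\<beta>} (traj t1 x1 w)"
  unfolding traj_def
proof (intro continuous_on_add continuous_on_duhamel truncate_absolutely_integrable assms)
  show "continuous_on {a..\<beta>} (\<lambda>t. \<Psi> (max 0 (t - t1)) x1)"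
    by (rule continuous_on_compose2[OF continuous_on_orbit[of "max 0 (\<beta> - t1)"]]) (auto intro!: continuous_intros)
qed

lemma traj_cong:
  assumes "AE \<tau> in lebesgue. t1 < \<tau> \<and> \<tau> < t \<longrightarrow> w \<tau> = w' \<tau>"
  shows "traj t1 x1 w t = traj t1 x1 w' t"
proof -
  have "AE \<tau> in lebesgue. \<tau> \<noteq> t"
    by (rule AE_completion) (rule AE_lborel_singleton)
  with assms have eq: "AE \<tau> in lebesgue. \<tau> \<in> {a..t} \<longrightarrow> (if t1 < \<tau> then w \<tau> else 0) = (if t1 < \<tau> then w' \<tau> else 0)"
    by eventually_elim auto
  show ?thesis
    unfolding traj_def duhamel_cong_AE[OF eq] by (rule refl)
qed

text \<open>
  Limits of approximate solutions are solutions. The \<open>n\<close>-th input may use the sets of radius \<open>\<delta> n\<close>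
  at the output observed with delay \<open>h n\<close>. The limiting output lies within \<open>d / 2\<close> of the observed one
  for large \<open>n\<close>, so the inputs of a tail all lie in \<open>H d\<close> at the limiting output, and this closed
  convex set then contains the limiting input.
\<close>
lemma traj_compactness:
  fixes s h \<delta> :: "nat \<Rightarrow> real" and x :: "nat \<Rightarrow> 'b"
  assumes s: "\<And>n. a \<le> s n" "s \<longlonglongrightarrow> s'" and x: "x \<longlonglongrightarrow> x'"
    and \<delta>: "\<And>n. 0 < \<delta> n" "\<And>n. \<delta> n \<le> 1" "\<delta> \<longlonglongrightarrow> 0" and h: "\<And>n. 0 \<le> h n" "h \<longlonglongrightarrow> 0"
    and w: "\<And>n. w n absolutely_integrable_on {a..\<beta>}"
    and wH: "\<And>n. AE \<tau> in lebesgue. s n < \<tau> \<and> \<tau> < \<beta> \<longrightarrow> w n \<tau> \<in> H (\<delta> n) \<tau> (C (traj (s n) (x n) (w n) (max a (\<tau> - h n))))"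
  obtains r w' where "strict_mono (r :: nat \<Rightarrow> nat)" "inclusion_solution s' x' w' \<beta>"
    "uniform_limit {a..\<beta>} (\<lambda>n. traj (s (r n)) (x (r n)) (w (r n))) (traj s' x' w') sequentially"
proof -
  define u where "u n \<tau> = (if s n < \<tau> then w n \<tau> else 0)" for n \<tau>
  have u: "u n absolutely_integrable_on {a..\<beta>}" for n
    unfolding u_def by (rule truncate_absolutely_integrable[OF w])
  have m': "(\<lambda>\<tau>. \<bar>m \<tau>\<bar>) absolutely_integrable_on {a..\<beta>}"
    using m by (rule set_integrable_abs)
  have mi: "(\<lambda>\<tau>. \<bar>m \<tau>\<bar>) integrable_on {a..\<beta>}"
    using m' by (simp add: absolutely_integrable_on_def)
  have AE_ne: "AE \<tau> in lebesgue. \<tau> \<noteq> c" for c :: real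
    by (rule AE_completion) (rule AE_lborel_singleton)
  have um: "AE \<tau> in lebesgue. \<tau> \<in> {a..\<beta>} \<longrightarrow> norm (u n \<tau>) \<le> \<bar>m \<tau>\<bar>" for n
    using wH[of n] bound_H AE_ne[of \<beta>]
  proof eventually_elim
    case (elim \<tau>)
    show ?case
    proof
      assume \<tau>: "\<tau> \<in> {a..\<beta>}"
      show "norm (u n \<tau>) \<le> \<bar>m \<tau>\<bar>"
      proof (cases "s n < \<tau>")
        case True
        have "H (\<delta> n) \<tau> (C (traj (s n) (x n) (w n) (max a (\<tau> - h n)))) \<subseteq> cball 0 (m \<tau>)"
          using elim(2) \<tau> \<delta>(1,2) by blast
        moreover have "w n \<tau> \<in> H (\<delta> n) \<tau> (C (traj (s n) (x n) (w n) (max a (\<tau> - h n))))"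
          using elim(1,3) True \<tau> by simp
        ultimately have "w n \<tau> \<in> cball 0 (m \<tau>)" by blast
        then show ?thesis using True by (simp add: u_def)
      qed (simp add: u_def)
    qed
  qed
  obtain r \<Phi> where r: "strict_mono (r :: nat \<Rightarrow> nat)" and \<Phi>: "uniform_limit {a..\<beta>} (\<lambda>n. duhamel a (u (r n))) \<Phi> sequentially"
    by (rule duhamel_uniformly_convergent_subsequence[OF u mi um])
  obtain w' where w': "w' absolutely_integrable_on {a..\<beta>}"
    and w'\<Phi>: "\<And>t. t \<in> {a..\<beta>} \<Longrightarrow> duhamel a w' t = \<Phi> t"
    and w'_hull: "AE \<tau> in lebesgue. \<tau> \<in> {a..\<beta>} \<longrightarrow> (\<forall>n. w' \<tau> \<in> closure (convex hull ((\<lambda>k. u (r k) \<tau>) ` {n..})))"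
    by (rule duhamel_limit_representation[where u = "\<lambda>n. u (r n)", OF u m' um tendsto_uniform_limitI[OF \<Phi>]]) (assumption, rule that)
  define Y where "Y n = traj (s (r n)) (x (r n)) (w (r n))" for n
  have sr: "(\<lambda>n. s (r n)) \<longlonglongrightarrow> s'" and xr: "(\<lambda>n. x (r n)) \<longlonglongrightarrow> x'"
    and \<delta>r: "(\<lambda>n. \<delta> (r n)) \<longlonglongrightarrow> 0" and hr: "(\<lambda>n. h (r n)) \<longlonglongrightarrow> 0"
    using LIMSEQ_subseq_LIMSEQ[OF s(2) r] LIMSEQ_subseq_LIMSEQ[OF x r] LIMSEQ_subseq_LIMSEQ[OF \<delta>(3) r] LIMSEQ_subseq_LIMSEQ[OF h(2) r]
    by (simp_all add: o_def)
  have w'_zero: "AE \<tau> in lebesgue. \<tau> \<in> {a..\<beta>} \<longrightarrow> \<tau> < s' \<longrightarrow> w' \<tau> = 0"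
    using w'_hull
  proof eventually_elim
    case (elim \<tau>)
    show ?case
    proof (intro impI)
      assume \<tau>: "\<tau> \<in> {a..\<beta>}" "\<tau> < s'"
      obtain n where n: "\<And>k. k \<ge> n \<Longrightarrow> \<tau> < s (r k)"
        using order_tendstoD(1)[OF sr \<tau>(2)] unfolding eventually_sequentially by blast
      have "(\<lambda>k. u (r k) \<tau>) ` {n..} = {0}"
      proof -
        have "u (r k) \<tau> = 0" if "k \<in> {n..}" for k using n[of k] that by (simp add: u_def)
        then show ?thesis by auto
      qed
      moreover have "w' \<tau> \<in> closure (convex hull ((\<lambda>k. u (r k) \<tau>) ` {n..}))"
        using elim \<tau>(1) by blast
      ultimately show "w' \<tau> = 0" by simp
    qed
  qed
  define X where "X t = \<Psi> (max 0 (t - s')) x' + \<Phi> t" for t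
  have trajX: "traj s' x' w' t = X t" if "t \<in> {a..\<beta>}" for t
  proof -
    have "duhamel a (\<lambda>\<tau>. if s' < \<tau> then w' \<tau> else 0) t = duhamel a w' t"
    proof (rule duhamel_cong_AE)
      show "AE \<tau> in lebesgue. \<tau> \<in> {a..t} \<longrightarrow> (if s' < \<tau> then w' \<tau> else 0) = w' \<tau>"
        using w'_zero AE_ne[of s']
      proof eventually_elim
        case (elim \<tau>)
        then show ?case using that by (cases "s' < \<tau>") auto
      qed
    qed
    then show ?thesis using w'\<Phi>[OF that] by (simp add: traj_def X_def)
  qed
  have contX: "continuous_on {a..\<beta>} X"
    by (rule continuous_on_eq[OF continuous_on_traj[OF w'] trajX])
  have as': "a \<le> s'" using s by (intro LIMSEQ_le_const[OF s(2)]) auto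
  have uX: "uniform_limit {a..\<beta>} Y X sequentially"
  proof -
    obtain M where M: "M \<ge> 1" "\<And>s x. 0 \<le> s \<Longrightarrow> s \<le> \<beta> - a \<Longrightarrow> norm (\<Psi> s x) \<le> M * norm x"
      using C0_semigroup_locally_bounded[OF semigroup] by blast
    have "uniform_limit {a..\<beta>} (\<lambda>n t. \<Psi> (max 0 (t - s (r n))) (x (r n))) (\<lambda>t. \<Psi> (max 0 (t - s')) x') sequentially"
    proof (rule uniform_limitI)
      fix e :: real assume e: "e > 0"
      then have "e / 3 > 0" by simp
      from C0_semigroup_orbit_uniformly_continuous[OF semigroup this, of "\<beta> - a" x']
      obtain d where d: "d > 0" "\<And>s s'. s \<in> {0..\<beta> - a} \<Longrightarrow> s' \<in> {0..\<beta> - a} \<Longrightarrow> \<bar>s - s'\<bar> \<le> d \<Longrightarrow> norm (\<Psi> s x' - \<Psi> s' x') \<le> e / 3"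
        by blast
      have "e / (3 * M) > 0" using e M by simp
      then have "eventually (\<lambda>n. dist (x (r n)) x' < e / (3 * M)) sequentially" using tendstoD[OF xr] by blast
      moreover have "eventually (\<lambda>n. dist (s (r n)) s' < d) sequentially" using tendstoD[OF sr d(1)] .
      ultimately show "eventually (\<lambda>n. \<forall>t\<in>{a..\<beta>}. dist (\<Psi> (max 0 (t - s (r n))) (x (r n))) (\<Psi> (max 0 (t - s')) x') < e) sequentially"
      proof eventually_elim
        case (elim n)
        show ?case
        proof
          fix t assume t: "t \<in> {a..\<beta>}"
          define p q where "p = max 0 (t - s (r n))" and "q = max 0 (t - s')"
          have pq: "p \<in> {0..\<beta> - a}" "q \<in> {0..\<beta> - a}" "\<bar>p - q\<bar> \<le> d"
            using t s(1)[of "r n"] as' elim(2) by (auto simp: p_def q_def dist_real_def)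
          interpret bounded_linear "\<Psi> p" using pq by (intro bounded_linear_semigroup) auto
          have "norm (\<Psi> p (x (r n)) - \<Psi> p x') \<le> M * norm (x (r n) - x')"
            using M(2)[of p "x (r n) - x'"] pq by (simp add: diff)
          also have "\<dots> \<le> M * (e / (3 * M))" using elim(1) M by (intro mult_left_mono) (auto simp: dist_norm)
          also have "\<dots> = e / 3" using M by simp
          finally have 1: "norm (\<Psi> p (x (r n)) - \<Psi> p x') \<le> e / 3" .
          have 2: "norm (\<Psi> p x' - \<Psi> q x') \<le> e / 3" by (rule d(2)[OF pq])
          show "dist (\<Psi> (max 0 (t - s (r n))) (x (r n))) (\<Psi> (max 0 (t - s')) x') < e"
            unfolding dist_norm p_def[symmetric] q_def[symmetric]
            using norm_triangle_le[OF add_mono[OF 1 2]] e by simp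
        qed
      qed
    qed
    from uniform_limit_add[OF this \<Phi>] show ?thesis
      by (simp add: Y_def[abs_def] traj_def[abs_def] X_def[abs_def] u_def[abs_def])
  qed
  have lim_delay: "(\<lambda>n. C (Y n (max a (\<tau> - h (r n))))) \<longlonglongrightarrow> C (X \<tau>)" if \<tau>: "\<tau> \<in> {a..\<beta>}" for \<tau>
  proof (rule bounded_linear.tendsto[OF observation])
    define \<sigma> where "\<sigma> n = max a (\<tau> - h (r n))" for n
    have \<sigma>: "\<sigma> n \<in> {a..\<beta>}" for n using \<tau> h(1)[of "r n"] by (auto simp: \<sigma>_def)
    have "\<sigma> \<longlonglongrightarrow> max a (\<tau> - 0)" unfolding \<sigma>_def by (intro tendsto_intros hr)
    then have "\<sigma> \<longlonglongrightarrow> \<tau>" using \<tau> by simp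
    then have X\<sigma>: "(\<lambda>n. X (\<sigma> n)) \<longlonglongrightarrow> X \<tau>"
      by (rule continuous_on_tendsto_compose[OF contX _ \<tau>]) (simp only: \<sigma> eventually_sequentially, simp)
    have "(\<lambda>n. Y n (\<sigma> n) - X (\<sigma> n)) \<longlonglongrightarrow> 0"
    proof (rule LIMSEQ_I)
      fix e :: real assume "e > 0"
      then obtain N where "\<And>n t. n \<ge> N \<Longrightarrow> t \<in> {a..\<beta>} \<Longrightarrow> dist (Y n t) (X t) < e"
        using uniform_limitD[OF uX \<open>e > 0\<close>] unfolding eventually_sequentially by blast
      then show "\<exists>N. \<forall>n\<ge>N. norm (Y n (\<sigma> n) - X (\<sigma> n) - 0) < e"
        using \<sigma> by (intro exI[of _ N]) (simp add: dist_norm)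
    qed
    from tendsto_add[OF this X\<sigma>] show "(\<lambda>n. Y n (max a (\<tau> - h (r n)))) \<longlonglongrightarrow> X \<tau>"
      by (simp add: \<sigma>_def)
  qed
  have all_wH: "AE \<tau> in lebesgue. \<forall>n. s (r n) < \<tau> \<and> \<tau> < \<beta> \<longrightarrow> w (r n) \<tau> \<in> H (\<delta> (r n)) \<tau> (C (Y n (max a (\<tau> - h (r n)))))"
    unfolding AE_all_countable Y_def using wH by blast
  have "AE \<tau> in lebesgue. s' < \<tau> \<and> \<tau> < \<beta> \<longrightarrow> w' \<tau> \<in> F \<tau> (C (traj s' x' w' \<tau>))"
    using all_wH w'_hull
  proof eventually_elim
    case (elim \<tau>)
    note all = elim(1) and hull = elim(2)
    show ?case
    proof
      assume \<tau>: "s' < \<tau> \<and> \<tau> < \<beta>"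
      then have \<tau>': "\<tau> \<in> {a..\<beta>}" using as' by auto
      have "w' \<tau> \<in> H d \<tau> (C (X \<tau>))" if d: "d > 0" for d
      proof -
        have "eventually (\<lambda>n. dist (C (Y n (max a (\<tau> - h (r n))))) (C (X \<tau>)) < d / 2) sequentially"
          using tendstoD[OF lim_delay[OF \<tau>'], of "d / 2"] d by simp
        moreover have "eventually (\<lambda>n. \<delta> (r n) < d / 2) sequentially"
          using order_tendstoD(2)[OF \<delta>r, of "d / 2"] d by simp
        moreover have "eventually (\<lambda>n. s (r n) < \<tau>) sequentially"
          using order_tendstoD(2)[OF sr] \<tau> by blast
        ultimately have "eventually (\<lambda>n. u (r n) \<tau> \<in> H d \<tau> (C (X \<tau>))) sequentially"
        proof eventually_elim
          case (elim n)
          have "w (r n) \<tau> \<in> H (\<delta> (r n)) \<tau> (C (Y n (max a (\<tau> - h (r n)))))"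
            using all elim(3) \<tau> by blast
          also have "\<dots> \<subseteq> H d \<tau> (C (X \<tau>))"
            using elim(1,2) \<delta>(1) by (intro mono_H) auto
          finally show ?case using elim(3) by (simp add: u_def)
        qed
        then obtain n where n: "\<And>k. k \<ge> n \<Longrightarrow> u (r k) \<tau> \<in> H d \<tau> (C (X \<tau>))"
          unfolding eventually_sequentially by blast
        then have "(\<lambda>k. u (r k) \<tau>) ` {n..} \<subseteq> H d \<tau> (C (X \<tau>))" by blast
        then have "closure (convex hull ((\<lambda>k. u (r k) \<tau>) ` {n..})) \<subseteq> H d \<tau> (C (X \<tau>))"
          by (intro closure_minimal hull_minimal closed_H convex_H)
        then show ?thesis using hull \<tau>' by blast
      qed
      then show "w' \<tau> \<in> F \<tau> (C (traj s' x' w' \<tau>))"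
        by (simp add: F_def trajX[OF \<tau>'])
    qed
  qed
  then have "inclusion_solution s' x' w' \<beta>"
    using w' by (simp add: inclusion_solution_def)
  moreover have "uniform_limit {a..\<beta>} (\<lambda>n. traj (s (r n)) (x (r n)) (w (r n))) (traj s' x' w') sequentially"
    using uX unfolding Y_def by (rule uniform_limit_cong'[THEN iffD1, rotated 2]) (simp_all add: trajX)
  ultimately show thesis using that[OF r] by blast
qed

end

section \<open>Existence, concatenation and stability of trajectories\<close>

context inclusion_system begin

text \<open>
  With a delay \<open>h\<close> the input on an interval of length \<open>h\<close> is known from the past. Instead of gluing
  steps, the integral operator is iterated from the constant function: the \<open>j\<close>-th iterate is
  already final up to time \<open>t1 + j h\<close>.
\<close>
lemma delayed_solution_exists:
  assumes t1: "a \<le> t1" and h: "0 < h" and \<delta>: "0 < \<delta>" "\<delta> \<le> 1"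
  shows "\<exists>w. w absolutely_integrable_on {a..\<beta>} \<and>
    (AE \<tau> in lebesgue. t1 < \<tau> \<and> \<tau> < \<beta> \<longrightarrow> w \<tau> \<in> H \<delta> \<tau> (C (traj t1 x1 w (max a (\<tau> - h)))))"
proof (cases "a \<le> \<beta>")
  case False
  then have "(\<lambda>_. 0 :: 'v) absolutely_integrable_on {a..\<beta>}" "\<not> (t1 < \<tau> \<and> \<tau> < \<beta>)" for \<tau>
    using t1 by (auto simp: set_integrable_def)
  then show ?thesis by blast
next
  case ab: True
  (* Clipping only serves to make the delayed output continuous on the whole line. *)
  define cl where "cl \<tau> = max a (min \<beta> (\<tau> - h))" for \<tau>
  define W where "W Y \<tau> = sel \<delta> \<tau> (C (Y (cl \<tau>)))" for Y :: "real \<Rightarrow> 'b" and \<tau>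
  have cl: "cl \<tau> \<in> {a..\<beta>}" for \<tau> using ab by (auto simp: cl_def)
  have W: "W Y absolutely_integrable_on {a..\<beta>}" if "continuous_on {a..\<beta>} Y" for Y
  proof (rule absolutely_integrable_bound_AE[OF _ _ m])
    have "continuous_on UNIV (\<lambda>\<tau>. C (Y (cl \<tau>)))"
      by (intro bounded_linear.continuous_on[OF observation] continuous_on_compose2[OF that])
        (auto simp: cl_def intro!: continuous_intros ab)
    then show "W Y \<in> borel_measurable lebesgue"
      unfolding W_def by (rule sel_measurable[OF \<delta>])
    show "AE \<tau> in lebesgue. \<tau> \<in> {a..\<beta>} \<longrightarrow> norm (W Y \<tau>) \<le> m \<tau>"
      using bound_H sel_in_H
    proof eventually_elim
      case (elim \<tau>)
      show ?case
      proof
        assume "\<tau> \<in> {a..\<beta>}"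
        then have "W Y \<tau> \<in> H \<delta> \<tau> (C (Y (cl \<tau>)))" "H \<delta> \<tau> (C (Y (cl \<tau>))) \<subseteq> cball 0 (m \<tau>)"
          using elim \<delta> unfolding W_def by blast+
        then have "W Y \<tau> \<in> cball 0 (m \<tau>)" by blast
        then show "norm (W Y \<tau>) \<le> m \<tau>" by simp
      qed
    qed
  qed simp
  define Y where "Y j = ((\<lambda>Y. traj t1 x1 (W Y)) ^^ j) (\<lambda>_. x1)" for j
  have Y_Suc: "Y (Suc j) = traj t1 x1 (W (Y j))" for j by (simp add: Y_def)
  have Y_cont: "continuous_on {a..\<beta>} (Y j)" for j
  proof (induction j)
    case (Suc j)
    show ?case unfolding Y_Suc by (rule continuous_on_traj[OF W[OF Suc]])
  qed (simp add: Y_def)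
  have agree: "Y (Suc j) t = Y j t" if "t \<in> {a..\<beta>}" "t \<le> t1 + real j * h" for j t
    using that
  proof (induction j arbitrary: t)
    case 0
    then show ?case unfolding Y_Suc by (simp add: traj_before) (simp add: Y_def)
  next
    case (Suc j)
    have "W (Y (Suc j)) \<tau> = W (Y j) \<tau>" if "\<tau> < t" for \<tau>
    proof -
      have "cl \<tau> \<le> t1 + real j * h"
      proof -
        have "0 \<le> real j * h" using h by simp
        then have "max a (\<tau> - h) \<le> t1 + real j * h"
          using Suc.prems that t1 by (simp add: algebra_simps)
        then show ?thesis unfolding cl_def by linarith
      qed
      then show ?thesis unfolding W_def using Suc.IH[OF cl] by simp
    qed
    then show ?case
      unfolding Y_Suc[of "Suc j"] Y_Suc[of j] by (intro traj_cong) (simp add: Y_Suc)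
  qed
  obtain N where N: "(\<beta> - t1) / h \<le> real N" using real_arch_simple by blast
  define w where "w = W (Y N)"
  have fix_point: "traj t1 x1 w t = Y N t" if "t \<in> {a..\<beta>}" for t
  proof -
    have "\<beta> - t1 \<le> real N * h" using N h by (simp add: pos_divide_le_eq)
    then show ?thesis using agree[OF that, of N] that by (simp add: Y_Suc w_def)
  qed
  have "AE \<tau> in lebesgue. t1 < \<tau> \<and> \<tau> < \<beta> \<longrightarrow> w \<tau> \<in> H \<delta> \<tau> (C (traj t1 x1 w (max a (\<tau> - h))))"
    using sel_in_H
  proof eventually_elim
    case (elim \<tau>)
    show ?case
    proof
      assume \<tau>: "t1 < \<tau> \<and> \<tau> < \<beta>"
      then have "cl \<tau> = max a (\<tau> - h)" using h by (simp add: cl_def)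
      then have "w \<tau> = sel \<delta> \<tau> (C (traj t1 x1 w (max a (\<tau> - h))))"
        using fix_point[OF cl[of \<tau>]] by (simp add: w_def W_def)
      moreover have "\<tau> \<in> {a..\<beta>}" using \<tau> t1 by simp
      ultimately show "w \<tau> \<in> H \<delta> \<tau> (C (traj t1 x1 w (max a (\<tau> - h))))"
        using elim \<delta> by simp
    qed
  qed
  then show ?thesis using W[OF Y_cont] by (auto simp: w_def)
qed

lemma inclusion_solution_exists:
  assumes t1: "a \<le> t1"
  obtains w where "inclusion_solution t1 x1 w \<beta>"
proof -
  have "\<forall>n. \<exists>w. w absolutely_integrable_on {a..\<beta>} \<and>
    (AE \<tau> in lebesgue. t1 < \<tau> \<and> \<tau> < \<beta> \<longrightarrow> w \<tau> \<in> H (inverse (real (Suc n))) \<tau> (C (traj t1 x1 w (max a (\<tau> - inverse (real (Suc n)))))))"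
    by (intro allI delayed_solution_exists[OF t1]) (simp_all add: inverse_eq_divide)
  from choice[OF this] obtain w where w: "\<And>n. w n absolutely_integrable_on {a..\<beta>}"
    "\<And>n. AE \<tau> in lebesgue. t1 < \<tau> \<and> \<tau> < \<beta> \<longrightarrow> w n \<tau> \<in> H (inverse (real (Suc n))) \<tau> (C (traj t1 x1 (w n) (max a (\<tau> - inverse (real (Suc n))))))"
    by blast
  show thesis
  proof (rule traj_compactness[where s = "\<lambda>_. t1" and x = "\<lambda>_. x1" and \<delta> = "\<lambda>n. inverse (real (Suc n))"
        and h = "\<lambda>n. inverse (real (Suc n))" and w = w])
    show "inverse (real (Suc n)) \<le> 1" for n by (simp add: inverse_eq_divide)
    show "AE \<tau> in lebesgue. t1 < \<tau> \<and> \<tau> < \<beta> \<longrightarrow> w n \<tau> \<in> H (inverse (real (Suc n))) \<tau> (C (traj t1 x1 (w n) (max a (\<tau> - inverse (real (Suc n))))))" for n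
      by (rule w(2))
    show thesis if "inclusion_solution t1 x1 w' \<beta>" for w' using that by (rule \<open>\<And>w. _ \<Longrightarrow> thesis\<close>)
  qed (use t1 w(1) in \<open>simp_all add: LIMSEQ_inverse_real_of_nat del: of_nat_Suc\<close>)
qed

lemma traj_glue:
  assumes w: "w absolutely_integrable_on {a..\<beta>}" and v: "v absolutely_integrable_on {a..\<beta>}"
    and c: "a \<le> t1" "t1 \<le> c" "c \<le> \<beta>"
  defines "z \<equiv> \<lambda>\<tau>. if \<tau> < c then w \<tau> else v \<tau>"
  shows "z absolutely_integrable_on {a..\<beta>}"
    and "\<And>t. t \<le> c \<Longrightarrow> traj t1 x1 z t = traj t1 x1 w t"
    and "\<And>t. c \<le> t \<Longrightarrow> t \<le> \<beta> \<Longrightarrow> traj t1 x1 z t = traj c (traj t1 x1 w c) v t"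
proof -
  have "(\<lambda>\<tau>. w \<tau> - (if c < \<tau> then w \<tau> else 0) + (if c < \<tau> then v \<tau> else 0)) absolutely_integrable_on {a..\<beta>}"
    by (intro set_integral_add set_integral_diff truncate_absolutely_integrable w v)
  then show z: "z absolutely_integrable_on {a..\<beta>}"
    by (rule absolutely_integrable_spike[where S = "{c}"]) (auto simp: z_def)
  show before: "traj t1 x1 z t = traj t1 x1 w t" if "t \<le> c" for t
    using that by (intro traj_cong always_eventually) (simp add: z_def)
  show "traj t1 x1 z t = traj c (traj t1 x1 w c) v t" if "c \<le> t" "t \<le> \<beta>" for t
  proof -
    have ct: "a \<le> c" using c by simp
    define z1 where "z1 \<tau> = (if t1 < \<tau> then z \<tau> else 0)" for \<tau>
    define v1 where "v1 \<tau> = (if c < \<tau> then v \<tau> else 0)" for \<tau>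
    have z1: "z1 absolutely_integrable_on {a..\<beta>}" and v1: "v1 absolutely_integrable_on {a..\<beta>}"
      unfolding z1_def v1_def by (intro truncate_absolutely_integrable z v)+
    have eq: "integral {c..t} (response t z1) = integral {c..t} (response t v1)"
      by (rule integral_spike[of "{c}"]) (use c in \<open>auto simp: z1_def v1_def z_def\<close>)
    have v10: "duhamel a v1 c = 0" by (rule duhamel_zero) (simp add: v1_def)
    interpret bounded_linear "\<Psi> (t - c)" using that by (intro bounded_linear_semigroup) simp
    have "traj t1 x1 z t = \<Psi> (t - t1) x1 + (\<Psi> (t - c) (duhamel a z1 c) + integral {c..t} (response t z1))"
      using duhamel_restart[OF z1 ct that] c that by (simp add: traj_def z1_def[abs_def])
    also have "\<Psi> (t - t1) x1 = \<Psi> (t - c) (\<Psi> (c - t1) x1)"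
      using c that by (simp flip: semigroup_add)
    also have "integral {c..t} (response t z1) = duhamel a v1 t"
      using duhamel_restart[OF v1 ct that] by (simp add: v10 zero eq)
    also have "\<Psi> (t - c) (\<Psi> (c - t1) x1) + (\<Psi> (t - c) (duhamel a z1 c) + duhamel a v1 t)
      = \<Psi> (t - c) (traj t1 x1 z c) + duhamel a v1 t"
      using c by (simp add: traj_def z1_def[abs_def] add)
    also have "\<dots> = traj c (traj t1 x1 w c) v t"
      using that by (simp add: traj_def[of c] v1_def[abs_def] before)
    finally show ?thesis .
  qed
qed

lemma inclusion_solution_glue:
  assumes w: "inclusion_solution t1 x1 w c" and v: "inclusion_solution c (traj t1 x1 w c) v d"
    and c: "a \<le> t1" "t1 \<le> c" "c \<le> \<beta>" and d: "d \<le> \<beta>"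
  defines "z \<equiv> \<lambda>\<tau>. if \<tau> < c then w \<tau> else v \<tau>"
  shows "inclusion_solution t1 x1 z d"
proof -
  have wi: "w absolutely_integrable_on {a..\<beta>}" and vi: "v absolutely_integrable_on {a..\<beta>}"
    and wF: "AE \<tau> in lebesgue. t1 < \<tau> \<and> \<tau> < c \<longrightarrow> w \<tau> \<in> F \<tau> (C (traj t1 x1 w \<tau>))"
    and vF: "AE \<tau> in lebesgue. c < \<tau> \<and> \<tau> < d \<longrightarrow> v \<tau> \<in> F \<tau> (C (traj c (traj t1 x1 w c) v \<tau>))"
    using w v by (auto simp: inclusion_solution_def)
  note g = traj_glue[OF wi vi c, folded z_def]
  have "AE \<tau> in lebesgue. \<tau> \<noteq> c" by (rule AE_completion) (rule AE_lborel_singleton)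
  with wF vF have "AE \<tau> in lebesgue. t1 < \<tau> \<and> \<tau> < d \<longrightarrow> z \<tau> \<in> F \<tau> (C (traj t1 x1 z \<tau>))"
  proof eventually_elim
    case (elim \<tau>)
    show ?case
    proof
      assume \<tau>: "t1 < \<tau> \<and> \<tau> < d"
      show "z \<tau> \<in> F \<tau> (C (traj t1 x1 z \<tau>))"
      proof (cases "\<tau> < c")
        case True
        then show ?thesis using elim(1) \<tau> g(2)[of \<tau>] by (simp add: z_def)
      next
        case False
        then show ?thesis using elim(2,3) \<tau> d g(3)[of \<tau>] by (simp add: z_def)
      qed
    qed
  qed
  then show ?thesis using g(1) by (simp add: inclusion_solution_def)
qed

text \<open>
  Since solutions exist from every initial state up to \<open>\<beta>\<close>, no solution stops earlier.
\<close>
lemma inclusion_solution_extend: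
  assumes w: "inclusion_solution t1 x1 w c" and c: "a \<le> t1" "t1 \<le> c" "c \<le> \<beta>"
  obtains z where "inclusion_solution t1 x1 z \<beta>" "\<And>t. t \<le> c \<Longrightarrow> traj t1 x1 z t = traj t1 x1 w t"
proof -
  have "a \<le> c" using c by simp
  then obtain v where v: "inclusion_solution c (traj t1 x1 w c) v \<beta>"
    using inclusion_solution_exists by blast
  then have "w absolutely_integrable_on {a..\<beta>}" "v absolutely_integrable_on {a..\<beta>}"
    using w by (auto simp: inclusion_solution_def)
  from traj_glue(2)[OF this c] show thesis
    using that[OF inclusion_solution_glue[OF w v c order_refl]] by simp
qed

text \<open>
  Solutions violating the estimate for initial data converging to \<open>(t0, x0)\<close> can be extended to
  \<open>\<beta>\<close>, and by compactness a subsequence converges uniformly to a solution from \<open>(t0, x0)\<close>. The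
  latter is \<open>X\<close>, a contradiction. The argument \<open>max t t0\<close> covers solutions that start before \<open>t0\<close>.
\<close>
lemma inclusion_solution_stability:
  fixes X :: "real \<Rightarrow> 'b"
  assumes t0: "a < t0" "t0 \<le> b" "b \<le> \<beta>"
    and unique: "\<And>w t. inclusion_solution t0 x0 w \<beta> \<Longrightarrow> t0 \<le> t \<Longrightarrow> t \<le> b \<Longrightarrow> traj t0 x0 w t = X t"
    and \<epsilon>: "\<epsilon> > 0"
  shows "\<exists>\<delta>>0. \<forall>t1 x1 w c. a \<le> t1 \<and> t1 \<le> c \<and> c \<le> \<beta> \<and> \<bar>t1 - t0\<bar> + norm (x1 - x0) < \<delta> \<and> inclusion_solution t1 x1 w c \<longrightarrow>
    (\<forall>t. t1 \<le> t \<and> t \<le> c \<and> t \<le> b \<longrightarrow> norm (traj t1 x1 w t - X (max t t0)) < \<epsilon>)"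
proof -
  define stable where "stable \<delta> \<longleftrightarrow> (\<forall>t1 x1 w c. a \<le> t1 \<and> t1 \<le> c \<and> c \<le> \<beta> \<and> \<bar>t1 - t0\<bar> + norm (x1 - x0) < \<delta> \<and> inclusion_solution t1 x1 w c \<longrightarrow>
    (\<forall>t. t1 \<le> t \<and> t \<le> c \<and> t \<le> b \<longrightarrow> norm (traj t1 x1 w t - X (max t t0)) < \<epsilon>))" for \<delta>
  have "\<exists>\<delta>>0. stable \<delta>"
  proof (rule ccontr)
    assume contr: "\<not> (\<exists>\<delta>>0. stable \<delta>)"
    define bad where "bad n p \<longleftrightarrow> (case p of (t1, x1, w, t) \<Rightarrow>
        a \<le> t1 \<and> \<bar>t1 - t0\<bar> + norm (x1 - x0) < inverse (real (Suc n)) \<and> inclusion_solution t1 x1 w \<beta> \<and>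
        t1 \<le> t \<and> t \<le> b \<and> \<not> norm (traj t1 x1 w t - X (max t t0)) < \<epsilon>)" for n p
    have "\<forall>n. \<exists>p. bad n p"
    proof
      fix n
      have "inverse (real (Suc n)) > 0" by simp
      with contr have "\<not> stable (inverse (real (Suc n)))" by blast
      then obtain t1 x1 w c t where *: "a \<le> t1" "t1 \<le> c" "c \<le> \<beta>" "\<bar>t1 - t0\<bar> + norm (x1 - x0) < inverse (real (Suc n))"
        "inclusion_solution t1 x1 w c" "t1 \<le> t" "t \<le> c" "t \<le> b" "\<not> norm (traj t1 x1 w t - X (max t t0)) < \<epsilon>"
        unfolding stable_def not_all not_imp by blast
      obtain z where z: "inclusion_solution t1 x1 z \<beta>" "\<And>t. t \<le> c \<Longrightarrow> traj t1 x1 z t = traj t1 x1 w t"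
        by (rule inclusion_solution_extend[OF *(5,1,2,3)]) (rule that)
      have zt: "traj t1 x1 z t = traj t1 x1 w t" using *(7) by (rule z(2))
      show "\<exists>p. bad n p"
        by (intro exI[of _ "(t1, x1, z, t)"]) (unfold bad_def prod.case zt, intro conjI *(1,4,6,8,9) z(1))
    qed
    from choice[OF this] obtain p where p: "\<And>n. bad n (p n)"
      by blast
    define s where "s n = fst (p n)" for n
    define x where "x n = fst (snd (p n))" for n
    define w where "w n = fst (snd (snd (p n)))" for n
    define t where "t n = snd (snd (snd (p n)))" for n
    have s: "a \<le> s n" and close: "\<bar>s n - t0\<bar> + norm (x n - x0) < inverse (real (Suc n))"
      and w: "inclusion_solution (s n) (x n) (w n) \<beta>" and t: "s n \<le> t n" "t n \<le> b"
      and far: "\<not> norm (traj (s n) (x n) (w n) (t n) - X (max (t n) t0)) < \<epsilon>" for n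
      using p[of n] by (auto simp: bad_def s_def x_def w_def t_def case_prod_unfold)
    have "(\<lambda>n. s n - t0) \<longlonglongrightarrow> 0"
      by (rule Lim_null_comparison[OF _ LIMSEQ_inverse_real_of_nat])
        (intro always_eventually allI order.trans[OF _ less_imp_le[OF close]], simp)
    then have sl: "s \<longlonglongrightarrow> t0" by (rule LIM_zero_cancel)
    have "(\<lambda>n. x n - x0) \<longlonglongrightarrow> 0"
      by (rule Lim_null_comparison[OF _ LIMSEQ_inverse_real_of_nat])
        (intro always_eventually allI order.trans[OF _ less_imp_le[OF close]], simp)
    then have xl: "x \<longlonglongrightarrow> x0" by (rule LIM_zero_cancel)
    have wi: "w n absolutely_integrable_on {a..\<beta>}" for n
      using w by (simp add: inclusion_solution_def)
    have wH: "AE \<tau> in lebesgue. s n < \<tau> \<and> \<tau> < \<beta> \<longrightarrow> w n \<tau> \<in> H (inverse (real (Suc n))) \<tau> (C (traj (s n) (x n) (w n) (max a (\<tau> - 0))))" for n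
    proof -
      have "AE \<tau> in lebesgue. s n < \<tau> \<and> \<tau> < \<beta> \<longrightarrow> w n \<tau> \<in> F \<tau> (C (traj (s n) (x n) (w n) \<tau>))"
        using w[of n] by (simp add: inclusion_solution_def)
      then show ?thesis
      proof eventually_elim
        case (elim \<tau>)
        show ?case
        proof
          assume \<tau>: "s n < \<tau> \<and> \<tau> < \<beta>"
          then have "max a (\<tau> - 0) = \<tau>" using s[of n] by simp
          moreover have "inverse (real (Suc n)) \<in> {0<..}" by simp
          ultimately show "w n \<tau> \<in> H (inverse (real (Suc n))) \<tau> (C (traj (s n) (x n) (w n) (max a (\<tau> - 0))))"
            using elim \<tau> unfolding F_def by simp
        qed
      qed
    qed
    obtain r w' where r: "strict_mono (r :: nat \<Rightarrow> nat)" and w': "inclusion_solution t0 x0 w' \<beta>"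
      and unif: "uniform_limit {a..\<beta>} (\<lambda>n. traj (s (r n)) (x (r n)) (w (r n))) (traj t0 x0 w') sequentially"
    proof (rule traj_compactness[where s = s and x = x and s' = t0 and x' = x0 and w = w and \<delta> = "\<lambda>n. inverse (real (Suc n))" and h = "\<lambda>_. 0"])
      show "inverse (real (Suc n)) \<le> 1" for n by (simp add: inverse_eq_divide)
      show "AE \<tau> in lebesgue. s n < \<tau> \<and> \<tau> < \<beta> \<longrightarrow> w n \<tau> \<in> H (inverse (real (Suc n))) \<tau> (C (traj (s n) (x n) (w n) (max a (\<tau> - 0))))" for n
        by (rule wH)
    next
      fix r :: "nat \<Rightarrow> nat" and w'
      assume "strict_mono r" "inclusion_solution t0 x0 w' \<beta>"
        "uniform_limit {a..\<beta>} (\<lambda>n. traj (s (r n)) (x (r n)) (w (r n))) (traj t0 x0 w') sequentially"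
      then show thesis by (rule that)
    qed (use s sl xl wi in \<open>simp_all add: LIMSEQ_inverse_real_of_nat del: of_nat_Suc\<close>)
    have X: "traj t0 x0 w' \<tau> = X (max \<tau> t0)" if "\<tau> \<le> b" for \<tau>
    proof (cases "t0 \<le> \<tau>")
      case True
      then show ?thesis using unique[OF w' True that] by (simp add: max_def)
    next
      case False
      then show ?thesis using unique[OF w' order_refl t0(2)] traj_before[of \<tau> t0 x0 w'] traj_before[of t0 t0 x0 w']
        by (simp add: max_def)
    qed
    obtain n where n: "\<forall>\<tau>\<in>{a..\<beta>}. dist (traj (s (r n)) (x (r n)) (w (r n)) \<tau>) (traj t0 x0 w' \<tau>) < \<epsilon>"
      using eventually_happens'[OF sequentially_bot uniform_limitD[OF unif \<epsilon>]] by blast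
    have tn: "t (r n) \<in> {a..\<beta>}" using s[of "r n"] t[of "r n"] t0 by auto
    from n[rule_format, OF tn] have "norm (traj (s (r n)) (x (r n)) (w (r n)) (t (r n)) - X (max (t (r n)) t0)) < \<epsilon>"
      unfolding X[OF t(2)[of "r n"]] dist_norm .
    then show False using far[of "r n"] by simp
  qed
  then show ?thesis by (simp only: stable_def)
qed

end

section \<open>Essential convex hulls and ball averages\<close>

text \<open>
  The set that the Filippov regularization intersects over \<open>\<delta>\<close>. If \<open>u t\<close> is essentially bounded on
  the ball, its mean value over the ball belongs to this set, so the set is not empty, and the mean
  values are a selection measurable in \<open>t\<close> that needs no measurable selection theorem.
\<close>
definition ess_hull :: "(real \<Rightarrow> 'y::euclidean_space \<Rightarrow> 'v::real_normed_vector) \<Rightarrow> real \<Rightarrow> real \<Rightarrow> 'y \<Rightarrow> 'v set" where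
  "ess_hull u \<delta> t y = (\<Inter>M\<in>null_sets lebesgue. closure (convex hull (u t ` (ball y \<delta> - M))))"

lemma filippov_reg_eq_INT_ess_hull: "filippov_reg u t y = (\<Inter>\<delta>\<in>{0<..}. ess_hull u \<delta> t y)"
  by (simp add: filippov_reg_def ess_hull_def)

lemma closed_ess_hull: "closed (ess_hull u \<delta> t y)"
  unfolding ess_hull_def by (intro closed_INT ballI closed_closure)

lemma convex_ess_hull: "convex (ess_hull u \<delta> t y)"
  unfolding ess_hull_def by (intro convex_INT convex_closure convex_convex_hull)

lemma ess_hull_mono:
  assumes "ball y' \<delta>' \<subseteq> ball y \<delta>"
  shows "ess_hull u \<delta>' t y' \<subseteq> ess_hull u \<delta> t y"
proof -
  have "closure (convex hull (u t ` (ball y' \<delta>' - M))) \<subseteq> closure (convex hull (u t ` (ball y \<delta> - M)))" for M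
    using assms by (intro closure_mono hull_mono image_mono Diff_mono order_refl)
  then show ?thesis unfolding ess_hull_def by blast
qed

lemma ess_hull_subset_cball:
  assumes "AE z in lebesgue. z \<in> ball y \<delta> \<longrightarrow> norm (u t z) \<le> M"
  shows "ess_hull u \<delta> t y \<subseteq> cball 0 M"
proof -
  define N where "N = {z. \<not> (z \<in> ball y \<delta> \<longrightarrow> norm (u t z) \<le> M)}"
  have "N \<in> null_sets lebesgue"
    using assms by (simp add: completion.AE_iff_null_sets N_def)
  then have "ess_hull u \<delta> t y \<subseteq> closure (convex hull (u t ` (ball y \<delta> - N)))"
    unfolding ess_hull_def by (rule INT_lower)
  also have "\<dots> \<subseteq> cball 0 M"
    by (intro closure_minimal hull_minimal) (auto simp: N_def)
  finally show ?thesis .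
qed

definition ball_average :: "('y::euclidean_space \<Rightarrow> 'v::euclidean_space) \<Rightarrow> real \<Rightarrow> 'y \<Rightarrow> 'v" where
  "ball_average f \<delta> y = (1 / measure lborel (ball y \<delta>)) *\<^sub>R (LINT z|lborel. indicator (ball y \<delta>) z *\<^sub>R f z)"

lemma integrable_indicator_ball_bounded:
  fixes f :: "'y::euclidean_space \<Rightarrow> 'v::euclidean_space"
  assumes f: "f \<in> borel_measurable borel" and bound: "AE z in lborel. z \<in> ball y \<delta> \<longrightarrow> norm (f z) \<le> M"
  shows "integrable lborel (\<lambda>z. indicat_real (ball y \<delta>) z *\<^sub>R f z)"
proof (rule Bochner_Integration.integrable_bound)
  show "integrable lborel (\<lambda>z. indicat_real (ball y \<delta>) z *\<^sub>R M)"
    by (intro integrable_scaleR_left integrable_real_indicator emeasure_bounded_finite) auto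
  show "(\<lambda>z. indicat_real (ball y \<delta>) z *\<^sub>R f z) \<in> borel_measurable lborel"
    using f by (intro borel_measurable_scaleR borel_measurable_indicator) auto
  show "AE z in lborel. norm (indicat_real (ball y \<delta>) z *\<^sub>R f z) \<le> norm (indicat_real (ball y \<delta>) z *\<^sub>R M)"
    using bound by eventually_elim (auto simp: indicator_def)
qed

text \<open>
  A mean value outside the closed convex hull could be strictly separated from it, and integrating
  the separating inequality over the ball would separate the mean value from itself.
\<close>
lemma ball_average_in_ess_hull:
  fixes f :: "'y::euclidean_space \<Rightarrow> 'v::euclidean_space"
  assumes \<delta>: "0 < \<delta>" and f: "f \<in> borel_measurable borel"
    and bound: "AE z in lborel. z \<in> ball y \<delta> \<longrightarrow> norm (f z) \<le> M"
    and eq: "AE z in lborel. u t z = f z"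
  shows "ball_average f \<delta> y \<in> ess_hull u \<delta> t y"
  unfolding ess_hull_def
proof
  fix N :: "'y set" assume N: "N \<in> null_sets lebesgue"
  define S where "S = closure (convex hull (u t ` (ball y \<delta> - N)))"
  have int: "integrable lborel (\<lambda>z. indicat_real (ball y \<delta>) z *\<^sub>R f z)"
    by (rule integrable_indicator_ball_bounded[OF f bound])
  have pos: "measure lborel (ball y \<delta>) > 0" using \<delta> by (simp add: content_ball)
  have "AE z in lebesgue. z \<notin> N" using N by (rule AE_not_in)
  then have "AE z in lborel. z \<notin> N" by (simp add: AE_completion_iff)
  with eq have inS: "AE z in lborel. z \<in> ball y \<delta> \<longrightarrow> f z \<in> S"
  proof eventually_elim
    case (elim z)
    have "u t z \<in> S" if "z \<in> ball y \<delta>"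
      unfolding S_def using elim(2) that by (intro subsetD[OF closure_subset] hull_inc imageI) simp
    then show ?case using elim by simp
  qed
  have "ball_average f \<delta> y \<in> S"
  proof (rule ccontr)
    assume "ball_average f \<delta> y \<notin> S"
    moreover have "convex S" "closed S" by (simp_all add: S_def convex_closure)
    ultimately have "\<exists>p c. inner p (ball_average f \<delta> y) < c \<and> (\<forall>x\<in>S. inner p x > c)"
      by (intro separating_hyperplane_closed_point)
    then obtain p c where p: "inner p (ball_average f \<delta> y) < c" "\<And>x. x \<in> S \<Longrightarrow> inner p x > c"
      by blast
    have "c * measure lborel (ball y \<delta>) = (LINT z|lborel. indicat_real (ball y \<delta>) z * c)"
      by simp
    also have "\<dots> \<le> (LINT z|lborel. inner p (indicat_real (ball y \<delta>) z *\<^sub>R f z))"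
    proof (rule integral_mono_AE)
      show "integrable lborel (\<lambda>z. indicat_real (ball y \<delta>) z * c)"
        by (intro integrable_mult_left integrable_real_indicator emeasure_bounded_finite) auto
      show "integrable lborel (\<lambda>z. inner p (indicat_real (ball y \<delta>) z *\<^sub>R f z))"
        using int by (intro integrable_inner_right) simp
      show "AE z in lborel. indicat_real (ball y \<delta>) z * c \<le> inner p (indicat_real (ball y \<delta>) z *\<^sub>R f z)"
        using inS
      proof eventually_elim
        case (elim z)
        then show ?case using less_imp_le[OF p(2)[of "f z"]] by (cases "z \<in> ball y \<delta>") simp_all
      qed
    qed
    also have "\<dots> = inner p (LINT z|lborel. indicat_real (ball y \<delta>) z *\<^sub>R f z)"
      using int by (intro integral_inner_right) simp
    also have "\<dots> = inner p (ball_average f \<delta> y) * measure lborel (ball y \<delta>)"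
      using pos by (simp add: ball_average_def)
    finally show False using p(1) pos by simp
  qed
  then show "ball_average f \<delta> y \<in> closure (convex hull (u t ` (ball y \<delta> - N)))" by (simp add: S_def)
qed

lemma ball_average_component:
  fixes f :: "'y::euclidean_space \<Rightarrow> real ^ 'm"
  assumes "f \<in> borel_measurable borel" "AE z in lborel. z \<in> ball y \<delta> \<longrightarrow> norm (f z) \<le> M"
  shows "ball_average f \<delta> y $ i = ball_average (\<lambda>z. f z $ i) \<delta> y"
proof -
  have "(LINT z|lborel. (indicat_real (ball y \<delta>) z *\<^sub>R f z) $ i) = (LINT z|lborel. indicat_real (ball y \<delta>) z *\<^sub>R f z) $ i"
    by (rule integral_bounded_linear[OF bounded_linear_vec_nth integrable_indicator_ball_bounded[OF assms]])
  then show ?thesis by (simp add: ball_average_def)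
qed

lemma ball_average_measurable:
  fixes g :: "real \<times> 'y::euclidean_space \<Rightarrow> 'v::euclidean_space"
  assumes g[measurable]: "g \<in> borel_measurable borel" and \<eta>: "continuous_on UNIV \<eta>" and \<delta>: "0 < \<delta>"
  shows "(\<lambda>t. ball_average (\<lambda>z. g (t, z)) \<delta> (\<eta> t)) \<in> borel_measurable lebesgue"
proof -
  have \<eta>_meas[measurable]: "\<eta> \<in> borel_measurable borel" using \<eta> by (rule borel_measurable_continuous_onI)
  have "(\<lambda>t. LINT z|lborel. (if dist (\<eta> t) z < \<delta> then g (t, z) else 0)) \<in> borel_measurable borel"
  proof (rule lborel.borel_measurable_lebesgue_integral)
    have "(\<lambda>(t, z). if dist (\<eta> t) z < \<delta> then g (t, z) else 0) \<in> borel_measurable (borel \<Otimes>\<^sub>M borel)"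
      by measurable
    then show "(\<lambda>(t, z). if dist (\<eta> t) z < \<delta> then g (t, z) else 0) \<in> borel_measurable (borel \<Otimes>\<^sub>M lborel)"
      by simp
  qed
  moreover have "ball_average (\<lambda>z. g (t, z)) \<delta> (\<eta> t) = (1 / (unit_ball_vol (real DIM('y)) * \<delta> ^ DIM('y))) *\<^sub>R
      (LINT z|lborel. (if dist (\<eta> t) z < \<delta> then g (t, z) else 0))" for t
  proof -
    have "(\<lambda>z. indicat_real (ball (\<eta> t) \<delta>) z *\<^sub>R g (t, z)) = (\<lambda>z. if dist (\<eta> t) z < \<delta> then g (t, z) else 0)"
      by (auto simp: indicator_def)
    then show ?thesis using \<delta> by (simp add: ball_average_def content_ball)
  qed
  ultimately have "(\<lambda>t. ball_average (\<lambda>z. g (t, z)) \<delta> (\<eta> t)) \<in> borel_measurable borel" by simp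
  then show ?thesis by (intro measurable_completion) simp
qed

text \<open>
  Both regularizations are intersections over \<open>\<delta>\<close> of closed convex sets that grow with the ball and
  contain the mean values, so the two kinds of solutions can be treated alike. The
  factor \<open>CARD('m)\<close> pays for bounding a vector by its components.
\<close>
lemma filippov_hull_family:
  fixes u :: "real \<Rightarrow> real ^ 'k \<Rightarrow> real ^ 'm"
  assumes U: "U = filippov_reg u \<or> U = filippov_reg_componentwise u"
  obtains H where "\<And>\<delta> t y. closed (H \<delta> t y)" "\<And>\<delta> t y. convex (H \<delta> t y)"
    "\<And>\<delta> \<delta>' t y y'. ball y' \<delta>' \<subseteq> ball y \<delta> \<Longrightarrow> H \<delta>' t y' \<subseteq> H \<delta> t y"
    "\<And>t y. U t y = (\<Inter>\<delta>\<in>{0<..}. H \<delta> t y)"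
    "\<And>\<delta> t y M. AE z in lebesgue. z \<in> ball y \<delta> \<longrightarrow> norm (u t z) \<le> M \<Longrightarrow> H \<delta> t y \<subseteq> cball 0 (real CARD('m) * \<bar>M\<bar>)"
    "\<And>\<delta> t y f M. 0 < \<delta> \<Longrightarrow> f \<in> borel_measurable borel \<Longrightarrow> AE z in lborel. z \<in> ball y \<delta> \<longrightarrow> norm (f z) \<le> M \<Longrightarrow>
      AE z in lborel. u t z = f z \<Longrightarrow> ball_average f \<delta> y \<in> H \<delta> t y"
  using U
proof
  assume U: "U = filippov_reg u"
  show thesis
  proof (rule that[of "ess_hull u"])
    show "ess_hull u \<delta> t y \<subseteq> cball 0 (real CARD('m) * \<bar>M\<bar>)"
      if "AE z in lebesgue. z \<in> ball y \<delta> \<longrightarrow> norm (u t z) \<le> M" for \<delta> t y M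
    proof -
      have "1 * \<bar>M\<bar> \<le> real CARD('m) * \<bar>M\<bar>" by (intro mult_right_mono) (simp_all add: Suc_le_eq)
      then have "cball 0 M \<subseteq> (cball 0 (real CARD('m) * \<bar>M\<bar>) :: (real ^ 'm) set)"
        by (intro subset_cball) simp
      then show ?thesis using ess_hull_subset_cball[where u = u and t = t, OF that] by blast
    qed
    show "U t y = (\<Inter>\<delta>\<in>{0<..}. ess_hull u \<delta> t y)" for t y
      by (simp add: U filippov_reg_eq_INT_ess_hull)
  qed (rule closed_ess_hull convex_ess_hull ess_hull_mono ball_average_in_ess_hull; assumption)+
next
  assume U: "U = filippov_reg_componentwise u"
  define H where "H \<delta> t y = {v. \<forall>i. v $ i \<in> ess_hull (\<lambda>s z. u s z $ i) \<delta> t y}" for \<delta> t y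
  have H_eq: "H \<delta> t y = (\<Inter>i. (\<lambda>v. v $ i) -` ess_hull (\<lambda>s z. u s z $ i) \<delta> t y)" for \<delta> t y
    by (auto simp: H_def)
  show thesis
  proof (rule that[of H])
    show "closed (H \<delta> t y)" for \<delta> t y
      unfolding H_eq by (intro closed_INT ballI closed_vimage closed_ess_hull continuous_intros)
    show "convex (H \<delta> t y)" for \<delta> t y
      unfolding H_eq by (intro convex_INT convex_linear_vimage convex_ess_hull bounded_linear.linear bounded_linear_vec_nth)
    show "H \<delta>' t y' \<subseteq> H \<delta> t y" if "ball y' \<delta>' \<subseteq> ball y \<delta>" for \<delta> \<delta>' t y y'
      unfolding H_def using ess_hull_mono[OF that] by blast
    show "U t y = (\<Inter>\<delta>\<in>{0<..}. H \<delta> t y)" for t y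
      by (auto simp: U filippov_reg_componentwise_def filippov_reg_eq_INT_ess_hull H_def)
    show "H \<delta> t y \<subseteq> cball 0 (real CARD('m) * \<bar>M\<bar>)"
      if b: "AE z in lebesgue. z \<in> ball y \<delta> \<longrightarrow> norm (u t z) \<le> M" for \<delta> t y M
    proof
      fix v assume v: "v \<in> H \<delta> t y"
      have "\<bar>v $ i\<bar> \<le> \<bar>M\<bar>" for i
      proof -
        have "AE z in lebesgue. z \<in> ball y \<delta> \<longrightarrow> norm (u t z $ i) \<le> M"
          using b by eventually_elim (auto intro: order.trans[OF component_le_norm_cart])
        from ess_hull_subset_cball[where u = "\<lambda>s z. u s z $ i" and t = t, OF this]
        have "v $ i \<in> cball 0 M" using v unfolding H_def by blast
        then show ?thesis by simp
      qed
      then have "(\<Sum>i\<in>UNIV. \<bar>v $ i\<bar>) \<le> (\<Sum>i\<in>(UNIV :: 'm set). \<bar>M\<bar>)" by (intro sum_mono)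
      then show "v \<in> cball 0 (real CARD('m) * \<bar>M\<bar>)"
        using norm_le_l1_cart[of v] by simp
    qed
    show "ball_average f \<delta> y \<in> H \<delta> t y" if "0 < \<delta>" and f: "f \<in> borel_measurable borel"
      and b: "AE z in lborel. z \<in> ball y \<delta> \<longrightarrow> norm (f z) \<le> M" and eq: "AE z in lborel. u t z = f z" for \<delta> t y f M
    proof -
      have "ball_average (\<lambda>z. f z $ i) \<delta> y \<in> ess_hull (\<lambda>s z. u s z $ i) \<delta> t y" for i
      proof (rule ball_average_in_ess_hull[where M = M, OF \<open>0 < \<delta>\<close>])
        show "(\<lambda>z. f z $ i) \<in> borel_measurable borel"
          by (rule borel_measurable_continuous_on[OF continuous_on_component[OF continuous_on_id] f])
        show "AE z in lborel. z \<in> ball y \<delta> \<longrightarrow> norm (f z $ i) \<le> M"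
          using b by eventually_elim (auto intro: order.trans[OF component_le_norm_cart])
        show "AE z in lborel. u t z $ i = f z $ i" using eq by eventually_elim simp
      qed
      then show ?thesis by (simp add: H_def ball_average_component[OF f b])
    qed
  qed
qed

lemma lebesgue_measurable_ex_borel:
  fixes f :: "'a::euclidean_space \<Rightarrow> 'v::euclidean_space"
  assumes f: "f \<in> borel_measurable lebesgue"
  obtains g where "g \<in> borel_measurable borel" "AE x in lborel. f x = g x"
proof -
  have "\<forall>b. \<exists>g. g \<in> borel_measurable lborel \<and> (AE x in lborel. f x \<bullet> b = g x)"
  proof
    fix b :: 'v
    have "(\<lambda>x. f x \<bullet> b) \<in> borel_measurable lebesgue"
      using f by (intro borel_measurable_inner) auto
    from completion_ex_borel_measurable_real[OF this]
    show "\<exists>g. g \<in> borel_measurable lborel \<and> (AE x in lborel. f x \<bullet> b = g x)" by blast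
  qed
  from choice[OF this] obtain g where g: "\<And>b. g b \<in> borel_measurable lborel" "\<And>b. AE x in lborel. f x \<bullet> b = g b x"
    by blast
  show thesis
  proof (rule that[of "\<lambda>x. \<Sum>b\<in>Basis. g b x *\<^sub>R b"])
    have "g b \<in> borel_measurable borel" for b using g(1)[of b] by simp
    then show "(\<lambda>x. \<Sum>b\<in>Basis. g b x *\<^sub>R b) \<in> borel_measurable borel"
      by (intro borel_measurable_sum borel_measurable_scaleR) auto
    have "AE x in lborel. \<forall>b\<in>Basis. f x \<bullet> b = g b x"
      by (intro AE_finite_allI g(2)) simp
    then show "AE x in lborel. f x = (\<Sum>b\<in>Basis. g b x *\<^sub>R b)"
    proof eventually_elim
      case (elim x)
      have "f x = (\<Sum>b\<in>Basis. (f x \<bullet> b) *\<^sub>R b)" by (rule euclidean_representation[symmetric])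
      also have "\<dots> = (\<Sum>b\<in>Basis. g b x *\<^sub>R b)" using elim by (intro sum.cong) auto
      finally show ?case .
    qed
  qed
qed

section \<open>Utkin solutions and trajectories with projected output\<close>

lemma first_exit_time:
  fixes f :: "real \<Rightarrow> real"
  assumes f: "continuous_on {p..q} f" and p: "f p < r" and exit: "t \<in> {p..q}" "r \<le> f t"
  obtains t' where "p < t'" "t' \<le> q" "r \<le> f t'" "\<And>t. p \<le> t \<Longrightarrow> t < t' \<Longrightarrow> f t < r"
proof -
  define S where "S = {t \<in> {p..q}. r \<le> f t}"
  have "closed ({p..q} \<inter> f -` {r..})"
    by (rule continuous_closed_preimage[OF f]) auto
  then have "compact ({p..q} \<inter> ({p..q} \<inter> f -` {r..}))"
    by (rule compact_Int_closed[OF compact_Icc])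
  moreover have "{p..q} \<inter> ({p..q} \<inter> f -` {r..}) = S" by (auto simp: S_def)
  ultimately have "compact S" by simp
  moreover have "S \<noteq> {}" using exit by (auto simp: S_def)
  ultimately have "\<exists>t'\<in>S. \<forall>t\<in>S. t' \<le> t"
    by (rule compact_attains_inf)
  then obtain t' where t': "t' \<in> S" "\<And>t. t \<in> S \<Longrightarrow> t' \<le> t"
    by blast
  show thesis
  proof (rule that[of t'])
    show "p < t'" using t'(1) p by (cases "t' = p") (auto simp: S_def)
    show "f t < r" if "p \<le> t" "t < t'" for t
    proof (rule ccontr)
      assume "\<not> f t < r"
      then have "t \<in> S" using t'(1) that by (auto simp: S_def)
      then show False using t'(2)[of t] that by simp
    qed
  qed (use t'(1) in \<open>auto simp: S_def\<close>)
qed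

lemma strict_bound_persists:
  fixes f :: "real \<Rightarrow> real"
  assumes f: "continuous_on {p..\<beta>} f" and b: "p \<le> b" "b < \<beta>" and lt: "\<And>t. p \<le> t \<Longrightarrow> t \<le> b \<Longrightarrow> f t < r"
  obtains c where "b < c" "c \<le> \<beta>" "\<And>t. p \<le> t \<Longrightarrow> t < c \<Longrightarrow> f t < r"
proof (cases "\<exists>t\<in>{b..\<beta>}. r \<le> f t")
  case False
  show thesis
  proof (rule that[OF b(2) order_refl])
    fix t assume "p \<le> t" "t < \<beta>"
    then show "f t < r" using False lt[of t] by (cases "t \<le> b") (auto simp: not_le)
  qed
next
  case True
  then obtain t where t: "t \<in> {b..\<beta>}" "r \<le> f t" by blast
  have "continuous_on {b..\<beta>} f" using f by (rule continuous_on_subset) (use b in auto)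
  then obtain t' where t': "b < t'" "t' \<le> \<beta>" "\<And>t. b \<le> t \<Longrightarrow> t < t' \<Longrightarrow> f t < r"
    using first_exit_time[OF _ lt[OF b(1) order_refl] t] by blast
  show thesis
  proof (rule that[OF t'(1,2)])
    fix t assume "p \<le> t" "t < t'"
    then show "f t < r" using t'(3)[of t] lt[of t] by linarith
  qed
qed

text \<open>
  An inclusion system whose right-hand side is \<open>\<gamma> t + U t y\<close> as long as the output stays in the ball
  of radius \<open>r\<close>. The lemmas \<open>utkin_imp_inclusion\<close> and \<open>inclusion_imp_utkin\<close> translate between its
  solutions and Utkin solutions whose output stays in this ball.
\<close>
locale utkin_cutoff = inclusion_system \<Psi> B C a \<beta> H sel m
  for \<Psi> :: "real \<Rightarrow> 'b::banach \<Rightarrow> 'b" and B :: "'v::euclidean_space \<Rightarrow> 'b" and C :: "'b \<Rightarrow> 'y::euclidean_space"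
    and a \<beta> H sel m +
  fixes \<gamma> :: "real \<Rightarrow> 'v" and U :: "real \<Rightarrow> 'y \<Rightarrow> 'v set" and r :: real
  assumes disturbance: "\<gamma> absolutely_integrable_on {a..\<beta>}"
    and cutoff: "norm y \<le> r \<Longrightarrow> (\<Inter>\<delta>\<in>{0<..}. H \<delta> t y) = {v. v - \<gamma> t \<in> U t y}"
begin

lemma traj_eq_integral:
  assumes w: "w absolutely_integrable_on {a..\<beta>}" and t: "a \<le> t1" "t1 \<le> t" "t \<le> \<beta>"
  shows "traj t1 x1 w t = \<Psi> (t - t1) x1 + integral {t1..t} (response t w)"
proof -
  define w1 where "w1 \<tau> = (if t1 < \<tau> then w \<tau> else 0)" for \<tau>
  have w1: "w1 absolutely_integrable_on {a..\<beta>}" unfolding w1_def by (rule truncate_absolutely_integrable[OF w])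
  have "integral {t1..t} (response t w) = integral {t1..t} (response t w1)"
    by (rule integral_spike[of "{t1}"]) (auto simp: w1_def)
  moreover have "duhamel a w1 t1 = 0" by (rule duhamel_zero) (simp add: w1_def)
  moreover have "\<Psi> (t - t1) 0 = 0" using linear_0[OF bounded_linear.linear[OF bounded_linear_semigroup[of "t - t1"]]] t by simp
  ultimately show ?thesis
    using duhamel_restart[OF w1 t] t by (simp add: traj_def w1_def[abs_def])
qed

lemma utkin_imp_inclusion:
  assumes \<xi>: "utkin_solution \<Psi> B C \<gamma> U t1 x1 T \<xi>" and c: "a \<le> t1" "t1 \<le> c" "c \<le> \<beta>" "ereal c \<le> ereal t1 + T"
    and bound: "\<And>t. t1 \<le> t \<Longrightarrow> t < c \<Longrightarrow> norm (C (\<xi> t)) \<le> r"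
  obtains w where "inclusion_solution t1 x1 w c" "\<And>t. t \<in> lifespan t1 T \<Longrightarrow> t \<le> c \<Longrightarrow> traj t1 x1 w t = \<xi> t"
proof -
  from \<xi> obtain v where v: "\<And>b. ereal b \<le> ereal t1 + T \<Longrightarrow> set_integrable lebesgue {t1<..<b} v"
    and vU: "AE t in lebesgue. t \<in> lifespan t1 T \<longrightarrow> v t \<in> U t (C (\<xi> t))"
    and vI: "\<And>t. t \<in> lifespan t1 T \<Longrightarrow> \<exists>I. has_strong_bochner_integral lebesgue
        (\<lambda>\<tau>. indicator {t1<..<t} \<tau> *\<^sub>R \<Psi> (t - \<tau>) (B (v \<tau> + \<gamma> \<tau>))) I \<and> \<xi> t = \<Psi> (t - t1) x1 + I"
    unfolding utkin_solution_def by blast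
  define w where "w \<tau> = (if \<tau> \<in> {t1<..<c} then v \<tau> + \<gamma> \<tau> else 0)" for \<tau>
  have \<gamma>c: "set_integrable lebesgue {t1<..<c} \<gamma>"
    by (rule set_integrable_subset[OF disturbance]) (use c in auto)
  have "set_integrable lebesgue {t1<..<c} (\<lambda>\<tau>. v \<tau> + \<gamma> \<tau>)"
    by (intro set_integral_add v[OF c(4)] \<gamma>c)
  moreover have "(\<lambda>x. indicat_real {t1<..<c} x *\<^sub>R (v x + \<gamma> x)) = (\<lambda>x. indicat_real {a..\<beta>} x *\<^sub>R w x)"
    using c by (auto simp: w_def indicator_def)
  ultimately have w: "w absolutely_integrable_on {a..\<beta>}"
    by (simp add: set_integrable_def)
  have traj: "traj t1 x1 w t = \<xi> t" if t: "t \<in> lifespan t1 T" "t \<le> c" for t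
  proof -
    have t1t: "t1 \<le> t" "ereal t \<le> ereal t1 + T" using t by (auto simp: lifespan_def)
    have "set_integrable lebesgue {t1<..<t} (\<lambda>\<tau>. v \<tau> + \<gamma> \<tau>)"
      by (intro set_integral_add v[OF t1t(2)] set_integrable_subset[OF \<gamma>c]) (use t in auto)
    note bochner_iff = strong_bochner_duhamel_iff[OF this]
    from vI[OF t(1)] have "\<xi> t = \<Psi> (t - t1) x1 + integral {t1..t} (\<lambda>\<tau>. \<Psi> (t - \<tau>) (B (v \<tau> + \<gamma> \<tau>)))"
      unfolding bochner_iff by simp
    also have "integral {t1..t} (\<lambda>\<tau>. \<Psi> (t - \<tau>) (B (v \<tau> + \<gamma> \<tau>))) = integral {t1..t} (response t w)"
      by (rule integral_spike[of "{t1, t}"]) (use t in \<open>auto simp: w_def\<close>)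
    also have "\<Psi> (t - t1) x1 + \<dots> = traj t1 x1 w t"
      using c t t1t by (intro traj_eq_integral[symmetric] w) auto
    finally show ?thesis ..
  qed
  have "AE \<tau> in lebesgue. t1 < \<tau> \<and> \<tau> < c \<longrightarrow> w \<tau> \<in> F \<tau> (C (traj t1 x1 w \<tau>))"
    using vU
  proof eventually_elim
    case (elim \<tau>)
    show ?case
    proof
      assume \<tau>: "t1 < \<tau> \<and> \<tau> < c"
      then have "ereal \<tau> < ereal c" by simp
      then have "ereal \<tau> < ereal t1 + T" using c(4) by (rule less_le_trans)
      then have l: "\<tau> \<in> lifespan t1 T" using \<tau> by (simp add: lifespan_def)
      then have "w \<tau> - \<gamma> \<tau> \<in> U \<tau> (C (\<xi> \<tau>))" using elim \<tau> by (simp add: w_def)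
      moreover have "norm (C (\<xi> \<tau>)) \<le> r" using bound \<tau> by simp
      ultimately show "w \<tau> \<in> F \<tau> (C (traj t1 x1 w \<tau>))"
        using traj[OF l] \<tau> by (simp add: F_def cutoff)
    qed
  qed
  then have "inclusion_solution t1 x1 w c" using w by (simp add: inclusion_solution_def)
  then show thesis using traj by (rule that)
qed

lemma lifespan_finite: "lifespan t1 (ereal (c - t1)) = {t1..<c}"
  by (auto simp: lifespan_def)

lemma inclusion_imp_utkin:
  assumes w: "inclusion_solution t1 x1 w d" and c: "a \<le> t1" "t1 < c" "c \<le> d" "d \<le> \<beta>"
    and bound: "\<And>t. t1 \<le> t \<Longrightarrow> t < c \<Longrightarrow> norm (C (traj t1 x1 w t)) \<le> r"
  shows "utkin_solution \<Psi> B C \<gamma> U t1 x1 (ereal (c - t1)) (traj t1 x1 w)"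
proof -
  have wi: "w absolutely_integrable_on {a..\<beta>}" and wF: "AE \<tau> in lebesgue. t1 < \<tau> \<and> \<tau> < d \<longrightarrow> w \<tau> \<in> F \<tau> (C (traj t1 x1 w \<tau>))"
    using w by (auto simp: inclusion_solution_def)
  have sub: "set_integrable lebesgue {t1<..<b} w" "set_integrable lebesgue {t1<..<b} \<gamma>" if "b \<le> c" for b
    by (rule set_integrable_subset[OF wi] set_integrable_subset[OF disturbance]; use c that in auto)+
  have "continuous_on {t1..<c} (traj t1 x1 w)"
    by (rule continuous_on_subset[OF continuous_on_traj[OF wi]]) (use c in auto)
  moreover have "set_integrable lebesgue {t1<..<b} (\<lambda>\<tau>. w \<tau> - \<gamma> \<tau>)" if "ereal b \<le> ereal t1 + ereal (c - t1)" for b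
    using that by (intro set_integral_diff sub) auto
  moreover have "AE t in lebesgue. t \<in> {t1..<c} \<longrightarrow> w t - \<gamma> t \<in> U t (C (traj t1 x1 w t))"
  proof -
    have "AE \<tau> in lebesgue. \<tau> \<noteq> t1" by (rule AE_completion) (rule AE_lborel_singleton)
    with wF show ?thesis
    proof eventually_elim
      case (elim \<tau>)
      show ?case
      proof
        assume \<tau>: "\<tau> \<in> {t1..<c}"
        then have "w \<tau> \<in> F \<tau> (C (traj t1 x1 w \<tau>))" using elim c by simp
        moreover have "norm (C (traj t1 x1 w \<tau>)) \<le> r" using bound \<tau> by simp
        ultimately show "w \<tau> - \<gamma> \<tau> \<in> U \<tau> (C (traj t1 x1 w \<tau>))" by (simp add: F_def cutoff)
      qed
    qed
  qed
  moreover have "\<exists>I. has_strong_bochner_integral lebesgue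
      (\<lambda>\<tau>. indicator {t1<..<t} \<tau> *\<^sub>R \<Psi> (t - \<tau>) (B (w \<tau> - \<gamma> \<tau> + \<gamma> \<tau>))) I \<and> traj t1 x1 w t = \<Psi> (t - t1) x1 + I"
    if "t \<in> {t1..<c}" for t
  proof -
    have "has_strong_bochner_integral lebesgue (\<lambda>\<tau>. indicator {t1<..<t} \<tau> *\<^sub>R \<Psi> (t - \<tau>) (B (w \<tau>)))
        (integral {t1..t} (response t w))"
      using strong_bochner_duhamel_iff[OF sub(1)[of t]] that by simp
    moreover have "traj t1 x1 w t = \<Psi> (t - t1) x1 + integral {t1..t} (response t w)"
      using that c by (intro traj_eq_integral[OF wi]) auto
    ultimately show ?thesis by auto
  qed
  ultimately show ?thesis
    unfolding utkin_solution_def lifespan_finite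
    using c traj_before[of t1 t1 x1 w] by (intro conjI exI[of _ "\<lambda>\<tau>. w \<tau> - \<gamma> \<tau>"] ballI allI impI) auto
qed

lemma continuous_on_output:
  assumes "inclusion_solution t1 x1 w c" "a \<le> p"
  shows "continuous_on {p..\<beta>} (\<lambda>t. norm (C (traj t1 x1 w t)))"
proof -
  have "continuous_on {p..\<beta>} (traj t1 x1 w)"
    using assms by (intro continuous_on_subset[OF continuous_on_traj]) (auto simp: inclusion_solution_def)
  then show ?thesis
    by (intro continuous_on_norm bounded_linear.continuous_on[OF observation])
qed

text \<open>
  Up to the first time at which the output norm reaches \<open>r\<close>, a solution of the projected inclusion is
  an Utkin solution, hence coincides with \<open>x\<close>, whose output is bounded by \<open>R < r\<close>; so the norm
  stays below \<open>r\<close> up to \<open>b\<close>. The solution stays in the ball slightly beyond \<open>b\<close>, which gives the equality at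
  \<open>b\<close> itself.
\<close>
lemma reference_solution_unique:
  assumes t0: "a < t0" "t0 \<le> b" "b < \<beta>" and x0: "x t0 = x0"
    and unique: "\<And>T' x' t. utkin_solution \<Psi> B C \<gamma> U t0 x0 T' x' \<Longrightarrow> t \<in> {t0..b} \<Longrightarrow> t \<in> lifespan t0 T' \<Longrightarrow> x' t = x t"
    and R: "\<And>t. t \<in> {t0..b} \<Longrightarrow> norm (C (x t)) \<le> R" "R < r"
    and w: "inclusion_solution t0 x0 w \<beta>" and t: "t0 \<le> t" "t \<le> b"
  shows "traj t0 x0 w t = x t"
proof -
  define f where "f t = norm (C (traj t0 x0 w t))" for t
  have f: "continuous_on {t0..\<beta>} f" unfolding f_def by (rule continuous_on_output[OF w]) (use t0 in simp)
  have start: "traj t0 x0 w t0 = x0" by (rule traj_before) simp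
  have ft0: "f t0 < r" using R(1)[of t0] R(2) t0 by (simp add: f_def start x0)
  have "f t < r" if t: "t0 \<le> t" "t \<le> b" for t
  proof (rule ccontr)
    assume "\<not> f t < r"
    moreover have "continuous_on {t0..b} f" by (rule continuous_on_subset[OF f]) (use t0 in auto)
    ultimately obtain t' where t': "t0 < t'" "t' \<le> b" "r \<le> f t'" "\<And>t. t0 \<le> t \<Longrightarrow> t < t' \<Longrightarrow> f t < r"
      using first_exit_time[of t0 b f r t] ft0 t by auto
    have "utkin_solution \<Psi> B C \<gamma> U t0 x0 (ereal (t' - t0)) (traj t0 x0 w)"
      by (rule inclusion_imp_utkin[OF w]) (use t0 t' less_imp_le in \<open>auto simp: f_def\<close>)
    then have "traj t0 x0 w s = x s" if "s \<in> {t0..<t'}" for s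
      using that t' by (intro unique) (auto simp: lifespan_finite)
    then have "\<forall>s\<in>{t0..<t'}. norm (f s) \<le> R" using R(1) t' by (auto simp: f_def)
    moreover have "closure {t0..<t'} = {t0..t'}" using t' by simp
    moreover have "continuous_on {t0..t'} f" by (rule continuous_on_subset[OF f]) (use t0 t' in auto)
    ultimately have "norm (f t') \<le> R"
      using t'(1) continuous_on_closure_norm_le[of "{t0..<t'}" f R t'] by simp
    then show False using t'(3) R(2) by simp
  qed
  then obtain c where c: "b < c" "c \<le> \<beta>" "\<And>t. t0 \<le> t \<Longrightarrow> t < c \<Longrightarrow> f t < r"
    using strict_bound_persists[OF f t0(2,3)] by blast
  have "utkin_solution \<Psi> B C \<gamma> U t0 x0 (ereal (c - t0)) (traj t0 x0 w)"
    by (rule inclusion_imp_utkin[OF w]) (use t0 c less_imp_le in \<open>auto simp: f_def\<close>)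
  then show ?thesis using t c by (intro unique) (auto simp: lifespan_finite)
qed

text \<open>
  The stability radius \<open>\<epsilon>'\<close> is so small that a state \<open>\<epsilon>'\<close>-close to the reference has output norm
  below \<open>r\<close>. Solutions starting close to the reference therefore never leave the ball before \<open>b\<close>, so
  that stability for the projected inclusion applies to them, and so does its global existence.
\<close>
lemma continuous_dependence:
  assumes t0: "a < t0" "t0 \<le> b" "b < \<beta>" and x0: "x t0 = x0"
    and unique: "\<And>T' x' t. utkin_solution \<Psi> B C \<gamma> U t0 x0 T' x' \<Longrightarrow> t \<in> {t0..b} \<Longrightarrow> t \<in> lifespan t0 T' \<Longrightarrow> x' t = x t"
    and R: "\<And>t. t \<in> {t0..b} \<Longrightarrow> norm (C (x t)) \<le> R" "R < r"
    and \<epsilon>: "0 < \<epsilon>"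
  shows "\<exists>\<delta>>0. \<forall>t1 x1. \<bar>t1 - t0\<bar> + norm (x1 - x0) < \<delta> \<longrightarrow>
    (\<exists>T1 \<xi>. utkin_solution \<Psi> B C \<gamma> U t1 x1 T1 \<xi>) \<and>
    (\<forall>T1 \<xi>. utkin_solution \<Psi> B C \<gamma> U t1 x1 T1 \<xi> \<longrightarrow>
      (\<forall>t\<in>lifespan t1 T1. t \<le> b \<longrightarrow> norm (\<xi> t - x (max t t0)) < \<epsilon>) \<and>
      (\<exists>T2 \<zeta>. T1 \<le> T2 \<and> utkin_solution \<Psi> B C \<gamma> U t1 x1 T2 \<zeta> \<and>
         (\<forall>t\<in>lifespan t1 T1. \<zeta> t = \<xi> t) \<and> {t1..b} \<subseteq> lifespan t1 T2))"
proof -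
  obtain \<mu> where \<mu>: "\<mu> > 0" "\<And>z. norm (C z) \<le> norm z * \<mu>"
    using bounded_linear.pos_bounded[OF observation] by blast
  define \<epsilon>' where "\<epsilon>' = min \<epsilon> ((r - R) / \<mu>)"
  have \<epsilon>': "0 < \<epsilon>'" "\<epsilon>' \<le> \<epsilon>" using \<epsilon> R(2) \<mu>(1) by (auto simp: \<epsilon>'_def)
  have near: "norm (C z) < r" if "norm (z - x (max s t0)) < \<epsilon>'" "s \<le> b" for z s
  proof -
    interpret bounded_linear C by (rule observation)
    have "norm (z - x (max s t0)) * \<mu> < (r - R) / \<mu> * \<mu>"
      using that \<mu>(1) by (intro mult_strict_right_mono) (auto simp: \<epsilon>'_def)
    then have "norm (C z - C (x (max s t0))) < r - R"
      using \<mu>(2)[of "z - x (max s t0)"] \<mu>(1) by (simp add: diff)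
    then show ?thesis
      using norm_triangle_sub[of "C z" "C (x (max s t0))"] R(1)[of "max s t0"] that(2) t0(2) by auto
  qed
  have ref: "traj t0 x0 w t = x t" if "inclusion_solution t0 x0 w \<beta>" "t0 \<le> t" "t \<le> b" for w t
    using t0 x0 unique R that by (rule reference_solution_unique)
  have "\<exists>\<delta>>0. \<forall>t1 x1 w c. a \<le> t1 \<and> t1 \<le> c \<and> c \<le> \<beta> \<and> \<bar>t1 - t0\<bar> + norm (x1 - x0) < \<delta> \<and>
      inclusion_solution t1 x1 w c \<longrightarrow> (\<forall>t. t1 \<le> t \<and> t \<le> c \<and> t \<le> b \<longrightarrow> norm (traj t1 x1 w t - x (max t t0)) < \<epsilon>')"
    by (rule inclusion_solution_stability[OF t0(1,2) less_imp_le[OF t0(3)] ref \<epsilon>'(1)])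
  then obtain \<delta>0 where \<delta>0: "\<delta>0 > 0" and stab_all: "\<forall>t1 x1 w c. a \<le> t1 \<and> t1 \<le> c \<and> c \<le> \<beta> \<and> \<bar>t1 - t0\<bar> + norm (x1 - x0) < \<delta>0 \<and>
      inclusion_solution t1 x1 w c \<longrightarrow> (\<forall>t. t1 \<le> t \<and> t \<le> c \<and> t \<le> b \<longrightarrow> norm (traj t1 x1 w t - x (max t t0)) < \<epsilon>')"
    by (elim exE conjE)
  have stab: "norm (traj t1 x1 w t - x (max t t0)) < \<epsilon>'"
    if "a \<le> t1" "t1 \<le> c" "c \<le> \<beta>" "\<bar>t1 - t0\<bar> + norm (x1 - x0) < \<delta>0" "inclusion_solution t1 x1 w c" "t1 \<le> t" "t \<le> c" "t \<le> b"
    for t1 x1 w c t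
    by (rule stab_all[rule_format, where c = c]) (use that in simp_all)
  define \<delta> where "\<delta> = min (min \<delta>0 (t0 - a)) (min (\<beta> - b) \<epsilon>')"
  have in_range: "a \<le> t1" "t1 < \<beta>" "norm (x1 - x0) < \<epsilon>'" if "\<bar>t1 - t0\<bar> + norm (x1 - x0) < \<delta>" for t1 x1
  proof -
    have "\<bar>t1 - t0\<bar> + norm (x1 - x0) < t0 - a" "\<bar>t1 - t0\<bar> + norm (x1 - x0) < \<beta> - b" "\<bar>t1 - t0\<bar> + norm (x1 - x0) < \<epsilon>'"
      using that by (simp_all add: \<delta>_def)
    then show "a \<le> t1" "t1 < \<beta>" "norm (x1 - x0) < \<epsilon>'"
      using t0 norm_ge_zero[of "x1 - x0"] by linarith+
  qed
  have "\<delta> > 0" using \<delta>0 t0 \<epsilon>' by (simp add: \<delta>_def)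
  moreover have "(\<exists>T1 \<xi>. utkin_solution \<Psi> B C \<gamma> U t1 x1 T1 \<xi>)" if close: "\<bar>t1 - t0\<bar> + norm (x1 - x0) < \<delta>" for t1 x1
  proof -
    have t1: "a \<le> t1" "t1 < \<beta>" using in_range[OF close] by simp_all
    have Cx1: "norm (C x1) < r" using near[of x1 t0] in_range(3)[OF close] t0 x0 by simp
    obtain w where w: "inclusion_solution t1 x1 w \<beta>" using inclusion_solution_exists[OF t1(1)] by blast
    have f: "continuous_on {t1..\<beta>} (\<lambda>t. norm (C (traj t1 x1 w t)))" by (rule continuous_on_output[OF w t1(1)])
    have "norm (C (traj t1 x1 w t)) < r" if "t1 \<le> t" "t \<le> t1" for t
      using that Cx1 traj_before[of t t1 x1 w] by simp
    then obtain c where c: "t1 < c" "c \<le> \<beta>" "\<And>t. t1 \<le> t \<Longrightarrow> t < c \<Longrightarrow> norm (C (traj t1 x1 w t)) < r"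
      using strict_bound_persists[OF f order_refl t1(2)] by blast
    have "utkin_solution \<Psi> B C \<gamma> U t1 x1 (ereal (c - t1)) (traj t1 x1 w)"
      by (rule inclusion_imp_utkin[OF w t1(1) c(1,2) order_refl]) (rule less_imp_le[OF c(3)])
    then show ?thesis by blast
  qed
  moreover have "(\<forall>t\<in>lifespan t1 T1. t \<le> b \<longrightarrow> norm (\<xi> t - x (max t t0)) < \<epsilon>) \<and>
      (\<exists>T2 \<zeta>. T1 \<le> T2 \<and> utkin_solution \<Psi> B C \<gamma> U t1 x1 T2 \<zeta> \<and>
         (\<forall>t\<in>lifespan t1 T1. \<zeta> t = \<xi> t) \<and> {t1..b} \<subseteq> lifespan t1 T2)"
    if close: "\<bar>t1 - t0\<bar> + norm (x1 - x0) < \<delta>" and \<xi>: "utkin_solution \<Psi> B C \<gamma> U t1 x1 T1 \<xi>" for t1 x1 T1 \<xi>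
  proof -
    have t1: "a \<le> t1" "t1 < \<beta>" using in_range[OF close] by simp_all
    have close0: "\<bar>t1 - t0\<bar> + norm (x1 - x0) < \<delta>0" using close by (simp add: \<delta>_def)
    have Cx1: "norm (C x1) < r" using near[of x1 t0] in_range(3)[OF close] t0 x0 by simp
    have \<xi>t1: "\<xi> t1 = x1" and \<xi>_cont: "continuous_on (lifespan t1 T1) \<xi>" and T1: "0 < T1"
      using \<xi> by (auto simp: utkin_solution_def)
    have life: "ereal t \<le> ereal t1 + T1" "{t1..t} \<subseteq> lifespan t1 T1" "t1 \<le> t" if "t \<in> lifespan t1 T1" for t
      using that by (auto simp: lifespan_def intro: le_less_trans[rotated])
    have near_\<xi>: "norm (\<xi> t - x (max t t0)) < \<epsilon>'"
      if t: "t \<in> lifespan t1 T1" "t \<le> b" and bound: "\<And>s. t1 \<le> s \<Longrightarrow> s < t \<Longrightarrow> norm (C (\<xi> s)) < r" for t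
    proof -
      have "t \<le> \<beta>" using t t0 by simp
      then obtain w where w: "inclusion_solution t1 x1 w t" "\<And>s. s \<in> lifespan t1 T1 \<Longrightarrow> s \<le> t \<Longrightarrow> traj t1 x1 w s = \<xi> s"
        by (rule utkin_imp_inclusion[OF \<xi> t1(1) life(3)[OF t(1)] _ life(1)[OF t(1)] less_imp_le[OF bound]])
          (assumption, assumption, rule that)
      show ?thesis
        using stab[OF t1(1) life(3)[OF t(1)] \<open>t \<le> \<beta>\<close> close0 w(1) life(3)[OF t(1)] order_refl t(2)] w(2)[OF t(1) order_refl] by simp
    qed
    have bound_\<xi>: "norm (C (\<xi> t)) < r" if t: "t \<in> lifespan t1 T1" "t \<le> b" for t
    proof (rule ccontr)
      assume exit: "\<not> norm (C (\<xi> t)) < r"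
      have "continuous_on {t1..t} (\<lambda>t. norm (C (\<xi> t)))"
        by (intro continuous_on_norm bounded_linear.continuous_on[OF observation] continuous_on_subset[OF \<xi>_cont] life(2) t)
      then obtain t' where t': "t1 < t'" "t' \<le> t" "r \<le> norm (C (\<xi> t'))" "\<And>s. t1 \<le> s \<Longrightarrow> s < t' \<Longrightarrow> norm (C (\<xi> s)) < r"
        using first_exit_time[of t1 t "\<lambda>t. norm (C (\<xi> t))" r t] Cx1 \<xi>t1 exit life(3)[OF t(1)] by auto
      have l: "t' \<in> lifespan t1 T1" using life(2)[OF t(1)] t' by auto
      have "norm (\<xi> t' - x (max t' t0)) < \<epsilon>'"
        using l t' t by (intro near_\<xi>) auto
      then have "norm (C (\<xi> t')) < r" using t' t by (intro near[of _ t']) auto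
      then show False using t'(3) by simp
    qed
    have "norm (\<xi> t - x (max t t0)) < \<epsilon>" if t: "t \<in> lifespan t1 T1" "t \<le> b" for t
    proof -
      have "norm (\<xi> t - x (max t t0)) < \<epsilon>'"
      proof (rule near_\<xi>[OF t])
        fix s assume "t1 \<le> s" "s < t"
        then show "norm (C (\<xi> s)) < r" using life(2)[OF t(1)] t by (intro bound_\<xi>) auto
      qed
      then show ?thesis using \<epsilon>'(2) by simp
    qed
    moreover have "\<exists>T2 \<zeta>. T1 \<le> T2 \<and> utkin_solution \<Psi> B C \<gamma> U t1 x1 T2 \<zeta> \<and>
         (\<forall>t\<in>lifespan t1 T1. \<zeta> t = \<xi> t) \<and> {t1..b} \<subseteq> lifespan t1 T2"
    proof (cases "{t1..b} \<subseteq> lifespan t1 T1")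
      case True
      then show ?thesis using \<xi> by blast
    next
      case False
      then obtain s where "s \<in> {t1..b}" "s \<notin> lifespan t1 T1" by blast
      then have s: "t1 \<le> s" "s \<le> b" "ereal t1 + T1 \<le> ereal s" by (auto simp: lifespan_def not_less)
      then obtain p where p: "T1 = ereal p" using T1 by (cases T1) auto
      define c where "c = t1 + p"
      have c: "t1 < c" "c \<le> b" "T1 = ereal (c - t1)" using s T1 by (auto simp: p c_def)
      have life_c: "lifespan t1 T1 = {t1..<c}" unfolding c(3) by (rule lifespan_finite)
      have c\<beta>: "c \<le> \<beta>" using c t0 by simp
      have bound_c: "norm (C (\<xi> t)) \<le> r" if "t1 \<le> t" "t < c" for t
      proof (rule less_imp_le[OF bound_\<xi>])
        show "t \<in> lifespan t1 T1" unfolding life_c using that by simp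
      qed (use that c in simp)
      obtain w where w: "inclusion_solution t1 x1 w c" "\<And>t. t \<in> lifespan t1 T1 \<Longrightarrow> t \<le> c \<Longrightarrow> traj t1 x1 w t = \<xi> t"
        by (rule utkin_imp_inclusion[OF \<xi> t1(1) less_imp_le[OF c(1)] c\<beta> _ bound_c]) (simp add: c(3), assumption, assumption, rule that)
      obtain z where z: "inclusion_solution t1 x1 z \<beta>" "\<And>t. t \<le> c \<Longrightarrow> traj t1 x1 z t = traj t1 x1 w t"
        by (rule inclusion_solution_extend[OF w(1) t1(1) less_imp_le[OF c(1)] c\<beta>]) (rule that)
      have "norm (C (traj t1 x1 z t)) < r" if "t1 \<le> t" "t \<le> b" for t
        using stab[OF t1(1) less_imp_le[OF t1(2)] order_refl close0 z(1) that(1) _ that(2)] that(2) t0(3)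
        by (intro near[of _ t]) simp_all
      moreover have "continuous_on {t1..\<beta>} (\<lambda>t. norm (C (traj t1 x1 z t)))" by (rule continuous_on_output[OF z(1) t1(1)])
      moreover have "t1 \<le> b" using c by simp
      ultimately obtain d where d: "b < d" "d \<le> \<beta>" "\<And>t. t1 \<le> t \<Longrightarrow> t < d \<Longrightarrow> norm (C (traj t1 x1 z t)) < r"
        using strict_bound_persists[of t1 \<beta> _ b r] t0(3) by blast
      have "utkin_solution \<Psi> B C \<gamma> U t1 x1 (ereal (d - t1)) (traj t1 x1 z)"
        using c d by (intro inclusion_imp_utkin[OF z(1) t1(1) _ d(2) order_refl]) (auto intro: less_imp_le)
      moreover have "\<forall>t\<in>lifespan t1 T1. traj t1 x1 z t = \<xi> t"
        using z(2) w(2) by (auto simp: life_c)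
      moreover have "{t1..b} \<subseteq> lifespan t1 (ereal (d - t1))" using d by (auto simp: lifespan_finite)
      moreover have "T1 \<le> ereal (d - t1)" using c d by simp
      ultimately show ?thesis by blast
    qed
    ultimately show ?thesis by blast
  qed
  ultimately show ?thesis by (intro exI[of _ \<delta>]) blast
qed

end

section \<open>Continuous dependence on initial data\<close>

lemma caratheodory_imp_filippov:
  assumes "caratheodory_condition u" "(\<lambda>(t, y). u t y) \<in> borel_measurable lebesgue"
  shows "filippov_condition u"
  unfolding filippov_condition_def
proof (intro conjI allI impI assms(2))
  fix \<alpha> r :: real assume "0 < \<alpha>" "0 < r"
  with assms(1) obtain m :: "real \<Rightarrow> real" where m: "set_integrable lebesgue {-\<alpha><..<\<alpha>} m"
    "AE t in lebesgue. t \<in> {-\<alpha><..<\<alpha>} \<longrightarrow> (\<forall>y\<in>ball 0 r. norm (u t y) \<le> m t)"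
    unfolding caratheodory_condition_def by blast
  have "AE t in lebesgue. t \<in> {-\<alpha><..<\<alpha>} \<longrightarrow> (AE y in lebesgue. y \<in> ball 0 r \<longrightarrow> norm (u t y) \<le> m t)"
    using m(2) by eventually_elim (intro impI always_eventually allI, blast)
  with m(1) show "\<exists>m. set_integrable lebesgue {-\<alpha><..<\<alpha>} m \<and>
      (AE t in lebesgue. t \<in> {-\<alpha><..<\<alpha>} \<longrightarrow> (AE y in lebesgue. y \<in> ball 0 r \<longrightarrow> norm (u t y) \<le> m t))"
    by blast
qed

lemma Linfty_absolutely_integrable:
  assumes "Linfty \<gamma>"
  shows "\<gamma> absolutely_integrable_on {a..b}"
proof -
  from assms obtain c where c: "AE t in lebesgue. norm (\<gamma> t) \<le> c" and \<gamma>: "\<gamma> \<in> borel_measurable lebesgue"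
    by (auto simp: Linfty_def)
  show ?thesis
  proof (rule absolutely_integrable_bound_AE[OF _ \<gamma>])
    show "(\<lambda>_. c) absolutely_integrable_on {a..b}" by (rule absolutely_integrable_on_const) auto
    show "AE t in lebesgue. t \<in> {a..b} \<longrightarrow> norm (\<gamma> t) \<le> c" using c by eventually_elim simp
  qed auto
qed

text \<open>
  Outputs are projected onto the ball of radius \<open>r\<close>. For \<open>\<delta> \<le> 1\<close> only values of \<open>u t\<close> on the ball
  of radius \<open>r + 2\<close> enter, where the Filippov condition supplies the integrable bound. Averages are
  formed with a Borel version \<open>g\<close> of \<open>u\<close>, which agrees with \<open>u t\<close> almost everywhere for almost every
  \<open>t\<close>, so that Fubini yields measurability in \<open>t\<close>.
\<close>
lemma utkin_cutoff_exists:
  fixes \<Psi> :: "real \<Rightarrow> 'b::banach \<Rightarrow> 'b" and B :: "real ^ 'm \<Rightarrow> 'b" and C :: "'b \<Rightarrow> real ^ 'k"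
    and \<gamma> :: "real \<Rightarrow> real ^ 'm" and u :: "real \<Rightarrow> real ^ 'k \<Rightarrow> real ^ 'm"
  assumes \<Psi>: "C0_semigroup \<Psi>" and B: "bounded_linear B" and C: "bounded_linear C" and \<gamma>: "Linfty \<gamma>"
    and u: "filippov_condition u" and U: "U = filippov_reg u \<or> U = filippov_reg_componentwise u"
    and r: "0 < r"
  shows "\<exists>H sel m. utkin_cutoff \<Psi> B C a \<beta> H sel m \<gamma> U r"
proof -
  define \<alpha> where "\<alpha> = \<bar>a\<bar> + \<bar>\<beta>\<bar> + 1"
  have \<alpha>: "0 < \<alpha>" "{a..\<beta>} \<subseteq> {-\<alpha><..<\<alpha>}" by (auto simp: \<alpha>_def)
  have "0 < r + 2" using r by simp
  with u \<alpha>(1) obtain m0 :: "real \<Rightarrow> real" where m0: "set_integrable lebesgue {-\<alpha><..<\<alpha>} m0"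
    and um0: "AE t in lebesgue. t \<in> {-\<alpha><..<\<alpha>} \<longrightarrow> (AE y in lebesgue. y \<in> ball 0 (r + 2) \<longrightarrow> norm (u t y) \<le> m0 t)"
    unfolding filippov_condition_def by blast
  have "(\<lambda>(t, y). u t y) \<in> borel_measurable lebesgue"
    using u by (simp add: filippov_condition_def)
  then obtain g where g: "g \<in> borel_measurable borel" and ae: "AE p in lborel. (case p of (t, y) \<Rightarrow> u t y) = g p"
    by (rule lebesgue_measurable_ex_borel)
  have "AE p in lborel \<Otimes>\<^sub>M lborel. (case p of (t, y) \<Rightarrow> u t y) = g p"
    unfolding lborel_prod by (rule ae)
  from lborel_pair.AE_pair[OF this] have "AE t in lborel. AE y in lborel. u t y = g (t, y)"
    by simp
  then have ug: "AE t in lebesgue. AE y in lborel. u t y = g (t, y)"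
    by (rule AE_completion)
  have g_section: "(\<lambda>y. g (t, y)) \<in> borel_measurable borel" for t
    using measurable_compose[OF measurable_Pair1' g[folded borel_prod]] by (simp add: borel_prod)
  obtain Hd where closed: "\<And>\<delta> t y. closed (Hd \<delta> t y)" and convex: "\<And>\<delta> t y. convex (Hd \<delta> t y)"
    and mono: "\<And>\<delta> \<delta>' t y y'. ball y' \<delta>' \<subseteq> ball y \<delta> \<Longrightarrow> Hd \<delta>' t y' \<subseteq> Hd \<delta> t y"
    and INT: "\<And>t y. U t y = (\<Inter>\<delta>\<in>{0<..}. Hd \<delta> t y)"
    and bound: "\<And>\<delta> t y M. AE z in lebesgue. z \<in> ball y \<delta> \<longrightarrow> norm (u t z) \<le> M \<Longrightarrow> Hd \<delta> t y \<subseteq> cball 0 (real CARD('m) * \<bar>M\<bar>)"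
    and average: "\<And>\<delta> t y f M. 0 < \<delta> \<Longrightarrow> f \<in> borel_measurable borel \<Longrightarrow> AE z in lborel. z \<in> ball y \<delta> \<longrightarrow> norm (f z) \<le> M \<Longrightarrow>
      AE z in lborel. u t z = f z \<Longrightarrow> ball_average f \<delta> y \<in> Hd \<delta> t y"
    by (rule filippov_hull_family[OF U]) (rule that)
  define \<pi> where "\<pi> = closest_point (cball (0 :: real ^ 'k) r)"
  have \<pi>_lip: "dist (\<pi> y) (\<pi> y') \<le> dist y y'" for y y'
    unfolding \<pi>_def using r by (intro closest_point_lipschitz) auto
  have \<pi>_in: "\<pi> y \<in> cball 0 r" for y
    unfolding \<pi>_def using r by (intro closest_point_in_set) auto
  have \<pi>_id: "\<pi> y = y" if "norm y \<le> r" for y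
    unfolding \<pi>_def using that by (intro closest_point_self) simp
  have \<pi>_cont: "continuous_on UNIV \<pi>"
    unfolding \<pi>_def using r by (intro continuous_on_closest_point) auto
  have ball_sub: "ball (\<pi> y) \<delta> \<subseteq> ball 0 (r + 2)" if "\<delta> \<le> 1" for y \<delta>
  proof
    fix z assume "z \<in> ball (\<pi> y) \<delta>"
    then show "z \<in> ball 0 (r + 2)"
      using \<pi>_in[of y] that dist_triangle[of 0 z "\<pi> y"] by simp
  qed
  define H where "H \<delta> t y = {v. v - \<gamma> t \<in> Hd \<delta> t (\<pi> y)}" for \<delta> t y
  define sel where "sel \<delta> t y = ball_average (\<lambda>z. g (t, z)) \<delta> (\<pi> y) + \<gamma> t" for \<delta> t y
  define m where "m t = real CARD('m) * \<bar>m0 t\<bar> + norm (\<gamma> t)" for t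
  have \<gamma>_int: "\<gamma> absolutely_integrable_on {a..\<beta>}" by (rule Linfty_absolutely_integrable[OF \<gamma>])
  have H_eq: "H \<delta> t y = (\<lambda>v. \<gamma> t + v) ` Hd \<delta> t (\<pi> y)" for \<delta> t y
    by (auto simp: H_def intro!: image_eqI[where x = "v - \<gamma> t" for v])
  have "utkin_cutoff \<Psi> B C a \<beta> H sel m \<gamma> U r"
  proof (intro utkin_cutoff.intro inclusion_system.intro control_semigroup.intro inclusion_system_axioms.intro utkin_cutoff_axioms.intro)
    show "m absolutely_integrable_on {a..\<beta>}"
      unfolding m_def
      by (intro set_integral_add set_integrable_mult_right set_integrable_abs set_integrable_norm \<gamma>_int set_integrable_subset[OF m0 _ \<alpha>(2)]) auto
    show "closed (H \<delta> t y)" for \<delta> t y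
      unfolding H_eq by (rule closed_translation[OF closed])
    show "convex (H \<delta> t y)" for \<delta> t y
      unfolding H_eq by (rule convex_translation[OF convex])
    show "H \<delta>' t y' \<subseteq> H \<delta> t y" if "0 < \<delta>'" "dist y' y + \<delta>' \<le> \<delta>" for \<delta>' y' y \<delta> t
    proof -
      have "ball (\<pi> y') \<delta>' \<subseteq> ball (\<pi> y) \<delta>"
      proof
        fix z assume "z \<in> ball (\<pi> y') \<delta>'"
        then show "z \<in> ball (\<pi> y) \<delta>"
          using \<pi>_lip[of y' y] that(2) dist_triangle[of "\<pi> y" z "\<pi> y'"] by (simp add: dist_commute)
      qed
      from mono[OF this] show ?thesis unfolding H_def by blast
    qed
    show "AE t in lebesgue. t \<in> {a..\<beta>} \<longrightarrow> (\<forall>y. \<forall>\<delta>. 0 < \<delta> \<and> \<delta> \<le> 1 \<longrightarrow> H \<delta> t y \<subseteq> cball 0 (m t))"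
      using um0
    proof eventually_elim
      case (elim t)
      show ?case
      proof (intro impI allI subsetI)
        fix y \<delta> v assume t: "t \<in> {a..\<beta>}" and \<delta>: "0 < \<delta> \<and> \<delta> \<le> (1::real)" and v: "v \<in> H \<delta> t y"
        have "AE z in lebesgue. z \<in> ball 0 (r + 2) \<longrightarrow> norm (u t z) \<le> m0 t" using elim t \<alpha>(2) by blast
        then have "AE z in lebesgue. z \<in> ball (\<pi> y) \<delta> \<longrightarrow> norm (u t z) \<le> m0 t"
          using ball_sub[of \<delta> y] \<delta> by (auto elim!: eventually_mono)
        from bound[OF this] have "norm (v - \<gamma> t) \<le> real CARD('m) * \<bar>m0 t\<bar>"
          using v unfolding H_def by auto
        then show "v \<in> cball 0 (m t)"
          using norm_triangle_sub[of v "\<gamma> t"] by (simp add: m_def)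
      qed
    qed
    show "(\<lambda>t. sel \<delta> t (\<eta> t)) \<in> borel_measurable lebesgue" if "0 < \<delta>" "\<delta> \<le> 1" "continuous_on UNIV \<eta>" for \<delta> \<eta>
    proof -
      have "continuous_on UNIV (\<lambda>t. \<pi> (\<eta> t))" by (rule continuous_on_compose2[OF \<pi>_cont that(3)]) auto
      from ball_average_measurable[OF g this that(1)] show ?thesis
        unfolding sel_def using \<gamma> by (intro borel_measurable_add) (auto simp: Linfty_def)
    qed
    show "AE t in lebesgue. t \<in> {a..\<beta>} \<longrightarrow> (\<forall>y. \<forall>\<delta>. 0 < \<delta> \<and> \<delta> \<le> 1 \<longrightarrow> sel \<delta> t y \<in> H \<delta> t y)"
      using um0 ug
    proof eventually_elim
      case (elim t)
      show ?case
      proof (intro impI allI)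
        fix y \<delta> assume t: "t \<in> {a..\<beta>}" and \<delta>: "0 < \<delta> \<and> \<delta> \<le> (1::real)"
        have "AE z in lebesgue. z \<in> ball 0 (r + 2) \<longrightarrow> norm (u t z) \<le> m0 t" using elim(1) t \<alpha>(2) by blast
        then have "AE z in lborel. z \<in> ball 0 (r + 2) \<longrightarrow> norm (u t z) \<le> m0 t" by (simp add: AE_completion_iff)
        with elim(2) have "AE z in lborel. z \<in> ball (\<pi> y) \<delta> \<longrightarrow> norm (g (t, z)) \<le> m0 t"
        proof eventually_elim
          case (elim z)
          then show ?case using subsetD[OF ball_sub[of \<delta> y]] \<delta> by metis
        qed
        from average[OF _ g_section this elim(2)] \<delta> show "sel \<delta> t y \<in> H \<delta> t y"
          by (simp add: H_def sel_def)
      qed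
    qed
    show "(\<Inter>\<delta>\<in>{0<..}. H \<delta> t y) = {v. v - \<gamma> t \<in> U t y}" if "norm y \<le> r" for y t
      using that by (auto simp: H_def INT \<pi>_id)
  qed (rule \<Psi> B C \<gamma>_int)+
  then show ?thesis by blast
qed

theorem corollary7:
  fixes D :: "'b::banach set" and A :: "'b \<Rightarrow> 'b" and \<Psi> :: "real \<Rightarrow> 'b \<Rightarrow> 'b"
    and B :: "real ^ 'm \<Rightarrow> 'b" and C :: "'b \<Rightarrow> real ^ 'k"
    and \<gamma> :: "real \<Rightarrow> real ^ 'm" and u :: "real \<Rightarrow> real ^ 'k \<Rightarrow> real ^ 'm"
    and U :: "real \<Rightarrow> real ^ 'k \<Rightarrow> (real ^ 'm) set"
    and t0 :: real and x0 :: 'b and T :: ereal and x :: "real \<Rightarrow> 'b" and J :: "real set"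
  assumes "linear_operator_on D A" and "closed_operator_on D A" and "closure D = UNIV"
    and "C0_semigroup \<Psi>" and "generates D A \<Psi>"
    and "bounded_linear B" and "bounded_linear C"
    and "Linfty \<gamma>"
    and "(\<lambda>(t, y). u t y) \<in> borel_measurable lebesgue"
    and "range B \<subseteq> domain_sq D A"
    and "filippov_condition u \<or> caratheodory_condition u"
    and "U = filippov_reg u \<or> U = filippov_reg_componentwise u"
    and "x0 \<in> D"
    and "is_interval J" and "t0 \<in> J" and "J \<subseteq> lifespan t0 T"
    and "utkin_solution \<Psi> B C \<gamma> U t0 x0 T x"
    and unique: "\<And>T' x'. utkin_solution \<Psi> B C \<gamma> U t0 x0 T' x' \<Longrightarrow>
                   \<forall>t\<in>J \<inter> lifespan t0 T'. x' t = x t"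
  shows "\<forall>K. compact K \<and> K \<subseteq> J \<longrightarrow>
    (\<forall>\<epsilon>>0. \<exists>\<delta>>0. \<forall>t1 x1.
       x1 \<in> D \<and> \<bar>t1 - t0\<bar> + norm (x1 - x0) + norm (A x1 - A x0) < \<delta> \<longrightarrow>
       (\<exists>T1 \<xi>. utkin_solution \<Psi> B C \<gamma> U t1 x1 T1 \<xi>) \<and>
       (\<forall>T1 \<xi>. utkin_solution \<Psi> B C \<gamma> U t1 x1 T1 \<xi> \<longrightarrow>
          (\<forall>t\<in>K \<inter> lifespan t1 T1. norm (\<xi> t - x t) < \<epsilon>) \<and>
          (\<exists>T2 \<zeta>. T1 \<le> T2 \<and> utkin_solution \<Psi> B C \<gamma> U t1 x1 T2 \<zeta> \<and>
                  (\<forall>t\<in>lifespan t1 T1. \<zeta> t = \<xi> t) \<and> K \<inter> {t1..} \<subseteq> lifespan t1 T2)))"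
proof (intro allI impI)
  fix K :: "real set" and \<epsilon> :: real
  assume "compact K \<and> K \<subseteq> J" and \<epsilon>: "\<epsilon> > 0"
  then have K: "compact K" "K \<subseteq> J" by simp_all
  have "\<exists>b\<in>insert t0 K. \<forall>t\<in>insert t0 K. t \<le> b"
    by (rule compact_attains_sup[OF compact_insert[OF K(1)] insert_not_empty])
  then obtain b where b: "b \<in> insert t0 K" "\<And>t. t \<in> insert t0 K \<Longrightarrow> t \<le> b" by blast
  have t0b: "t0 \<le> b" by (rule b(2)[OF insertI1])
  have "b \<in> J" using b(1) K(2) \<open>t0 \<in> J\<close> by auto
  then have seg: "{t0..b} \<subseteq> J"
    using mem_is_interval_1_I[OF \<open>is_interval J\<close> \<open>t0 \<in> J\<close>] by auto
  have K_range: "t0 \<le> t" "t \<le> b" if "t \<in> K" for t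
    using subsetD[OF \<open>J \<subseteq> lifespan t0 T\<close> subsetD[OF K(2) that]] b(2)[of t] that by (simp_all add: lifespan_def)
  have x: "x t0 = x0" "continuous_on (lifespan t0 T) x"
    using \<open>utkin_solution \<Psi> B C \<gamma> U t0 x0 T x\<close> unfolding utkin_solution_def by simp_all
  have "continuous_on {t0..b} (\<lambda>t. C (x t))"
    by (intro bounded_linear.continuous_on[OF \<open>bounded_linear C\<close>] continuous_on_subset[OF x(2)])
      (rule order.trans[OF seg \<open>J \<subseteq> lifespan t0 T\<close>])
  then have "bounded ((\<lambda>t. C (x t)) ` {t0..b})"
    by (intro compact_imp_bounded compact_continuous_image) auto
  then obtain R where R_image: "\<forall>z\<in>(\<lambda>t. C (x t)) ` {t0..b}. norm z \<le> R"
    unfolding bounded_iff by (elim exE)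
  have R: "norm (C (x t)) \<le> R" if "t \<in> {t0..b}" for t
    by (rule bspec[OF R_image imageI[OF that]])
  define r where "r = \<bar>R\<bar> + 1"
  have r: "0 < r" "R < r" by (auto simp: r_def)
  have "filippov_condition u"
    using assms(11)
  proof
    assume "caratheodory_condition u"
    then show ?thesis using assms(9) by (rule caratheodory_imp_filippov)
  qed
  from utkin_cutoff_exists[OF assms(4,6,7,8) this assms(12) r(1), of "t0 - 1" "b + 1"]
  obtain H sel m where "utkin_cutoff \<Psi> B C (t0 - 1) (b + 1) H sel m \<gamma> U r" by (elim exE)
  then interpret utkin_cutoff \<Psi> B C "t0 - 1" "b + 1" H sel m \<gamma> U r .
  have uniq: "x' t = x t" if "utkin_solution \<Psi> B C \<gamma> U t0 x0 T' x'" "t \<in> {t0..b}" "t \<in> lifespan t0 T'" for T' x' t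
    by (rule bspec[OF unique[OF that(1)]]) (use that(2,3) seg in blast)
  have "\<exists>\<delta>>0. \<forall>t1 x1. \<bar>t1 - t0\<bar> + norm (x1 - x0) < \<delta> \<longrightarrow>
    (\<exists>T1 \<xi>. utkin_solution \<Psi> B C \<gamma> U t1 x1 T1 \<xi>) \<and>
    (\<forall>T1 \<xi>. utkin_solution \<Psi> B C \<gamma> U t1 x1 T1 \<xi> \<longrightarrow>
      (\<forall>t\<in>lifespan t1 T1. t \<le> b \<longrightarrow> norm (\<xi> t - x (max t t0)) < \<epsilon>) \<and>
      (\<exists>T2 \<zeta>. T1 \<le> T2 \<and> utkin_solution \<Psi> B C \<gamma> U t1 x1 T2 \<zeta> \<and>
         (\<forall>t\<in>lifespan t1 T1. \<zeta> t = \<xi> t) \<and> {t1..b} \<subseteq> lifespan t1 T2))"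
    (is "\<exists>\<delta>>0. ?dependence \<delta>")
  proof (rule continuous_dependence[where R = R])
    show "x' t = x t" if "utkin_solution \<Psi> B C \<gamma> U t0 x0 T' x'" "t \<in> {t0..b}" "t \<in> lifespan t0 T'" for T' x' t
      using that by (rule uniq)
    show "norm (C (x t)) \<le> R" if "t \<in> {t0..b}" for t using that by (rule R)
  qed (use t0b x(1) r(2) \<epsilon> in simp_all)
  then obtain \<delta> where \<delta>: "\<delta> > 0" and dep: "?dependence \<delta>"
    by (elim exE conjE)
  show "\<exists>\<delta>>0. \<forall>t1 x1.
       x1 \<in> D \<and> \<bar>t1 - t0\<bar> + norm (x1 - x0) + norm (A x1 - A x0) < \<delta> \<longrightarrow>
       (\<exists>T1 \<xi>. utkin_solution \<Psi> B C \<gamma> U t1 x1 T1 \<xi>) \<and>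
       (\<forall>T1 \<xi>. utkin_solution \<Psi> B C \<gamma> U t1 x1 T1 \<xi> \<longrightarrow>
          (\<forall>t\<in>K \<inter> lifespan t1 T1. norm (\<xi> t - x t) < \<epsilon>) \<and>
          (\<exists>T2 \<zeta>. T1 \<le> T2 \<and> utkin_solution \<Psi> B C \<gamma> U t1 x1 T2 \<zeta> \<and>
                  (\<forall>t\<in>lifespan t1 T1. \<zeta> t = \<xi> t) \<and> K \<inter> {t1..} \<subseteq> lifespan t1 T2))"
  proof (intro exI[of _ \<delta>] conjI \<delta> allI impI)
    fix t1 x1
    assume "x1 \<in> D \<and> \<bar>t1 - t0\<bar> + norm (x1 - x0) + norm (A x1 - A x0) < \<delta>"
    then have close: "\<bar>t1 - t0\<bar> + norm (x1 - x0) < \<delta>"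
      using norm_ge_zero[of "A x1 - A x0"] by linarith
    note dep1 = dep[THEN spec, THEN spec, THEN mp, OF close]
    show "\<exists>T1 \<xi>. utkin_solution \<Psi> B C \<gamma> U t1 x1 T1 \<xi>" by (rule dep1[THEN conjunct1])
    fix T1 \<xi> assume \<xi>: "utkin_solution \<Psi> B C \<gamma> U t1 x1 T1 \<xi>"
    note dep3 = dep1[THEN conjunct2, THEN spec, THEN spec, THEN mp, OF \<xi>]
    show "\<forall>t\<in>K \<inter> lifespan t1 T1. norm (\<xi> t - x t) < \<epsilon>"
    proof
      fix t assume t: "t \<in> K \<inter> lifespan t1 T1"
      then have "norm (\<xi> t - x (max t t0)) < \<epsilon>" using dep3[THEN conjunct1] K_range(2)[of t] by simp
      moreover have "max t t0 = t" using K_range t by simp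
      ultimately show "norm (\<xi> t - x t) < \<epsilon>" by simp
    qed
    from dep3[THEN conjunct2] obtain T2 \<zeta> where \<zeta>: "T1 \<le> T2" "utkin_solution \<Psi> B C \<gamma> U t1 x1 T2 \<zeta>"
      "\<forall>t\<in>lifespan t1 T1. \<zeta> t = \<xi> t" "{t1..b} \<subseteq> lifespan t1 T2" by (elim exE conjE)
    have "K \<inter> {t1..} \<subseteq> {t1..b}" using K_range(2) by auto
    with \<zeta>(4) have "K \<inter> {t1..} \<subseteq> lifespan t1 T2" by (rule order.trans[rotated])
    with \<zeta> show "\<exists>T2 \<zeta>. T1 \<le> T2 \<and> utkin_solution \<Psi> B C \<gamma> U t1 x1 T2 \<zeta> \<and>
        (\<forall>t\<in>lifespan t1 T1. \<zeta> t = \<xi> t) \<and> K \<inter> {t1..} \<subseteq> lifespan t1 T2" by (intro exI conjI)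
  qed
qed

end
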